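(* Let $b,k,r\geq 2$ be integers with $r\geq k$ and $b\geq k$. Let $M$ be a matroid of rank $r$ with $b$ pairwise disjoint bases, and let $M^{\times k}_\Delta$ be its $k$-fold deleted product. (i) The connectivity of $M^{\times k}_\Delta$ is at least $r-2-\left\lfloor \frac{r(k-1)}{b}\right\rfloor$, i.e. $M^{\times k}_\Delta$ is $\left(r-2-\left\lfloor \frac{r(k-1)}{b}\right\rfloor\right)$-connected. (ii) If $b\geq r(k-1)+1$, then $M^{\times k}_\Delta$ is $(r-2)$-connected, but not $(r-1)$-connected.
   Context: A matroid is regarded as the simplicial complex of its independent sets, with geometric realization $|M|$; its rank is the cardinality of a basis. For a geometric simplicial complex $\Sigma$, the $k$-fold deleted product $\Sigma^{\times k}_\Delta$ is the subspace of $|\Sigma|^k$ which is the union of the products $\sigma_1\times\dots\times\sigma_k$ over all faces $\sigma_1,\dots,\sigma_k$ of $\Sigma$ with $\sigma_i\cap\sigma_j=\emptyset$ for $i\neq j$ (a CW complex with cells $\mathrm{relint}(\sigma_1)\times\dots\times\mathrm{relint}(\sigma_k)$). A space is $n$-connected if it is nonempty and $\pi_i=0$ for $0\le i\le n$. *)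

theory Defs
  imports "HOL-Analysis.Analysis"
begin

section \<open>Finite matroids\<close>

locale matroid =
  fixes E :: "'a set" and \<I> :: "'a set set"
  assumes finite_ground: "finite E"
    and indep_subset: "A \<in> \<I> \<Longrightarrow> A \<subseteq> E"
    and indep_empty: "{} \<in> \<I>"
    and indep_downward: "A \<in> \<I> \<Longrightarrow> B \<subseteq> A \<Longrightarrow> B \<in> \<I>"
    and indep_exchange: "A \<in> \<I> \<Longrightarrow> B \<in> \<I> \<Longrightarrow> card A < card B \<Longrightarrow> \<exists>x\<in>B - A. insert x A \<in> \<I>"

definition matroid_basis :: "'a set set \<Rightarrow> 'a set \<Rightarrow> bool" where
  "matroid_basis \<I> B \<longleftrightarrow> B \<in> \<I> \<and> (\<forall>A\<in>\<I>. B \<subseteq> A \<longrightarrow> A = B)"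

definition matroid_rank :: "'a set set \<Rightarrow> nat" where
  "matroid_rank \<I> = card (SOME B. matroid_basis \<I> B)"

lemma (in matroid) basis_exists: "\<exists>B. matroid_basis \<I> B"
proof -
  have "finite \<I>"
    using finite_ground indep_subset by (meson Pow_iff finite_Pow_iff finite_subset subsetI)
  then obtain B where "B \<in> \<I>" "\<forall>A\<in>\<I>. B \<subseteq> A \<longrightarrow> B = A"
    using finite_has_maximal[of \<I>] indep_empty by blast
  then show ?thesis
    unfolding matroid_basis_def by auto
qed

lemma (in matroid) basis_card_le:
  assumes "matroid_basis \<I> B" "matroid_basis \<I> C"
  shows "card C \<le> card B"
proof (rule ccontr)
  assume "\<not> card C \<le> card B"
  then obtain x where "x \<in> C - B" "insert x B \<in> \<I>"
    using indep_exchange[of B C] assms by (auto simp: matroid_basis_def)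
  then show False
    using assms(1) by (auto simp: matroid_basis_def)
qed

lemma (in matroid) matroid_rank_eq:
  assumes "matroid_basis \<I> B"
  shows "matroid_rank \<I> = card B"
  unfolding matroid_rank_def
  using assms basis_card_le someI_ex[OF basis_exists] by (meson le_antisym)

section \<open>Geometric realization and deleted products\<close>

text \<open>Simplicial complexes are given by their set of faces (including the empty face), and
  points by their barycentric coordinates. The vertices form an affinely independent family, so
  two closed simplices are disjoint exactly if their vertex sets are. The simplex of the empty face
  is empty.\<close>

definition simplex_on :: "'a set \<Rightarrow> ('a \<Rightarrow> real) set" where
  "simplex_on \<sigma> = {x. (\<forall>v. 0 \<le> x v) \<and> (\<forall>v. v \<notin> \<sigma> \<longrightarrow> x v = 0) \<and> sum x \<sigma> = 1}"

text \<open>The topology is that of pointwise convergence of barycentric coordinates; for a complex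
  with finitely many vertices this is the Euclidean topology.\<close>

definition realization :: "'a set set \<Rightarrow> ('a \<Rightarrow> real) topology" where
  "realization \<Sigma> = top_of_set (\<Union>\<sigma>\<in>\<Sigma>. simplex_on \<sigma>)"

text \<open>The \<open>k\<close> factors are indexed by \<open>{..<k}\<close>.\<close>

definition deleted_product :: "nat \<Rightarrow> 'a set set \<Rightarrow> (nat \<Rightarrow> 'a \<Rightarrow> real) topology" where
  "deleted_product k \<Sigma> =
     subtopology (product_topology (\<lambda>_. realization \<Sigma>) {..<k})
       (\<Union>\<sigma>\<in>{\<sigma>. (\<forall>i<k. \<sigma> i \<in> \<Sigma>) \<and> (\<forall>i<k. \<forall>j<k. i \<noteq> j \<longrightarrow> \<sigma> i \<inter> \<sigma> j = {})}.
          (\<Pi>\<^sub>E i\<in>{..<k}. simplex_on (\<sigma> i)))"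

section \<open>Homotopy groups and connectivity\<close>

definition cube :: "nat \<Rightarrow> (nat \<Rightarrow> real) topology" where
  "cube n = product_topology (\<lambda>_. top_of_set {0..1}) {..<n}"

definition cube_boundary :: "nat \<Rightarrow> (nat \<Rightarrow> real) set" where
  "cube_boundary n = {t \<in> topspace (cube n). \<exists>i<n. t i = 0 \<or> t i = 1}"

text \<open>The underlying set of \<open>\<pi>\<^sub>n(X, x\<^sub>0)\<close>: classes of maps
  of the \<open>n\<close>-cube to \<open>X\<close> sending the boundary to \<open>x\<^sub>0\<close>, up to homotopy through such maps.
  The group structure is not needed in order to say that it is trivial. The cube of dimension
  \<open>0\<close> is a point with empty boundary, so \<open>\<pi>\<^sub>0\<close> is the set of path components. Members are total
  functions and their values outside the cube are irrelevant: maps agreeing on the cube are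
  homotopic.\<close>

definition homotopy_set :: "nat \<Rightarrow> 'a topology \<Rightarrow> 'a \<Rightarrow> ((nat \<Rightarrow> real) \<Rightarrow> 'a) set set" where
  "homotopy_set n X x\<^sub>0 =
     {f. continuous_map (cube n) X f \<and> f ` cube_boundary n \<subseteq> {x\<^sub>0}} //
     {(f, g). homotopic_with (\<lambda>h. h ` cube_boundary n \<subseteq> {x\<^sub>0}) (cube n) X f g}"

text \<open>The integer \<open>n\<close> may be negative: \<open>(-1)\<close>-connected means nonempty. No base point is
  distinguished, so all of them are considered.\<close>

definition n_connected :: "int \<Rightarrow> 'a topology \<Rightarrow> bool" where
  "n_connected n X \<longleftrightarrow>
     topspace X \<noteq> {} \<and>
     (\<forall>i::nat. int i \<le> n \<longrightarrow> (\<forall>x\<^sub>0\<in>topspace X. is_singleton (homotopy_set i X x\<^sub>0)))"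

end

theory Submission
  imports Defs "HOL-Homology.Brouwer_Degree"
begin

text \<open>The projection of the \<open>(k + 1)\<close>-fold deleted product of \<open>M\<close> to the first \<open>k\<close> factors has
  as fibres the complexes of the deletions \<open>M - S\<close>, where \<open>S\<close> is the union of \<open>k\<close> disjoint independent
  sets. One of the \<open>b\<close> disjoint bases loses at most \<open>card S div b\<close> of its elements, which bounds the
  rank of \<open>M - S\<close>; and a matroid complex of rank \<open>r\<close> is \<open>(r - 2)\<close>-connected, by induction over
  deletions and contractions. Connectivity of the fibres lets one lift maps of cubes cell by cell
  along the projection after truncating small barycentric coordinates, whence (i). If
  \<open>M - S\<close> always has full rank, maps of an \<open>(r - 1)\<close>-sphere into the complex of \<open>M\<close> lift as well, up to truncation.
  For (ii) one lifts a map that is the identity over the simplex of one basis and avoids the interior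
  of this simplex elsewhere; it exists because there is a second, disjoint basis. Composing with the
  collapse of \<open>M\<close> onto an \<open>(r - 1)\<close>-sphere yields a map homotopic to the identity, which is not
  null-homotopic.\<close>

section \<open>Extension of maps from the boundary of a cube\<close>

text \<open>The projection is no fibration: its fibre, the complex of \<open>M - S\<close>, jumps
  whenever a barycentric coordinate of the other factors reaches zero. On a small cell, however, a
  vertex that is not positive on the whole cell has small weight there and vanishes under
  truncation, so only the others must be avoided. Faces of a cell avoid more vertices, hence the
  allowed complexes form a carrier that grows with the cell. A point and its truncation are joined
  by a segment inside one face, which later undoes the truncation. Connectivity is phrased
  throughout as extension of maps from the boundary of a cube, so that gluing replaces exact
  sequences. The number \<open>r * (k - 1)\<close> bounds the size of a union of
  \<open>k - 1\<close> independent sets. In (ii) no class in the deleted product is computed: its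
  first factor is followed into punctured Euclidean space, and the contradiction is a contractible
  sphere. Base points are a further obstacle there, because homotopy classes are those of maps
  constant on the boundary of a cube, while the lifted map lives on a whole sphere.\<close>

definition unit_cube :: "nat set \<Rightarrow> (nat \<Rightarrow> real) set" where
  "unit_cube J = {t. (\<forall>j\<in>J. 0 \<le> t j \<and> t j \<le> 1) \<and> (\<forall>j. j \<notin> J \<longrightarrow> t j = 0)}"

definition unit_cube_bd :: "nat set \<Rightarrow> (nat \<Rightarrow> real) set" where
  "unit_cube_bd J = {t \<in> unit_cube J. \<exists>j\<in>J. t j = 0 \<or> t j = 1}"

text \<open>For \<open>d > 0\<close> a map of a sphere, taken as the boundary of a cube, extends
  over the cube exactly if it is null-homotopic. For \<open>d = 0\<close> the boundary is empty, and
  the condition says that \<open>Y\<close> is nonempty.\<close>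

definition extendable :: "nat \<Rightarrow> 'b::topological_space set \<Rightarrow> bool" where
  "extendable d Y \<longleftrightarrow>
     (\<forall>J g. finite J \<and> card J = d \<and> continuous_on (unit_cube_bd J) g \<and> g ` unit_cube_bd J \<subseteq> Y \<longrightarrow>
       (\<exists>G. continuous_on (unit_cube J) G \<and> G ` unit_cube J \<subseteq> Y \<and> (\<forall>t\<in>unit_cube_bd J. G t = g t)))"

text \<open>For \<open>n > 0\<close> this is \<open>(n - 2)\<close>-connectedness. Cubes of dimension \<open>d\<close> are indexed by arbitrary sets
  of \<open>d\<close> coordinates, so that faces of cubes are cubes without any renumbering.\<close>

definition extendable_below :: "nat \<Rightarrow> 'b::topological_space set \<Rightarrow> bool" where
  "extendable_below n Y \<longleftrightarrow> (\<forall>d<n. extendable d Y)"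

lemma unit_cube_bd_subset: "unit_cube_bd J \<subseteq> unit_cube J"
  by (auto simp: unit_cube_bd_def)

lemma unit_cube_bd_empty [simp]: "unit_cube_bd {} = {}"
  by (auto simp: unit_cube_bd_def)

lemma unit_cube_nonempty: "unit_cube J \<noteq> {}"
  unfolding unit_cube_def by (rule ex_in_conv[THEN iffD1], rule exI[of _ "\<lambda>_. 0"]) simp

lemma continuous_on_coordinate: "continuous_on S (\<lambda>x. x i :: 'b::topological_space)"
  by (rule continuous_on_subset[OF continuous_on_product_coordinates subset_UNIV])

lemma continuous_on_coordinate_comp:
  fixes f :: "'a::topological_space \<Rightarrow> 'i \<Rightarrow> 'b::topological_space"
  shows "continuous_on S f \<Longrightarrow> continuous_on S (\<lambda>x. f x i)"
  by (rule continuous_on_product_then_coordinatewise)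

lemma continuous_on_Max:
  fixes f :: "'i \<Rightarrow> 'a::topological_space \<Rightarrow> real"
  assumes "finite J" "J \<noteq> {}" "\<And>j. j \<in> J \<Longrightarrow> continuous_on S (f j)"
  shows "continuous_on S (\<lambda>t. Max ((\<lambda>j. f j t) ` J))"
  using assms
proof (induction J rule: finite_ne_induct)
  case (singleton x)
  then show ?case by simp
next
  case (insert x F)
  then show ?case by (simp add: continuous_on_max)
qed

section \<open>Radial projection of a cube from its centre\<close>

definition sup_norm :: "nat set \<Rightarrow> (nat \<Rightarrow> real) \<Rightarrow> real" where
  "sup_norm J z = Max ((\<lambda>j. \<bar>z j\<bar>) ` J)"

definition centred :: "nat set \<Rightarrow> (nat \<Rightarrow> real) \<Rightarrow> nat \<Rightarrow> real" where
  "centred J t = (\<lambda>j. if j \<in> J then 2 * t j - 1 else 0)"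

text \<open>Moves a nonzero \<open>z\<close> along its ray to the boundary of the cube with
  coordinates in \<open>[-1, 1]\<close> and rescales to \<open>unit_cube J\<close>. Hence
  \<open>radial J (centred J t)\<close> is the projection of \<open>t\<close> from the centre of the
  unit cube.\<close>

definition radial :: "nat set \<Rightarrow> (nat \<Rightarrow> real) \<Rightarrow> nat \<Rightarrow> real" where
  "radial J z = (\<lambda>j. if j \<in> J then (1 + z j / sup_norm J z) / 2 else 0)"

lemma continuous_on_sup_norm:
  assumes "finite J" "J \<noteq> {}" "continuous_on S f"
  shows "continuous_on S (\<lambda>t. sup_norm J (f t))"
  unfolding sup_norm_def
  by (intro continuous_on_Max assms(1,2) continuous_on_rabs continuous_on_coordinate_comp[OF assms(3)])

lemma continuous_on_centred:
  assumes "continuous_on S f"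
  shows "continuous_on S (\<lambda>t. centred J (f t))"
proof (rule continuous_on_coordinatewise_then_product)
  fix i show "continuous_on S (\<lambda>t. centred J (f t) i)"
    by (cases "i \<in> J"; simp add: centred_def)
      (intro continuous_on_diff continuous_on_mult continuous_on_const continuous_on_coordinate_comp[OF assms])
qed

lemma sup_norm_ge:
  "finite J \<Longrightarrow> j \<in> J \<Longrightarrow> \<bar>z j\<bar> \<le> sup_norm J z"
  unfolding sup_norm_def by simp

lemma sup_norm_attained:
  assumes "finite J" "J \<noteq> {}"
  obtains j where "j \<in> J" "\<bar>z j\<bar> = sup_norm J z"
proof -
  have "Max ((\<lambda>j. \<bar>z j\<bar>) ` J) \<in> (\<lambda>j. \<bar>z j\<bar>) ` J" using assms by (intro Max_in) auto
  then show ?thesis using that unfolding sup_norm_def by auto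
qed

lemma sup_norm_pos:
  assumes "finite J" "j \<in> J" "z j \<noteq> 0"
  shows "0 < sup_norm J z"
  using sup_norm_ge[OF assms(1,2), of z] assms(3) by linarith

lemma continuous_on_radial:
  assumes "finite J" "continuous_on S f" "\<And>t. t \<in> S \<Longrightarrow> \<exists>j\<in>J. f t j \<noteq> 0"
  shows "continuous_on S (\<lambda>t. radial J (f t))"
proof (rule continuous_on_coordinatewise_then_product)
  fix i
  have ne: "sup_norm J (f t) \<noteq> 0" if "t \<in> S" for t
    using assms(3)[OF that] sup_norm_pos[OF assms(1)] by (metis less_irrefl)
  show "continuous_on S (\<lambda>t. radial J (f t) i)"
  proof (cases "i \<in> J")
    case True
    then have "J \<noteq> {}" by blast
    then have "continuous_on S (\<lambda>t. (1 + f t i / sup_norm J (f t)) / 2)"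
      using ne assms(1,2)
      by (intro continuous_on_divide continuous_on_add continuous_on_const continuous_on_sup_norm
          continuous_on_coordinate_comp[OF assms(2)]) auto
    then show ?thesis using True by (simp add: radial_def)
  qed (simp add: radial_def)
qed

lemma radial_in_bd:
  assumes J: "finite J" and z: "\<exists>j\<in>J. z j \<noteq> 0"
  shows "radial J z \<in> unit_cube_bd J"
proof -
  obtain j where j: "j \<in> J" "\<bar>z j\<bar> = sup_norm J z" using sup_norm_attained[OF J] z by blast
  have pos: "0 < sup_norm J z" using z sup_norm_pos[OF J] by blast
  have "\<bar>z i / sup_norm J z\<bar> \<le> 1" if "i \<in> J" for i
    using sup_norm_ge[OF J that, of z] pos by (simp add: abs_divide)
  then have "-1 \<le> z i / sup_norm J z \<and> z i / sup_norm J z \<le> 1" if "i \<in> J" for i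
    using that by (metis abs_le_D1 abs_le_D2 minus_le_iff)
  then have "radial J z \<in> unit_cube J" unfolding unit_cube_def radial_def by force
  moreover have "z j / sup_norm J z = 1 \<or> z j / sup_norm J z = -1"
    using j(2) pos by (auto simp: abs_if field_simps split: if_splits)
  then have "radial J z j = 1 \<or> radial J z j = 0" using j(1) by (auto simp: radial_def)
  ultimately show ?thesis using j(1) by (auto simp: unit_cube_bd_def)
qed

lemma sup_norm_centred_le_1:
  assumes "finite J" "J \<noteq> {}" "t \<in> unit_cube J"
  shows "sup_norm J (centred J t) \<le> 1"
proof -
  obtain j where j: "j \<in> J" "\<bar>centred J t j\<bar> = sup_norm J (centred J t)"
    using sup_norm_attained[OF assms(1,2)] by blast
  have "\<bar>centred J t j\<bar> \<le> 1" using assms(3) j(1) by (auto simp: centred_def unit_cube_def abs_le_iff)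
  then show ?thesis using j by simp
qed

lemma sup_norm_centred_bd:
  assumes "finite J" "t \<in> unit_cube_bd J"
  shows "sup_norm J (centred J t) = 1"
proof -
  obtain j where j: "j \<in> J" "t j = 0 \<or> t j = 1" "t \<in> unit_cube J"
    using assms(2) by (auto simp: unit_cube_bd_def)
  then have "\<bar>centred J t j\<bar> = 1" by (auto simp: centred_def)
  then show ?thesis using sup_norm_ge[OF assms(1) j(1), of "centred J t"]
      sup_norm_centred_le_1[OF assms(1) _ j(3)] j(1) by force
qed

lemma radial_centred:
  assumes "finite J" "t \<in> unit_cube_bd J"
  shows "radial J (centred J t) = t"
  using sup_norm_centred_bd[OF assms] assms(2)
  by (auto simp: radial_def centred_def unit_cube_bd_def unit_cube_def fun_eq_iff)

lemma centred_radial: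
  assumes "j \<in> J"
  shows "centred J (radial J z) j = z j / sup_norm J z"
  using assms by (simp add: centred_def radial_def add_divide_distrib)

text \<open>The concentric cube of half the side carries \<open>H\<close>, and the collar around it
  carries the homotopy \<open>F\<close>, read along rays from the centre. Thus a map on the boundary
  may be replaced by a homotopic one before it is extended.\<close>

lemma homotopy_extension_unit_cube:
  fixes F :: "real \<times> (nat \<Rightarrow> real) \<Rightarrow> 'b::topological_space"
  assumes J: "finite J"
    and F: "continuous_on ({0..1} \<times> unit_cube_bd J) F" "F ` ({0..1} \<times> unit_cube_bd J) \<subseteq> Y"
    and H: "continuous_on (unit_cube J) H" "H ` unit_cube J \<subseteq> Y"
    and FH: "\<And>t. t \<in> unit_cube_bd J \<Longrightarrow> F (1, t) = H t"
  shows "\<exists>G. continuous_on (unit_cube J) G \<and> G ` unit_cube J \<subseteq> Y \<and> (\<forall>t\<in>unit_cube_bd J. G t = F (0, t))"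
proof (cases "J = {}")
  case True
  then show ?thesis using H by (intro exI[of _ H]) simp
next
  case False
  define m where "m t = sup_norm J (centred J t)" for t
  \<comment> \<open>This is \<open>2 * t j - 1/2\<close>, the rescaling of the inner cube to the
    full one.\<close>
  define c where "c t = (\<lambda>j. if j \<in> J then 1/2 + centred J t j else 0)" for t
  \<comment> \<open>The parameter \<open>2 - 2 * m t\<close> runs from 1 at the inner cube to 0 at
    the outer boundary.\<close>
  define G where "G t = (if m t \<le> 1/2 then H (c t) else F (2 - 2 * m t, radial J (centred J t)))" for t
  have m: "continuous_on S m" for S
    unfolding m_def by (intro continuous_on_sup_norm continuous_on_centred J False continuous_on_id)
  have cin: "c t \<in> unit_cube J" if "m t \<le> 1/2" for t
  proof -
    have le: "\<bar>centred J t j\<bar> \<le> 1/2" if "j \<in> J" for j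
      using sup_norm_ge[OF J that, of "centred J t"] \<open>m t \<le> 1/2\<close> by (simp add: m_def)
    have "0 \<le> 1/2 + centred J t j \<and> 1/2 + centred J t j \<le> 1" if "j \<in> J" for j
      using le[OF that] by linarith
    then show ?thesis by (simp add: c_def unit_cube_def)
  qed
  have nz: "\<exists>j\<in>J. centred J t j \<noteq> 0" if "1/2 \<le> m t" for t
    using sup_norm_attained[OF J False, of "centred J t"] that unfolding m_def
    by (metis abs_zero divide_le_0_1_iff not_numeral_le_zero)
  have c: "continuous_on S c" for S
  proof (rule continuous_on_coordinatewise_then_product)
    fix i show "continuous_on S (\<lambda>t. c t i)"
      by (cases "i \<in> J"; simp add: c_def centred_def) (intro continuous_intros continuous_on_coordinate)
  qed
  have rin: "(2 - 2 * m t, radial J (centred J t)) \<in> {0..1} \<times> unit_cube_bd J"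
    if "1/2 \<le> m t" "t \<in> unit_cube J" for t
    using that sup_norm_centred_le_1[OF J False that(2)] radial_in_bd[OF J nz[OF that(1)]] by (auto simp: m_def)
  have mid: "H (c t) = F (2 - 2 * m t, radial J (centred J t))" if "m t = 1/2" for t
  proof -
    have "c t = radial J (centred J t)"
      using that by (auto simp: c_def radial_def m_def fun_eq_iff field_simps)
    moreover have "2 - 2 * m t = 1" using that by simp
    ultimately show ?thesis using FH[OF radial_in_bd[OF J nz, of t]] that by (metis order_refl)
  qed
  have "continuous_on (unit_cube J) G"
    unfolding G_def
  proof (rule continuous_on_cases_le[OF _ _ m mid])
    show "continuous_on {t \<in> unit_cube J. m t \<le> 1/2} (\<lambda>t. H (c t))"
      by (rule continuous_on_compose2[OF H(1) c]) (use cin in blast)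
    have "continuous_on {t \<in> unit_cube J. 1/2 \<le> m t} (\<lambda>t. radial J (centred J t))"
      by (intro continuous_on_radial J continuous_on_centred continuous_on_id nz) simp
    then have "continuous_on {t \<in> unit_cube J. 1/2 \<le> m t} (\<lambda>t. (2 - 2 * m t, radial J (centred J t)))"
      by (intro continuous_on_Pair continuous_on_diff continuous_on_mult continuous_on_const m)
    then show "continuous_on {t \<in> unit_cube J. 1/2 \<le> m t} (\<lambda>t. F (2 - 2 * m t, radial J (centred J t)))"
      by (rule continuous_on_compose2[OF F(1)]) (use rin in blast)
  qed auto
  moreover have "G ` unit_cube J \<subseteq> Y"
  proof (rule image_subsetI)
    fix t assume t: "t \<in> unit_cube J"
    show "G t \<in> Y"
    proof (cases "m t \<le> 1/2")
      case True
      then show ?thesis using H(2) cin by (simp add: G_def image_subset_iff)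
    next
      case False
      then have "1/2 \<le> m t" by simp
      then show ?thesis using F(2) rin[OF _ t] False by (simp only: G_def if_False image_subset_iff)
    qed
  qed
  moreover have "G t = F (0, t)" if "t \<in> unit_cube_bd J" for t
    using sup_norm_centred_bd[OF J that] radial_centred[OF J that] by (simp add: G_def m_def)
  ultimately show ?thesis by (intro exI[of _ G] conjI ballI)
qed

lemma extendableD:
  assumes "extendable d Y" "finite J" "card J = d" "continuous_on (unit_cube_bd J) g" "g ` unit_cube_bd J \<subseteq> Y"
  shows "\<exists>G. continuous_on (unit_cube J) G \<and> G ` unit_cube J \<subseteq> Y \<and> (\<forall>t\<in>unit_cube_bd J. G t = g t)"
  using assms(1)[unfolded extendable_def, rule_format, of J g] assms(2-) by simp

lemma extendableI:
  assumes "\<And>J g. \<lbrakk>finite J; card J = d; continuous_on (unit_cube_bd J) g; g ` unit_cube_bd J \<subseteq> Y\<rbrakk> \<Longrightarrow>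
    \<exists>G. continuous_on (unit_cube J) G \<and> G ` unit_cube J \<subseteq> Y \<and> (\<forall>t\<in>unit_cube_bd J. G t = g t)"
  shows "extendable d Y"
  unfolding extendable_def by (intro allI impI, elim conjE, rule assms)

lemma extendable_0: "extendable 0 Y \<longleftrightarrow> Y \<noteq> {}"
proof
  assume "extendable 0 Y"
  then obtain G where "G ` unit_cube {} \<subseteq> Y"
    using extendableD[of 0 Y "{}" undefined] by auto
  then show "Y \<noteq> {}" using unit_cube_nonempty by fastforce
next
  assume "Y \<noteq> {}"
  then obtain y where y: "y \<in> Y" by blast
  show "extendable 0 Y"
  proof (rule extendableI)
    fix J :: "nat set" and g :: "(nat \<Rightarrow> real) \<Rightarrow> 'a"
    assume "finite J" "card J = 0"
    then show "\<exists>G. continuous_on (unit_cube J) G \<and> G ` unit_cube J \<subseteq> Y \<and> (\<forall>t\<in>unit_cube_bd J. G t = g t)"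
      using y by (intro exI[of _ "\<lambda>_. y"]) auto
  qed
qed

text \<open>Following the contraction makes the boundary map constant, and a constant map
  extends.\<close>

lemma extendable_contractible:
  fixes Y :: "'b::topological_space set"
  assumes y: "y \<in> Y" and h: "continuous_on ({0..1} \<times> Y) h" "h ` ({0..1::real} \<times> Y) \<subseteq> Y"
    and h0: "\<And>x. x \<in> Y \<Longrightarrow> h (0, x) = x" and h1: "\<And>x. x \<in> Y \<Longrightarrow> h (1, x) = y"
  shows "extendable d Y"
proof (rule extendableI)
  fix J :: "nat set" and g :: "(nat \<Rightarrow> real) \<Rightarrow> 'b"
  assume J: "finite J" and g: "continuous_on (unit_cube_bd J) g" "g ` unit_cube_bd J \<subseteq> Y"
  have "\<exists>G. continuous_on (unit_cube J) G \<and> G ` unit_cube J \<subseteq> Y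
    \<and> (\<forall>t\<in>unit_cube_bd J. G t = (\<lambda>(s, t). h (s, g t)) (0, t))"
  proof (rule homotopy_extension_unit_cube[OF J, where H = "\<lambda>_. y"])
    show "continuous_on ({0..1} \<times> unit_cube_bd J) (\<lambda>(s, t). h (s, g t))"
      unfolding case_prod_unfold
      by (rule continuous_on_compose2[OF h(1)])
        (use g(2) in \<open>auto intro!: continuous_on_Pair continuous_on_fst continuous_on_snd continuous_on_id
          continuous_on_compose2[OF g(1), of _ snd]\<close>)
    show "(\<lambda>(s, t). h (s, g t)) ` ({0..1} \<times> unit_cube_bd J) \<subseteq> Y"
      using h(2) g(2) by (auto simp: image_subset_iff)
  qed (use y g(2) h1 in auto)
  then obtain G where G: "continuous_on (unit_cube J) G" "G ` unit_cube J \<subseteq> Y"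
    "\<And>t. t \<in> unit_cube_bd J \<Longrightarrow> G t = h (0, g t)" by auto
  show "\<exists>G. continuous_on (unit_cube J) G \<and> G ` unit_cube J \<subseteq> Y \<and> (\<forall>t\<in>unit_cube_bd J. G t = g t)"
  proof (intro exI conjI ballI)
    fix t assume t: "t \<in> unit_cube_bd J"
    then have "g t \<in> Y" using g(2) by blast
    then show "G t = g t" using G(3)[OF t] h0 by simp
  qed (use G in auto)
qed

section \<open>Maps with prescribed carriers\<close>

text \<open>Obstruction theory in carrier form: cells are attached one at a time, and monotonicity
  of \<open>C\<close> puts the map already built on \<open>bd e\<close> into \<open>C e\<close>. The
  function \<open>dim\<close> only orders the cells. The set \<open>\<A>\<close> of cells with
  prescribed values is closed under faces, so a new cell meets them in its boundary only.\<close>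

lemma carrier_extension:
  fixes cell bd :: "'c \<Rightarrow> 'x::topological_space set" and C :: "'c \<Rightarrow> 'y::topological_space set"
    and dim :: "'c \<Rightarrow> nat"
  assumes fin: "finite \<C>"
    and closed: "\<And>e. e \<in> \<C> \<Longrightarrow> closed (cell e)"
    and bd: "\<And>e. e \<in> \<C> \<Longrightarrow> bd e \<subseteq> cell e"
    and faces: "\<And>e x. e \<in> \<C> \<Longrightarrow> x \<in> bd e \<Longrightarrow> \<exists>e'\<in>\<C>. x \<in> cell e' \<and> cell e' \<subseteq> cell e \<and> dim e' < dim e"
    and inter: "\<And>e e'. e \<in> \<C> \<Longrightarrow> e' \<in> \<C> \<Longrightarrow> cell e \<subseteq> cell e' \<or> cell e \<inter> cell e' \<subseteq> bd e"
    and dim: "\<And>e e'. e \<in> \<C> \<Longrightarrow> e' \<in> \<C> \<Longrightarrow> cell e' \<subseteq> cell e \<Longrightarrow> e' = e \<or> dim e' < dim e"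
    and mono: "\<And>e e'. e \<in> \<C> \<Longrightarrow> e' \<in> \<C> \<Longrightarrow> cell e' \<subseteq> cell e \<Longrightarrow> C e' \<subseteq> C e"
    and ext: "\<And>e g. e \<in> \<C> - \<A> \<Longrightarrow> continuous_on (bd e) g \<Longrightarrow> g ` bd e \<subseteq> C e \<Longrightarrow>
      \<exists>G. continuous_on (cell e) G \<and> G ` cell e \<subseteq> C e \<and> (\<forall>x\<in>bd e. G x = g x)"
    and sub: "\<A> \<subseteq> \<C>"
    and down: "\<And>e e'. e' \<in> \<A> \<Longrightarrow> e \<in> \<C> \<Longrightarrow> cell e \<subseteq> cell e' \<Longrightarrow> e \<in> \<A>"
    and g: "continuous_on (\<Union>(cell ` \<A>)) g" "\<And>e. e \<in> \<A> \<Longrightarrow> g ` cell e \<subseteq> C e"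
  shows "\<exists>G. continuous_on (\<Union>(cell ` \<C>)) G \<and> (\<forall>e\<in>\<C>. G ` cell e \<subseteq> C e) \<and> (\<forall>x\<in>\<Union>(cell ` \<A>). G x = g x)"
  using ext sub down g
proof (induction "card (\<C> - \<A>)" arbitrary: \<A> g)
  case 0
  then have "\<A> = \<C>" using fin by (metis Diff_eq_empty_iff card_0_eq finite_Diff subset_antisym)
  then show ?case using 0 by (intro exI[of _ g]) simp
next
  case (Suc n)
  have ne: "\<C> - \<A> \<noteq> {}" using Suc.hyps(2) by (metis card.empty nat.distinct(1))
  \<comment> \<open>A missing cell of least dimension has all its proper faces in
    \<open>\<A>\<close>, so the map is already defined on all of \<open>bd e\<close>.\<close>
  define e where "e = arg_min_on dim (\<C> - \<A>)"
  have e: "e \<in> \<C> - \<A>" unfolding e_def by (rule arg_min_if_finite) (use fin ne in auto)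
  have min: "dim e \<le> dim e'" if "e' \<in> \<C> - \<A>" for e'
    unfolding e_def by (rule arg_min_least) (use fin ne that in auto)
  have lower: "e' \<in> \<A>" if "e' \<in> \<C>" "dim e' < dim e" for e'
    using min[of e'] that by auto
  let ?U = "\<Union>(cell ` \<A>)"
  have bdU: "bd e \<subseteq> ?U"
    using faces[of e] lower e by blast
  \<comment> \<open>No cell of \<open>\<A>\<close> contains the new one, since \<open>\<A>\<close>
    is closed under faces; so \<open>inter\<close> leaves only the second alternative.\<close>
  have UI: "cell e \<inter> ?U \<subseteq> bd e"
  proof
    fix x assume "x \<in> cell e \<inter> ?U"
    then obtain e' where e': "e' \<in> \<A>" "x \<in> cell e" "x \<in> cell e'" by blast
    then have "e' \<in> \<C>" "\<not> cell e \<subseteq> cell e'" using Suc.prems(2,3) e by auto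
    then show "x \<in> bd e" using inter[of e e'] e e' by blast
  qed
  have bdC: "g ` bd e \<subseteq> C e"
  proof (rule image_subsetI)
    fix x assume "x \<in> bd e"
    then obtain e' where "e' \<in> \<C>" "x \<in> cell e'" "cell e' \<subseteq> cell e" "dim e' < dim e"
      using faces[of e] e by blast
    moreover from this have "g ` cell e' \<subseteq> C e'" using lower Suc.prems(5) by blast
    ultimately show "g x \<in> C e" using mono[of e e'] e by blast
  qed
  have "continuous_on (bd e) g" using Suc.prems(4) bdU by (rule continuous_on_subset)
  from Suc.prems(1)[OF e this bdC] obtain G where
    G: "continuous_on (cell e) G" "G ` cell e \<subseteq> C e" "\<forall>x\<in>bd e. G x = g x" by blast
  define h where "h x = (if x \<in> cell e then G x else g x)" for x
  have hG: "h x = G x" if "x \<in> cell e" for x using that by (simp add: h_def)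
  have hg: "h x = g x" if "x \<in> ?U" for x
    using that G(3) UI by (auto simp: h_def)
  have clU: "closed ?U" using Suc.prems(2) fin closed by (intro closed_Union) (auto intro: finite_subset)
  have cont: "continuous_on (cell e \<union> ?U) h"
  proof (rule continuous_on_closed_Un)
    show "closed (cell e)" using closed e by blast
    show "continuous_on (cell e) h" using G(1) hG by (simp cong: continuous_on_cong)
    show "continuous_on ?U h" using Suc.prems(4) hg continuous_on_cong by (metis (no_types, lifting))
  qed (rule clU)
  have U': "\<Union>(cell ` insert e \<A>) = cell e \<union> ?U" by blast
  have "\<exists>G. continuous_on (\<Union>(cell ` \<C>)) G \<and> (\<forall>e\<in>\<C>. G ` cell e \<subseteq> C e)
    \<and> (\<forall>x\<in>\<Union>(cell ` insert e \<A>). G x = h x)"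
  proof (rule Suc.hyps(1))
    have "\<C> - insert e \<A> = (\<C> - \<A>) - {e}" by blast
    then show "n = card (\<C> - insert e \<A>)" using Suc.hyps(2) e fin by simp
    show "insert e \<A> \<subseteq> \<C>" using e Suc.prems(2) by blast
    show "continuous_on (\<Union>(cell ` insert e \<A>)) h" using cont U' by simp
    show "\<And>e'. e' \<in> insert e \<A> \<Longrightarrow> h ` cell e' \<subseteq> C e'"
    proof -
      fix e' assume e': "e' \<in> insert e \<A>"
      show "h ` cell e' \<subseteq> C e'"
      proof (cases "e' = e")
        case True
        then show ?thesis using G(2) hG by auto
      next
        case False
        then have "e' \<in> \<A>" using e' by blast
        moreover from this have "h x = g x" if "x \<in> cell e'" for x using that hg by blast
        ultimately show ?thesis using Suc.prems(5) by auto
      qed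
    qed
    show "\<And>e'' e'. e' \<in> insert e \<A> \<Longrightarrow> e'' \<in> \<C> \<Longrightarrow> cell e'' \<subseteq> cell e' \<Longrightarrow> e'' \<in> insert e \<A>"
      using dim[of e] lower Suc.prems(3) e by blast
    show "\<And>e' g. e' \<in> \<C> - insert e \<A> \<Longrightarrow> continuous_on (bd e') g \<Longrightarrow> g ` bd e' \<subseteq> C e' \<Longrightarrow>
      \<exists>G. continuous_on (cell e') G \<and> G ` cell e' \<subseteq> C e' \<and> (\<forall>x\<in>bd e'. G x = g x)"
      by (rule Suc.prems(1)) simp_all
  qed
  then obtain G' where G': "continuous_on (\<Union>(cell ` \<C>)) G'" "\<forall>e\<in>\<C>. G' ` cell e \<subseteq> C e"
    "\<forall>x\<in>\<Union>(cell ` insert e \<A>). G' x = h x" by blast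
  show ?case
  proof (intro exI conjI)
    show "\<forall>x\<in>?U. G' x = g x" using G'(3) hg by simp
  qed (use G' in auto)
qed

section \<open>Grid subdivisions of the unit cube\<close>

definition grid :: "nat \<Rightarrow> nat set \<Rightarrow> ((nat \<Rightarrow> nat) \<times> nat set) set" where
  "grid N J = {(a, F). F \<subseteq> J \<and> (\<forall>j\<in>F. a j < N) \<and> (\<forall>j\<in>J. a j \<le> N) \<and> (\<forall>j. j \<notin> J \<longrightarrow> a j = 0)}"

text \<open>For \<open>e = (a, F)\<close> this is the product of the intervals from
  \<open>a j / N\<close> to \<open>(a j + 1) / N\<close> for \<open>j \<in> F\<close> with the
  points \<open>a j / N\<close> for all other \<open>j\<close>. So \<open>card F\<close> is its
  dimension.\<close>

definition grid_cell :: "nat \<Rightarrow> (nat \<Rightarrow> nat) \<times> nat set \<Rightarrow> (nat \<Rightarrow> real) set" where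
  "grid_cell N e = {t. \<forall>j. real (fst e j) \<le> N * t j \<and>
     (if j \<in> snd e then N * t j \<le> real (fst e j) + 1 else N * t j = real (fst e j))}"

definition grid_cell_bd :: "nat \<Rightarrow> (nat \<Rightarrow> nat) \<times> nat set \<Rightarrow> (nat \<Rightarrow> real) set" where
  "grid_cell_bd N e = {t \<in> grid_cell N e. \<exists>j\<in>snd e. N * t j = real (fst e j) \<or> N * t j = real (fst e j) + 1}"

definition cubical :: "nat \<Rightarrow> nat set \<Rightarrow> (nat \<Rightarrow> real) set \<Rightarrow> bool" where
  "cubical N J D \<longleftrightarrow> (\<forall>t\<in>D. \<exists>e\<in>grid N J. t \<in> grid_cell N e \<and> grid_cell N e \<subseteq> D)"

lemma mem_grid_cell:
  "t \<in> grid_cell N (a, F) \<longleftrightarrow>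
    (\<forall>j. real (a j) \<le> N * t j \<and> (if j \<in> F then N * t j \<le> real (a j) + 1 else N * t j = real (a j)))"
  by (simp add: grid_cell_def)

lemma finite_grid:
  assumes "finite J"
  shows "finite (grid N J)"
proof (rule finite_subset)
  show "grid N J \<subseteq> {a. \<forall>j. (j \<in> J \<longrightarrow> a j \<in> {..N}) \<and> (j \<notin> J \<longrightarrow> a j = 0)} \<times> Pow J"
    by (auto simp: grid_def)
  show "finite ({a. \<forall>j. (j \<in> J \<longrightarrow> a j \<in> {..N}) \<and> (j \<notin> J \<longrightarrow> a j = 0)} \<times> Pow J)"
    using finite_set_of_finite_funs[OF assms, of "{..N}" 0] assms by simp
qed

lemma closed_grid_cell: "closed (grid_cell N e)"
proof -
  have c: "continuous_on UNIV (\<lambda>t :: nat \<Rightarrow> real. real N * t j)" for j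
    by (intro continuous_on_mult continuous_on_const continuous_on_coordinate)
  have "closed {t :: nat \<Rightarrow> real. real (fst e j) \<le> N * t j \<and>
     (if j \<in> snd e then N * t j \<le> real (fst e j) + 1 else N * t j = real (fst e j))}" for j
    using c by (cases "j \<in> snd e"; simp only: if_True if_False)
      (intro closed_Collect_conj closed_Collect_le closed_Collect_eq continuous_on_const; simp)+
  then show ?thesis
    unfolding grid_cell_def by (rule closed_Collect_all)
qed

lemma grid_cell_extend:
  fixes g :: "(nat \<Rightarrow> real) \<Rightarrow> 'b::topological_space"
  assumes N: "N > 0" and fin: "finite (snd e)" and ext: "extendable (card (snd e)) Y"
    and g: "continuous_on (grid_cell_bd N e) g" "g ` grid_cell_bd N e \<subseteq> Y"
  shows "\<exists>G. continuous_on (grid_cell N e) G \<and> G ` grid_cell N e \<subseteq> Y \<and> (\<forall>x\<in>grid_cell_bd N e. G x = g x)"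
proof -
  define p where "p s = (\<lambda>j. (real (fst e j) + s j) / N)" for s :: "nat \<Rightarrow> real"
  define q where "q t = (\<lambda>j. N * t j - real (fst e j))" for t :: "nat \<Rightarrow> real"
  have p: "continuous_on S p" for S unfolding p_def using N
    by (intro continuous_on_coordinatewise_then_product continuous_on_divide continuous_on_add
        continuous_on_const continuous_on_coordinate) simp
  have q: "continuous_on S q" for S unfolding q_def
    by (intro continuous_on_coordinatewise_then_product continuous_on_diff continuous_on_mult
        continuous_on_const continuous_on_coordinate)
  have pq: "p (q t) = t" for t using N by (simp add: p_def q_def)
  have Np: "N * p s j = real (fst e j) + s j" for s j using N by (simp add: p_def)
  have pbd: "p s \<in> grid_cell_bd N e" if "s \<in> unit_cube_bd (snd e)" for s
    using that by (auto simp: unit_cube_bd_def unit_cube_def grid_cell_bd_def grid_cell_def Np)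
  have qc: "q t \<in> unit_cube (snd e)" if "t \<in> grid_cell N e" for t
    unfolding unit_cube_def mem_Collect_eq
  proof (intro conjI ballI allI impI)
    fix j
    have 1: "real (fst e j) \<le> N * t j \<and>
     (if j \<in> snd e then N * t j \<le> real (fst e j) + 1 else N * t j = real (fst e j))" 
      using that unfolding grid_cell_def by blast
    { assume "j \<in> snd e" then show "0 \<le> q t j" using 1 by (simp add: q_def) }
    { assume "j \<in> snd e" then show "q t j \<le> 1" using 1 by (simp add: q_def) }
    { assume "j \<notin> snd e" then show "q t j = 0" using 1 by (simp add: q_def) }
  qed
  have qbd: "q t \<in> unit_cube_bd (snd e)" if "t \<in> grid_cell_bd N e" for t
  proof -
    have t: "t \<in> grid_cell N e" and "\<exists>j\<in>snd e. N * t j = real (fst e j) \<or> N * t j = real (fst e j) + 1"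
      using that unfolding grid_cell_bd_def by blast+
    then have "\<exists>j\<in>snd e. q t j = 0 \<or> q t j = 1" unfolding q_def by (metis add_diff_cancel_left' diff_self)
    then show ?thesis using qc[OF t] by (simp add: unit_cube_bd_def)
  qed
  have "\<exists>G. continuous_on (unit_cube (snd e)) G \<and> G ` unit_cube (snd e) \<subseteq> Y
    \<and> (\<forall>s\<in>unit_cube_bd (snd e). G s = g (p s))"
  proof (rule extendableD[OF ext fin refl])
    show "continuous_on (unit_cube_bd (snd e)) (\<lambda>s. g (p s))"
      by (rule continuous_on_compose2[OF g(1) p]) (use pbd in auto)
    show "(\<lambda>s. g (p s)) ` unit_cube_bd (snd e) \<subseteq> Y"
      using pbd g(2) by (auto simp: image_subset_iff)
  qed
  then obtain G where G: "continuous_on (unit_cube (snd e)) G" "G ` unit_cube (snd e) \<subseteq> Y"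
    "\<And>s. s \<in> unit_cube_bd (snd e) \<Longrightarrow> G s = g (p s)" by metis
  show ?thesis
  proof (intro exI conjI ballI)
    show "continuous_on (grid_cell N e) (\<lambda>t. G (q t))"
      by (rule continuous_on_compose2[OF G(1) q]) (use qc in auto)
    show "(\<lambda>t. G (q t)) ` grid_cell N e \<subseteq> Y" using qc G(2) by (auto simp: image_subset_iff)
    show "G (q t) = g t" if "t \<in> grid_cell_bd N e" for t
      using G(3)[OF qbd[OF that]] pq by simp
  qed
qed

lemma grid_cell_nonempty:
  assumes "N > 0"
  shows "(\<lambda>j. real (fst e j) / N) \<in> grid_cell N e"
  using assms by (simp add: grid_cell_def)

lemma grid_cell_subset_cube:
  assumes "N > 0" "e \<in> grid N J"
  shows "grid_cell N e \<subseteq> unit_cube J"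
proof
  fix t assume t: "t \<in> grid_cell N e"
  obtain a F where e: "e = (a, F)" by (cases e)
  have *: "real (a j) \<le> N * t j \<and> (if j \<in> F then N * t j \<le> real (a j) + 1 else N * t j = real (a j))" for j
    using t[unfolded e mem_grid_cell] by blast
  have g: "F \<subseteq> J" "\<And>j. j\<in>F \<Longrightarrow> a j < N" "\<And>j. j\<in>J \<Longrightarrow> a j \<le> N" "\<And>j. j \<notin> J \<Longrightarrow> a j = 0"
    using assms(2) by (auto simp: grid_def e)
  have "0 \<le> t j \<and> t j \<le> 1" if "j \<in> J" for j
  proof -
    have "0 \<le> real N * t j" using *[of j] by linarith
    then have "0 \<le> t j" using assms(1) by (simp add: zero_le_mult_iff)
    moreover have "real N * t j \<le> N * 1"
    proof (cases "j \<in> F")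
      case True
      have "real (a j) + 1 \<le> N" using g(2)[OF True] by simp
      moreover have "real N * t j \<le> real (a j) + 1" using *[of j] True by argo
      ultimately show ?thesis by linarith
    next
      case False
      then have "real N * t j = real (a j)" using *[of j] by argo
      then show ?thesis using g(3)[OF that] by simp
    qed
    then have "t j \<le> 1" using assms(1) mult_le_cancel_left_pos[of "real N" "t j" 1] by simp
    ultimately show ?thesis by simp
  qed
  moreover have "t j = 0" if "j \<notin> J" for j
  proof -
    have "j \<notin> F" using that g(1) by blast
    then have "real N * t j = 0" using *[of j] g(4)[OF that] by simp
    then show ?thesis using assms(1) by simp
  qed
  ultimately show "t \<in> unit_cube J" by (simp add: unit_cube_def)
qed

text \<open>A common point off the boundary of \<open>e\<close> lies strictly between two grid
  values in each direction of \<open>e\<close>. The other cell must then span the same interval in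
  that direction, and so it contains all of \<open>e\<close>.\<close>

lemma grid_cell_inter:
  "grid_cell N e \<subseteq> grid_cell N e' \<or> grid_cell N e \<inter> grid_cell N e' \<subseteq> grid_cell_bd N e"
proof (rule ccontr)
  assume "\<not> ?thesis"
  then obtain s t where s: "s \<in> grid_cell N e" "s \<notin> grid_cell N e'"
    and t: "t \<in> grid_cell N e" "t \<in> grid_cell N e'" "t \<notin> grid_cell_bd N e" by blast
  have t3: "N * t j \<noteq> real (fst e j) \<and> N * t j \<noteq> real (fst e j) + 1" if "j \<in> snd e" for j
    using t(1,3) that unfolding grid_cell_bd_def by blast
  have "real (fst e' j) \<le> N * s j \<and> (if j \<in> snd e' then N * s j \<le> real (fst e' j) + 1 else N * s j = real (fst e' j))" for j
  proof -
    have 1: "real (fst e j) \<le> N * t j \<and> (if j \<in> snd e then N * t j \<le> real (fst e j) + 1 else N * t j = real (fst e j))"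
      "real (fst e j) \<le> N * s j \<and> (if j \<in> snd e then N * s j \<le> real (fst e j) + 1 else N * s j = real (fst e j))"
      "real (fst e' j) \<le> N * t j \<and> (if j \<in> snd e' then N * t j \<le> real (fst e' j) + 1 else N * t j = real (fst e' j))"
      using s(1) t(1,2) unfolding grid_cell_def by blast+
    show ?thesis
    proof (cases "j \<in> snd e")
      case True
      then have 2: "real (fst e j) < N * t j" "N * t j < fst e j + 1" using 1 t3[OF True] by auto
      have "j \<in> snd e'" using 1(3) 2 by (auto split: if_splits)
      then have "fst e' j = fst e j" using 1(3) 2 by simp
      then show ?thesis using 1 True \<open>j \<in> snd e'\<close> by simp
    next
      case False
      then have "N * s j = N * t j" using 1 by argo
      then show ?thesis using 1(3) by argo
    qed
  qed
  then have "s \<in> grid_cell N e'" unfolding grid_cell_def by blast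
  with s(2) show False by blast
qed

text \<open>The lowest and the highest corner of the smaller cell are enough to compare the data of
  the two cells.\<close>

lemma grid_cell_subset:
  assumes N: "N > 0" and sub: "grid_cell N e' \<subseteq> grid_cell N e"
  shows "snd e' \<subseteq> snd e" "\<And>j. fst e j \<le> fst e' j" "snd e' = snd e \<Longrightarrow> e' = e"
proof -
  have lo: "(\<lambda>j. real (fst e' j) / N) \<in> grid_cell N e"
    using sub grid_cell_nonempty[OF N, of e'] by blast
  have "(\<lambda>j. (if j \<in> snd e' then real (fst e' j) + 1 else real (fst e' j)) / N) \<in> grid_cell N e'"
    using N by (simp add: grid_cell_def)
  then have hi: "(\<lambda>j. (if j \<in> snd e' then real (fst e' j) + 1 else real (fst e' j)) / N) \<in> grid_cell N e"
    using sub by blast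
  have lo: "real (fst e j) \<le> fst e' j \<and> (if j \<in> snd e then real (fst e' j) \<le> real (fst e j) + 1 else real (fst e' j) = real (fst e j))" for j
    using lo[unfolded grid_cell_def mem_Collect_eq, rule_format, of j] N by (simp only: nonzero_mult_div_cancel_left times_divide_eq_right of_nat_eq_0_iff) simp
  show le: "\<And>j. fst e j \<le> fst e' j" using lo by simp
  have hi: "if j \<in> snd e then (if j \<in> snd e' then real (fst e' j) + 1 else real (fst e' j)) \<le> real (fst e j) + 1
      else (if j \<in> snd e' then real (fst e' j) + 1 else real (fst e' j)) = real (fst e j)" for j
    using hi[unfolded grid_cell_def mem_Collect_eq, rule_format, of j] N by (simp only: nonzero_mult_div_cancel_left times_divide_eq_right of_nat_eq_0_iff) simp
  show sn: "snd e' \<subseteq> snd e"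
  proof
    fix j assume "j \<in> snd e'"
    then show "j \<in> snd e" using hi[of j] lo[of j] by (auto split: if_splits)
  qed
  show "e' = e" if "snd e' = snd e"
  proof -
    have "fst e' j = fst e j" for j using hi[of j] lo[of j] that by (auto split: if_splits)
    then show ?thesis using that by (simp add: prod_eq_iff fun_eq_iff)
  qed
qed

lemma grid_cell_faces:
  assumes N: "N > 0" and J: "finite J" and e: "e \<in> grid N J" and x: "x \<in> grid_cell_bd N e"
  shows "\<exists>e'\<in>grid N J. x \<in> grid_cell N e' \<and> grid_cell N e' \<subseteq> grid_cell N e \<and> card (snd e') < card (snd e)"
proof -
  obtain a F where aF: "e = (a, F)" by (cases e)
  have xc: "real (a j) \<le> N * x j \<and> (if j \<in> F then N * x j \<le> real (a j) + 1 else N * x j = real (a j))" for j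
    using x unfolding grid_cell_bd_def aF mem_Collect_eq mem_grid_cell by blast
  obtain j where j: "j \<in> F" "N * x j = real (a j) \<or> N * x j = real (a j) + 1"
    using x by (auto simp: grid_cell_bd_def aF)
  have g: "F \<subseteq> J" "\<And>j. j\<in>F \<Longrightarrow> a j < N" "\<And>j. j\<in>J \<Longrightarrow> a j \<le> N" "\<And>j. j \<notin> J \<Longrightarrow> a j = 0"
    using e by (auto simp: grid_def aF)
  \<comment> \<open>The face through \<open>x\<close> loses the direction \<open>j\<close>; its
    corner moves up by one if \<open>x\<close> lies on the upper side.\<close>
  define a' where "a' = (if N * x j = real (a j) then a else a(j := a j + 1))"
  have "finite F" using g(1) J finite_subset by blast
  then have "card (F - {j}) < card F" using j(1) by (intro psubset_card_mono) auto
  moreover have "(a', F - {j}) \<in> grid N J"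
    using g j(1) g(2)[OF j(1)] Suc_leI[OF g(2)[OF j(1)]] by (auto simp: grid_def a'_def)
  moreover have "x \<in> grid_cell N (a', F - {j})"
    using xc j by (auto simp: grid_cell_def a'_def)
  moreover have "grid_cell N (a', F - {j}) \<subseteq> grid_cell N e"
  proof
    fix s assume s: "s \<in> grid_cell N (a', F - {j})"
    have "real (a i) \<le> N * s i \<and> (if i \<in> F then N * s i \<le> real (a i) + 1 else N * s i = real (a i))" for i
    proof -
      have "real (a' i) \<le> N * s i \<and> (if i \<in> F - {j} then N * s i \<le> real (a' i) + 1 else N * s i = real (a' i))"
        using s unfolding mem_grid_cell by blast
      then show ?thesis using j(1) by (cases "i = j") (auto simp: a'_def split: if_splits)
    qed
    then show "s \<in> grid_cell N e" by (simp add: grid_cell_def aF)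
  qed
  ultimately show ?thesis using aF by (metis snd_conv)
qed

text \<open>The carrier principle on a subdivided domain. Carriers of cells inside \<open>A\<close>
  may be arbitrary, which later allows the bare image of a prescribed map.\<close>

lemma cubical_extension:
  fixes C :: "(nat \<Rightarrow> nat) \<times> nat set \<Rightarrow> 'b::topological_space set"
  assumes N: "N > 0" and J: "finite J" and D: "cubical N J D" and A: "cubical N J A" "A \<subseteq> D"
    and mono: "\<And>e e'. \<lbrakk>e \<in> grid N J; e' \<in> grid N J; grid_cell N e \<subseteq> D; grid_cell N e' \<subseteq> grid_cell N e\<rbrakk> \<Longrightarrow> C e' \<subseteq> C e"
    and ext: "\<And>e. \<lbrakk>e \<in> grid N J; grid_cell N e \<subseteq> D; \<not> grid_cell N e \<subseteq> A\<rbrakk> \<Longrightarrow> extendable (card (snd e)) (C e)"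
    and g: "continuous_on A g" "\<And>e. \<lbrakk>e \<in> grid N J; grid_cell N e \<subseteq> A\<rbrakk> \<Longrightarrow> g ` grid_cell N e \<subseteq> C e"
  shows "\<exists>G. continuous_on D G \<and> (\<forall>e\<in>grid N J. grid_cell N e \<subseteq> D \<longrightarrow> G ` grid_cell N e \<subseteq> C e)
    \<and> (\<forall>t\<in>A. G t = g t)"
proof -
  define \<C> where "\<C> = {e \<in> grid N J. grid_cell N e \<subseteq> D}"
  define \<A> where "\<A> = {e \<in> grid N J. grid_cell N e \<subseteq> A}"
  have UD: "\<Union>(grid_cell N ` \<C>) = D" using D unfolding cubical_def \<C>_def by blast
  have UA: "\<Union>(grid_cell N ` \<A>) = A" using A(1) unfolding cubical_def \<A>_def by blast
  have fin: "finite (snd e)" if "e \<in> grid N J" for e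
    using that J finite_subset[OF _ J] by (auto simp: grid_def)
  have "\<exists>G. continuous_on (\<Union>(grid_cell N ` \<C>)) G \<and> (\<forall>e\<in>\<C>. G ` grid_cell N e \<subseteq> C e)
      \<and> (\<forall>x\<in>\<Union>(grid_cell N ` \<A>). G x = g x)"
  proof (rule carrier_extension[where bd = "grid_cell_bd N" and dim = "\<lambda>e. card (snd e)"])
    show "finite \<C>" using finite_grid[OF J] by (simp add: \<C>_def)
    show "closed (grid_cell N e)" for e by (rule closed_grid_cell)
    show "grid_cell_bd N e \<subseteq> grid_cell N e" for e by (auto simp: grid_cell_bd_def)
    show "\<exists>e'\<in>\<C>. x \<in> grid_cell N e' \<and> grid_cell N e' \<subseteq> grid_cell N e \<and> card (snd e') < card (snd e)"
      if "e \<in> \<C>" "x \<in> grid_cell_bd N e" for e x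
    proof -
      have "e \<in> grid N J" "grid_cell N e \<subseteq> D" using that(1) by (auto simp: \<C>_def)
      then show ?thesis using grid_cell_faces[OF N J _ that(2)] unfolding \<C>_def by blast
    qed
    show "grid_cell N e \<subseteq> grid_cell N e' \<or> grid_cell N e \<inter> grid_cell N e' \<subseteq> grid_cell_bd N e" for e e'
      by (rule grid_cell_inter)
    show "e' = e \<or> card (snd e') < card (snd e)"
      if "e \<in> \<C>" "e' \<in> \<C>" "grid_cell N e' \<subseteq> grid_cell N e" for e e'
      using grid_cell_subset[OF N that(3)] fin[of e] that(1) unfolding \<C>_def
      by (metis (no_types, lifting) mem_Collect_eq psubsetI psubset_card_mono)
    show "C e' \<subseteq> C e" if "e \<in> \<C>" "e' \<in> \<C>" "grid_cell N e' \<subseteq> grid_cell N e" for e e'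
      using mono that by (simp add: \<C>_def)
    show "\<exists>G. continuous_on (grid_cell N e) G \<and> G ` grid_cell N e \<subseteq> C e \<and> (\<forall>x\<in>grid_cell_bd N e. G x = h x)"
      if "e \<in> \<C> - \<A>" "continuous_on (grid_cell_bd N e) h" "h ` grid_cell_bd N e \<subseteq> C e" for e h
      using that fin by (intro grid_cell_extend[OF N] ext) (auto simp: \<C>_def \<A>_def)
    show "\<A> \<subseteq> \<C>" using A(2) by (auto simp: \<C>_def \<A>_def)
    show "e \<in> \<A>" if "e' \<in> \<A>" "e \<in> \<C>" "grid_cell N e \<subseteq> grid_cell N e'" for e e'
      using that by (auto simp: \<C>_def \<A>_def)
    show "continuous_on (\<Union>(grid_cell N ` \<A>)) g" using g(1) UA by simp
    show "g ` grid_cell N e \<subseteq> C e" if "e \<in> \<A>" for e using g(2) that by (simp add: \<A>_def)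
  qed
  then obtain G where G: "continuous_on D G" "\<forall>e\<in>\<C>. G ` grid_cell N e \<subseteq> C e" "\<forall>x\<in>A. G x = g x"
    unfolding UD UA by (elim exE conjE)
  have "G ` grid_cell N e \<subseteq> C e" if "e \<in> grid N J" "grid_cell N e \<subseteq> D" for e
    using G(2) that by (simp only: \<C>_def mem_Collect_eq Ball_def)
  then show ?thesis using G(1,3) by (intro exI[of _ G] conjI ballI impI) simp_all
qed

text \<open>The cell with \<open>t\<close> in its relative interior: it extends exactly in the
  directions in which \<open>N * t j\<close> is not an integer.\<close>

definition min_cell :: "nat \<Rightarrow> nat set \<Rightarrow> (nat \<Rightarrow> real) \<Rightarrow> (nat \<Rightarrow> nat) \<times> nat set" where
  "min_cell N J t = ((\<lambda>j. nat \<lfloor>N * t j\<rfloor>), {j \<in> J. N * t j \<notin> \<int>})"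

lemma min_cell:
  assumes N: "N > 0" and t: "t \<in> unit_cube J"
  shows "min_cell N J t \<in> grid N J" "t \<in> grid_cell N (min_cell N J t)"
proof -
  have r: "0 \<le> N * t j \<and> N * t j \<le> N" for j
    using t by (cases "j \<in> J") (auto simp: unit_cube_def mult_left_le)
  have fl: "real (nat \<lfloor>N * t j\<rfloor>) = of_int \<lfloor>N * t j\<rfloor>" for j
    using r[of j] by simp
  have "nat \<lfloor>N * t j\<rfloor> < N" if "N * t j \<notin> \<int>" for j
  proof -
    have "N * t j \<noteq> real N" using that by (metis Ints_of_nat)
    then have "N * t j < N" using r[of j] by linarith
    then show ?thesis using r[of j] by linarith
  qed
  moreover have "nat \<lfloor>N * t j\<rfloor> \<le> N" for j using r[of j] by linarith
  moreover have "nat \<lfloor>N * t j\<rfloor> = 0" if "j \<notin> J" for j using that t by (simp add: unit_cube_def)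
  ultimately show "min_cell N J t \<in> grid N J" by (auto simp: min_cell_def grid_def)
  show "t \<in> grid_cell N (min_cell N J t)"
    unfolding min_cell_def mem_grid_cell fl
  proof (intro allI)
    fix j
    have "N * t j = real_of_int \<lfloor>N * t j\<rfloor>" if "\<not> (j \<in> J \<and> N * t j \<notin> \<int>)"
      using that t by (auto simp: unit_cube_def)
    moreover have "real_of_int \<lfloor>N * t j\<rfloor> \<le> N * t j \<and> N * t j \<le> real_of_int \<lfloor>N * t j\<rfloor> + 1" by linarith
    ultimately show "real_of_int \<lfloor>N * t j\<rfloor> \<le> N * t j \<and> (if j \<in> {j \<in> J. N * t j \<notin> \<int>}
      then N * t j \<le> real_of_int \<lfloor>N * t j\<rfloor> + 1 else N * t j = real_of_int \<lfloor>N * t j\<rfloor>)"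
      by simp
  qed
qed

text \<open>The values 0 and 1 are grid values for every \<open>N\<close> and hence frozen on the
  smallest cell. This makes the boundary of the cube \<open>cubical\<close> for all
  \<open>N\<close>.\<close>

lemma min_cell_fixed:
  assumes N: "N > 0" and s: "s \<in> grid_cell N (min_cell N J t)"
    and "t j = 0 \<or> t j = 1"
  shows "s j = t j"
proof -
  have "N * t j \<in> \<int>" using assms(3) by auto
  then have "N * s j = nat \<lfloor>N * t j\<rfloor>" using s by (auto simp: grid_cell_def min_cell_def dest: spec[of _ j])
  also have "\<dots> = N * t j" using assms(3) by auto
  finally show ?thesis using N by simp
qed

lemma cubicalI:
  assumes "N > 0" "D \<subseteq> unit_cube J" "\<And>t. t \<in> D \<Longrightarrow> grid_cell N (min_cell N J t) \<subseteq> D"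
  shows "cubical N J D"
  unfolding cubical_def using min_cell[OF assms(1)] assms(2,3) by blast

lemma cubical_unit_cube: "N > 0 \<Longrightarrow> cubical N J (unit_cube J)"
  by (intro cubicalI subset_refl grid_cell_subset_cube min_cell(1))

lemma min_cell_subset_bd:
  assumes "N > 0" "t \<in> unit_cube_bd J"
  shows "grid_cell N (min_cell N J t) \<subseteq> unit_cube_bd J"
proof
  fix s assume s: "s \<in> grid_cell N (min_cell N J t)"
  then have "s \<in> unit_cube J"
    using grid_cell_subset_cube[OF assms(1) min_cell(1)[OF assms(1)]] assms(2) unit_cube_bd_subset by blast
  then show "s \<in> unit_cube_bd J"
    using assms(2) min_cell_fixed[OF assms(1) s] unfolding unit_cube_bd_def by fastforce
qed

lemma cubical_unit_cube_bd: "N > 0 \<Longrightarrow> cubical N J (unit_cube_bd J)"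
  by (intro cubicalI unit_cube_bd_subset min_cell_subset_bd)

lemma cubical_empty: "cubical N J {}"
  by (simp add: cubical_def)

lemma card_grid_cell_le: "finite J \<Longrightarrow> e \<in> grid N J \<Longrightarrow> card (snd e) \<le> card J"
  by (auto simp: grid_def intro: card_mono)

text \<open>A cell extending in all directions of \<open>J\<close> has its midpoint in the interior
  of the cube, by parity: twice \<open>N\<close> times a coordinate of the midpoint is odd, while
  the values 0 and 1 would make it even.\<close>

lemma card_grid_cell_bd:
  assumes N: "N > 0" and J: "finite J" and e: "e \<in> grid N J" "grid_cell N e \<subseteq> unit_cube_bd J"
  shows "card (snd e) < card J"
proof (rule ccontr)
  assume "\<not> ?thesis"
  moreover have "snd e \<subseteq> J" using e(1) by (auto simp: grid_def)
  ultimately have eq: "snd e = J" using J by (metis card_seteq not_less)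
  define s where "s = (\<lambda>j. if j \<in> J then (real (fst e j) + 1/2) / N else real (fst e j) / N)"
  have "s \<in> grid_cell N e" using N by (simp add: grid_cell_def s_def eq)
  then obtain j where "j \<in> J" "s j = 0 \<or> s j = 1" using e(2) by (auto simp: unit_cube_bd_def)
  then have "real (fst e j) + 1/2 = 0 \<or> real (fst e j) + 1/2 = real N" using N by (auto simp: s_def field_simps)
  then have "2 * real (fst e j) + 1 = 2 * real N" by auto
  then have "2 * fst e j + 1 = 2 * N" by linarith
  then show False by presburger
qed

section \<open>Compactness and fine subdivisions\<close>

lemma compact_unit_cube: "compact (unit_cube J)"
proof -
  \<comment> \<open>With one-point factors outside \<open>J\<close> the cube is a product over all
    indices, and Tychonoff applies.\<close>
  have eq: "unit_cube J = (\<Pi>\<^sub>E j\<in>UNIV. if j \<in> J then {0..1} else {0})"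
    by (fastforce simp: unit_cube_def PiE_iff split: if_splits)
  have "compactin (product_topology (\<lambda>_. euclidean :: real topology) UNIV) (unit_cube J)"
    unfolding eq by (simp add: compactin_PiE)
  then show ?thesis by (simp add: euclidean_product_topology)
qed

lemma compact_unit_cube_bd:
  assumes "finite J"
  shows "compact (unit_cube_bd J)"
proof -
  have "unit_cube_bd J = (\<Union>j\<in>J. unit_cube J \<inter> ({t. t j = 0} \<union> {t. t j = 1}))"
    by (auto simp: unit_cube_bd_def)
  moreover have "compact (\<Union>j\<in>J. unit_cube J \<inter> ({t. t j = 0} \<union> {t. t j = 1}))"
    by (intro compact_UN assms compact_Int_closed compact_unit_cube closed_Un closed_Collect_eq
        continuous_on_coordinate continuous_on_const)
  ultimately show ?thesis by simp
qed

text \<open>The metric on functions weights the coordinates geometrically. The leading coordinates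
  contribute at most \<open>2 / N\<close> and the tail at most \<open>(1/2)^N\<close>, so the bound
  tends to 0 uniformly over all cells.\<close>

lemma dist_grid_cell:
  assumes N: "N > 0" and "s \<in> grid_cell N e" "t \<in> grid_cell N e"
  shows "dist s t \<le> 2 / N + (1/2)^N"
proof -
  have "dist (s j) (t j) \<le> 1 / N" for j
  proof -
    obtain a F where e: "e = (a, F)" by (cases e)
    have "real (a j) \<le> N * s j \<and> (if j \<in> F then N * s j \<le> real (a j) + 1 else N * s j = real (a j))"
      "real (a j) \<le> N * t j \<and> (if j \<in> F then N * t j \<le> real (a j) + 1 else N * t j = real (a j))"
      using assms(2,3) unfolding e mem_grid_cell by blast+
    then have "\<bar>N * s j - N * t j\<bar> \<le> 1" by argo
    also have "\<bar>N * s j - N * t j\<bar> = N * \<bar>s j - t j\<bar>"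
      by (simp add: abs_mult flip: right_diff_distrib)
    finally show ?thesis using N by (simp add: dist_real_def field_simps)
  qed
  then have "Max {dist (s (from_nat n)) (t (from_nat n)) |n. n \<le> N} \<le> 1 / N"
    by (subst Max_le_iff) auto
  then show ?thesis using dist_fun_le_dist_first_terms[of s t N] by simp
qed

lemma grid_variation_small:
  fixes f :: "'i \<Rightarrow> (nat \<Rightarrow> real) \<Rightarrow> real"
  assumes I: "finite I" and D: "compact D" and f: "\<And>i. i \<in> I \<Longrightarrow> continuous_on D (f i)" and \<epsilon>: "\<epsilon> > 0"
  shows "\<exists>N>0. \<forall>e\<in>grid N J. grid_cell N e \<subseteq> D \<longrightarrow> (\<forall>s\<in>grid_cell N e. \<forall>t\<in>grid_cell N e. \<forall>i\<in>I. \<bar>f i s - f i t\<bar> < \<epsilon>)"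
proof -
  have lim: "(\<lambda>N. 2 / real N + (1/2)^N) \<longlonglongrightarrow> 0 + 0"
    by (intro tendsto_add LIMSEQ_realpow_zero lim_const_over_n) simp_all
  have "eventually (\<lambda>N. \<forall>e\<in>grid N J. grid_cell N e \<subseteq> D \<longrightarrow> (\<forall>s\<in>grid_cell N e. \<forall>t\<in>grid_cell N e. \<bar>f i s - f i t\<bar> < \<epsilon>)) sequentially"
    if i: "i \<in> I" for i
  proof -
    have "uniformly_continuous_on D (f i)"
      by (intro compact_uniformly_continuous f i D)
    then obtain d where d: "d > 0" "\<And>s t. s \<in> D \<Longrightarrow> t \<in> D \<Longrightarrow> dist t s < d \<Longrightarrow> dist (f i t) (f i s) < \<epsilon>"
      using \<epsilon> unfolding uniformly_continuous_on_def by metis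
    have "eventually (\<lambda>N. 2 / real N + (1/2)^N < d) sequentially"
      using order_tendstoD(2)[OF lim] d(1) by simp
    then show ?thesis
    proof (rule eventually_elim2[OF _ eventually_gt_at_top[of 0]], intro ballI impI)
      fix N :: nat and e s t
      assume "2 / real N + (1/2)^N < d" and N: "0 < N" and e: "grid_cell N e \<subseteq> D"
        and st: "s \<in> grid_cell N e" "t \<in> grid_cell N e"
      then have "dist s t < d" using dist_grid_cell[OF N st] by linarith
      then show "\<bar>f i s - f i t\<bar> < \<epsilon>"
        using d(2) e st by (metis dist_real_def subsetD)
    qed
  qed
  then have "eventually (\<lambda>N. \<forall>i\<in>I. \<forall>e\<in>grid N J. grid_cell N e \<subseteq> D \<longrightarrow> (\<forall>s\<in>grid_cell N e. \<forall>t\<in>grid_cell N e. \<bar>f i s - f i t\<bar> < \<epsilon>)) sequentially"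
    using I by (simp add: eventually_ball_finite)
  then have "eventually (\<lambda>N. 0 < N \<and> (\<forall>i\<in>I. \<forall>e\<in>grid N J. grid_cell N e \<subseteq> D \<longrightarrow> (\<forall>s\<in>grid_cell N e. \<forall>t\<in>grid_cell N e. \<bar>f i s - f i t\<bar> < \<epsilon>))) sequentially"
    by (intro eventually_conj eventually_gt_at_top)
  then obtain N where "0 < N" "\<forall>i\<in>I. \<forall>e\<in>grid N J. grid_cell N e \<subseteq> D \<longrightarrow> (\<forall>s\<in>grid_cell N e. \<forall>t\<in>grid_cell N e. \<bar>f i s - f i t\<bar> < \<epsilon>)"
    by (metis (mono_tags, lifting) eventually_happens sequentially_bot)
  then show ?thesis by metis
qed

lemma grid_cell_in_top:
  assumes N: "N > 0" and e: "e \<in> grid N J"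
  shows "\<exists>T\<in>grid N J. snd T = J \<and> grid_cell N e \<subseteq> grid_cell N T"
proof -
  obtain a F where aF: "e = (a, F)" by (cases e)
  have g: "F \<subseteq> J" "\<And>j. j\<in>F \<Longrightarrow> a j < N" "\<And>j. j\<in>J \<Longrightarrow> a j \<le> N" "\<And>j. j \<notin> J \<Longrightarrow> a j = 0"
    using e by (auto simp: grid_def aF)
  \<comment> \<open>No interval starts at the upper end \<open>N\<close>; the last one, which starts
    at \<open>N - 1\<close>, is taken instead.\<close>
  define a' where "a' j = (if a j = N then N - 1 else a j)" for j
  have "a' j < N" if "j \<in> J" for j
    using g(3)[OF that] N by (auto simp: a'_def)
  moreover have "a' j = 0" if "j \<notin> J" for j using g(4)[OF that] N by (simp add: a'_def)
  ultimately have "(a', J) \<in> grid N J" by (auto simp: grid_def intro: less_imp_le)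
  moreover have "grid_cell N e \<subseteq> grid_cell N (a', J)"
    unfolding aF
  proof
    fix t assume t: "t \<in> grid_cell N (a, F)"
    show "t \<in> grid_cell N (a', J)"
      unfolding mem_grid_cell
    proof
      fix j
      have *: "real (a j) \<le> N * t j \<and> (if j \<in> F then N * t j \<le> real (a j) + 1 else N * t j = real (a j))"
        using t unfolding mem_grid_cell by blast
      show "real (a' j) \<le> N * t j \<and> (if j \<in> J then N * t j \<le> real (a' j) + 1 else N * t j = real (a' j))"
      proof (cases "a j = N")
        case True
        then have "j \<notin> F" "j \<in> J" using g(2,4)[of j] N by auto
        then show ?thesis using * True N by (simp add: a'_def of_nat_diff)
      next
        case False
        then have "a' j = a j" by (simp add: a'_def)
        moreover have "j \<in> F \<Longrightarrow> j \<in> J" using g(1) by blast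
        ultimately show ?thesis using * by (cases "j \<in> F"; cases "j \<in> J") simp_all
      qed
    qed
  qed
  ultimately show ?thesis by (intro bexI[of _ "(a', J)"]) simp_all
qed

section \<open>Simplicial complexes and matroids\<close>

definition supp :: "('a \<Rightarrow> real) \<Rightarrow> 'a set" where
  "supp x = {v. x v \<noteq> 0}"

definition geo :: "'a set set \<Rightarrow> ('a \<Rightarrow> real) set" where
  "geo K = (\<Union>\<sigma>\<in>K. simplex_on \<sigma>)"

text \<open>Elements of \<open>V\<close> need not be vertices of \<open>K\<close>. So a complex and
  its subcomplexes can share one \<open>V\<close>, as in \<open>geo_iff_supp\<close>.\<close>

definition finite_complex :: "'a set \<Rightarrow> 'a set set \<Rightarrow> bool" where
  "finite_complex V K \<longleftrightarrow> finite V \<and> (\<forall>\<sigma>\<in>K. \<sigma> \<subseteq> V) \<and> (\<forall>\<sigma>\<in>K. \<forall>\<tau>. \<tau> \<subseteq> \<sigma> \<longrightarrow> \<tau> \<in> K)"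

lemma finite_complexD:
  assumes "finite_complex V K"
  shows "finite V" "\<sigma> \<in> K \<Longrightarrow> \<sigma> \<subseteq> V" "\<sigma> \<in> K \<Longrightarrow> \<tau> \<subseteq> \<sigma> \<Longrightarrow> \<tau> \<in> K"
  using assms unfolding finite_complex_def by auto

lemma finite_complexI:
  assumes "finite V" "\<And>\<sigma>. \<sigma> \<in> K \<Longrightarrow> \<sigma> \<subseteq> V" "\<And>\<sigma> \<tau>. \<sigma> \<in> K \<Longrightarrow> \<tau> \<subseteq> \<sigma> \<Longrightarrow> \<tau> \<in> K"
  shows "finite_complex V K"
  unfolding finite_complex_def by (intro conjI ballI allI impI; rule assms)

text \<open>The support of a point is the smallest face containing it. This replaces the unknown
  face by a condition on the support and a sum over a fixed set.\<close>

lemma geo_iff: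
  assumes K: "finite_complex V K"
  shows "x \<in> geo K \<longleftrightarrow> (\<forall>v. 0 \<le> x v) \<and> supp x \<in> K \<and> sum x V = 1"
proof
  assume "x \<in> geo K"
  then obtain \<sigma> where \<sigma>: "\<sigma> \<in> K" "\<And>v. 0 \<le> x v" "\<And>v. v \<notin> \<sigma> \<Longrightarrow> x v = 0" "sum x \<sigma> = 1"
    by (auto simp: geo_def simplex_on_def)
  have "sum x V = sum x \<sigma>"
    using \<sigma>(1,3) finite_complexD[OF K] by (intro sum.mono_neutral_right) auto
  moreover have "supp x \<subseteq> \<sigma>" using \<sigma>(3) by (auto simp: supp_def)
  ultimately show "(\<forall>v. 0 \<le> x v) \<and> supp x \<in> K \<and> sum x V = 1"
    using \<sigma> finite_complexD(3)[OF K] by auto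
next
  assume x: "(\<forall>v. 0 \<le> x v) \<and> supp x \<in> K \<and> sum x V = 1"
  then have "sum x V = sum x (supp x)"
    using finite_complexD[OF K] by (intro sum.mono_neutral_right) (auto simp: supp_def)
  then have "x \<in> simplex_on (supp x)" using x by (simp add: simplex_on_def supp_def)
  then show "x \<in> geo K" using x by (auto simp: geo_def)
qed

lemma geo_iff_supp:
  assumes K: "finite_complex V K" and L: "L \<subseteq> K" "finite_complex V L"
  shows "x \<in> geo L \<longleftrightarrow> x \<in> geo K \<and> supp x \<in> L"
  using L(1) unfolding geo_iff[OF K] geo_iff[OF L(2)] by blast

lemma mem_simplex_on_supp:
  assumes K: "finite_complex V K" and x: "x \<in> geo K"
  shows "x \<in> simplex_on (supp x)"
proof -
  have x: "\<forall>v. 0 \<le> x v" "supp x \<in> K" "sum x V = 1" using x geo_iff[OF K] by blast+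
  then have "sum x V = sum x (supp x)"
    using finite_complexD[OF K] by (intro sum.mono_neutral_right) (auto simp: supp_def)
  then show ?thesis using x by (simp add: simplex_on_def supp_def)
qed

lemma geo_mono: "K \<subseteq> L \<Longrightarrow> geo K \<subseteq> geo L"
  by (auto simp: geo_def)

lemma geo_outside_ground_eq_0:
  assumes "finite_complex V K" "x \<in> geo K" "v \<notin> V"
  shows "x v = 0"
  using assms geo_iff[OF assms(1)] finite_complexD(2)[OF assms(1)] by (auto simp: supp_def)

section \<open>Segments and truncation\<close>

definition mix :: "real \<Rightarrow> ('a \<Rightarrow> real) \<Rightarrow> ('a \<Rightarrow> real) \<Rightarrow> 'a \<Rightarrow> real" where
  "mix s x y = (\<lambda>v. (1 - s) * x v + s * y v)"

lemma mix_0 [simp]: "mix 0 x y = x" and mix_1 [simp]: "mix 1 x y = y"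
  by (simp_all add: mix_def)

lemma continuous_on_mix:
  assumes "continuous_on S a" "continuous_on S f" "continuous_on S g"
  shows "continuous_on S (\<lambda>p. mix (a p) (f p) (g p))"
  unfolding mix_def
  by (intro continuous_on_coordinatewise_then_product continuous_on_add continuous_on_mult
      continuous_on_diff continuous_on_const assms(1) continuous_on_coordinate_comp[OF assms(2)]
      continuous_on_coordinate_comp[OF assms(3)])

lemma supp_mix_subset: "supp (mix s x y) \<subseteq> supp x \<union> supp y"
  by (auto simp: supp_def mix_def)

lemma mix_in_geo:
  assumes K: "finite_complex V K" and x: "x \<in> geo K" and y: "y \<in> geo K"
    and xy: "supp x \<union> supp y \<in> K" and s: "0 \<le> s" "s \<le> 1"
  shows "mix s x y \<in> geo K"
  unfolding geo_iff[OF K]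
proof (intro conjI allI)
  show "0 \<le> mix s x y v" for v
    using x y s by (auto simp: geo_iff[OF K] mix_def intro!: add_nonneg_nonneg mult_nonneg_nonneg)
  show "supp (mix s x y) \<in> K"
    using finite_complexD(3)[OF K xy supp_mix_subset] .
  have "sum (mix s x y) V = (1 - s) * sum x V + s * sum y V"
    by (simp add: mix_def sum.distrib sum_distrib_left)
  then show "sum (mix s x y) V = 1" using x y by (simp add: geo_iff[OF K])
qed

text \<open>Truncating small coordinates makes supports locally constant from above: nearby points have
  truncations supported in a common face.\<close>

definition threshold :: "'a set \<Rightarrow> real" where
  "threshold V = 1 / (card V + 1)"

definition shrink :: "'a set \<Rightarrow> ('a \<Rightarrow> real) \<Rightarrow> 'a \<Rightarrow> real" where
  "shrink V x = (\<lambda>v. max 0 (x v - threshold V) / (\<Sum>w\<in>V. max 0 (x w - threshold V)))"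

lemma threshold_pos: "threshold V > 0"
  by (simp add: threshold_def)

text \<open>If all coordinates were at most \<open>threshold V\<close>, their sum would be at most
  \<open>card V / (card V + 1) < 1\<close>. So truncation never removes a whole point; this is the
  origin of the constant.\<close>

lemma shrink_denominator_pos:
  assumes K: "finite_complex V K" and x: "x \<in> geo K"
  shows "(\<Sum>w\<in>V. max 0 (x w - threshold V)) > 0"
proof -
  have fin: "finite V" by (rule finite_complexD[OF K])
  have s: "sum x V = 1" using x geo_iff[OF K] by blast
  have "\<exists>w\<in>V. x w > threshold V"
  proof (rule ccontr)
    assume "\<not> ?thesis"
    then have "sum x V \<le> of_nat (card V) * threshold V"
      by (intro sum_bounded_above) (auto simp: not_less)
    also have "\<dots> < 1" by (simp add: threshold_def)
    finally show False using s by simp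
  qed
  then obtain w where w: "w \<in> V" "x w > threshold V" by blast
  then show ?thesis by (intro sum_pos2[OF fin w(1)]) auto
qed

lemma supp_shrink:
  assumes K: "finite_complex V K" and x: "x \<in> geo K"
  shows "supp (shrink V x) = {v. x v > threshold V}"
proof -
  have "max 0 (x v - threshold V) \<noteq> 0 \<longleftrightarrow> threshold V < x v" for v by linarith
  moreover have "(\<Sum>w\<in>V. max 0 (x w - threshold V)) \<noteq> 0"
    using shrink_denominator_pos[OF K x] by (rule less_imp_neq[symmetric])
  ultimately show ?thesis unfolding supp_def shrink_def divide_eq_0_iff by blast
qed

lemma supp_shrink_subset:
  assumes K: "finite_complex V K" and x: "x \<in> geo K"
  shows "supp (shrink V x) \<subseteq> supp x"
  unfolding supp_shrink[OF K x] using threshold_pos[of V] by (auto simp: supp_def)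

lemma shrink_in_geo:
  assumes K: "finite_complex V K" and x: "x \<in> geo K"
  shows "shrink V x \<in> geo K"
  unfolding geo_iff[OF K]
proof (intro conjI allI)
  note p = shrink_denominator_pos[OF K x]
  show "0 \<le> shrink V x v" for v using p by (simp add: shrink_def)
  show "supp (shrink V x) \<in> K"
    using finite_complexD(3)[OF K _ supp_shrink_subset[OF K x]] x geo_iff[OF K] by blast
  show "sum (shrink V x) V = 1" using p by (simp add: shrink_def flip: sum_divide_distrib)
qed

text \<open>Truncation only drops vertices, so the segment stays in the face
  \<open>supp x\<close>.\<close>

lemma mix_shrink_in_geo:
  assumes K: "finite_complex V K" and x: "x \<in> geo K" and s: "0 \<le> s" "s \<le> 1"
  shows "mix s x (shrink V x) \<in> geo K"
proof (rule mix_in_geo[OF K x shrink_in_geo[OF K x] _ s])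
  show "supp x \<union> supp (shrink V x) \<in> K"
    using supp_shrink_subset[OF K x] x geo_iff[OF K] by (metis Un_absorb2)
qed

lemma continuous_on_shrink:
  assumes K: "finite_complex V K" and f: "continuous_on S f" "\<And>t. t \<in> S \<Longrightarrow> f t \<in> geo K"
  shows "continuous_on S (\<lambda>t. shrink V (f t))"
proof -
  have m: "continuous_on S (\<lambda>t. max 0 (f t v - threshold V))" for v
    by (intro continuous_on_max continuous_on_diff continuous_on_const continuous_on_coordinate_comp[OF f(1)])
  show ?thesis
    unfolding shrink_def
  proof (intro continuous_on_coordinatewise_then_product continuous_on_divide m continuous_on_sum ballI)
    show "(\<Sum>w\<in>V. max 0 (f t w - threshold V)) \<noteq> 0" if "t \<in> S" for t
      using shrink_denominator_pos[OF K f(2)[OF that]] by simp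
  qed
qed

text \<open>Extending the truncated boundary map suffices, as the segments back to \<open>g\<close>
  are absorbed in a collar.\<close>

lemma extend_from_shrink:
  assumes K: "finite_complex V K" and J: "finite J"
    and g: "continuous_on (unit_cube_bd J) g" "g ` unit_cube_bd J \<subseteq> geo K"
    and H: "continuous_on (unit_cube J) H" "H ` unit_cube J \<subseteq> geo K"
    and Hg: "\<And>t. t \<in> unit_cube_bd J \<Longrightarrow> H t = shrink V (g t)"
  shows "\<exists>G. continuous_on (unit_cube J) G \<and> G ` unit_cube J \<subseteq> geo K \<and> (\<forall>t\<in>unit_cube_bd J. G t = g t)"
proof -
  have gin: "\<And>t. t \<in> unit_cube_bd J \<Longrightarrow> g t \<in> geo K" using g(2) by auto
  have gs: "continuous_on ({0..1::real} \<times> unit_cube_bd J) (\<lambda>p. g (snd p))"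
    by (rule continuous_on_compose2[OF g(1) continuous_on_snd[OF continuous_on_id]]) auto
  let ?F = "\<lambda>p. mix (fst p) (g (snd p)) (shrink V (g (snd p)))"
  have "\<exists>G. continuous_on (unit_cube J) G \<and> G ` unit_cube J \<subseteq> geo K \<and> (\<forall>t\<in>unit_cube_bd J. G t = ?F (0, t))"
  proof (rule homotopy_extension_unit_cube[OF J])
    show "continuous_on ({0..1} \<times> unit_cube_bd J) (\<lambda>p. mix (fst p) (g (snd p)) (shrink V (g (snd p))))"
      by (intro continuous_on_mix continuous_on_fst continuous_on_id gs continuous_on_shrink[OF K])
        (auto intro: gin)
    show "(\<lambda>p. mix (fst p) (g (snd p)) (shrink V (g (snd p)))) ` ({0..1} \<times> unit_cube_bd J) \<subseteq> geo K"
      by (rule image_subsetI) (auto intro: mix_shrink_in_geo[OF K gin])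
    show "continuous_on (unit_cube J) H" "H ` unit_cube J \<subseteq> geo K" by (rule H)+
    show "mix (fst (1, t)) (g (snd (1, t))) (shrink V (g (snd (1, t)))) = H t" if "t \<in> unit_cube_bd J" for t
      using Hg[OF that] by simp
  qed
  then show ?thesis by simp
qed

section \<open>Cones, deletions and links\<close>

definition vertex :: "'a \<Rightarrow> 'a \<Rightarrow> real" where
  "vertex v = (\<lambda>w. if w = v then 1 else 0)"

lemma supp_vertex [simp]: "supp (vertex v) = {v}"
  by (simp add: supp_def vertex_def)

lemma vertex_in_geo:
  assumes K: "finite_complex V K" and v: "{v} \<in> K"
  shows "vertex v \<in> geo K"
  using v finite_complexD[OF K] unfolding geo_iff[OF K] supp_vertex
  by (auto simp: vertex_def)

lemma extendable_cone:
  assumes K: "finite_complex V K" and v: "{v} \<in> K" and cone: "\<And>\<sigma>. \<sigma> \<in> K \<Longrightarrow> insert v \<sigma> \<in> K"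
  shows "extendable d (geo K)"
proof (rule extendable_contractible[where h = "\<lambda>p. mix (fst p) (snd p) (vertex v)"])
  show "vertex v \<in> geo K" by (rule vertex_in_geo[OF K v])
  show "continuous_on ({0..1} \<times> geo K) (\<lambda>p. mix (fst p) (snd p) (vertex v))"
    by (intro continuous_on_mix continuous_on_fst continuous_on_snd continuous_on_id continuous_on_const)
  have "mix s x (vertex v) \<in> geo K" if "x \<in> geo K" "0 \<le> s" "s \<le> 1" for s x
  proof (rule mix_in_geo[OF K that(1) vertex_in_geo[OF K v] _ that(2,3)])
    show "supp x \<union> supp (vertex v) \<in> K" using that(1) cone geo_iff[OF K] by auto
  qed
  then show "(\<lambda>p. mix (fst p) (snd p) (vertex v)) ` ({0..1} \<times> geo K) \<subseteq> geo K" by auto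
qed auto

lemma extendable_unit_interval: "extendable d {0..1::real}"
proof (rule extendable_contractible[where h = "\<lambda>p. (1 - fst p) * snd p"])
  show "continuous_on ({0..1} \<times> {0..1}) (\<lambda>p. (1 - fst p) * snd p :: real)"
    by (intro continuous_on_mult continuous_on_diff continuous_on_const continuous_on_fst continuous_on_snd continuous_on_id)
  show "(\<lambda>p. (1 - fst p) * snd p) ` ({0..1} \<times> {0..1::real}) \<subseteq> {0..1}"
    by (auto simp: mult_le_one)
qed auto

text \<open>\<open>K\<close> is the union of the star of \<open>v\<close>, which is a cone, and the
  deletion of \<open>v\<close>, and these meet in the link. The cube is cut into a region where the
  weight of \<open>v\<close> is bounded below, sent to the star, and one where it is small, sent to
  the deletion. Cells of the interface go to the link; they are not full-dimensional, which is why
  one degree less of connectivity suffices there.\<close>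

lemma extendable_below_deletion_link:
  assumes K: "finite_complex V K"
    and dl: "extendable_below n (geo {\<sigma> \<in> K. v \<notin> \<sigma>})"
    and lk: "{v} \<in> K \<Longrightarrow> extendable_below (n - 1) (geo {\<sigma> \<in> K. v \<notin> \<sigma> \<and> insert v \<sigma> \<in> K})"
  shows "extendable_below n (geo K)"
proof (cases "{v} \<in> K")
  case False
  then have "{\<sigma> \<in> K. v \<notin> \<sigma>} = K" using finite_complexD(3)[OF K] by blast
  then show ?thesis using dl by simp
next
  case v: True
  define Kdl where "Kdl = {\<sigma> \<in> K. v \<notin> \<sigma>}"
  define Klk where "Klk = {\<sigma> \<in> K. v \<notin> \<sigma> \<and> insert v \<sigma> \<in> K}"
  define Kst where "Kst = {\<sigma> \<in> K. insert v \<sigma> \<in> K}"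
  have sub: "Kdl \<subseteq> K" "Klk \<subseteq> K" "Kst \<subseteq> K" "Klk \<subseteq> Kst" "Klk \<subseteq> Kdl"
    by (auto simp: Kdl_def Klk_def Kst_def)
  have fc: "finite_complex V Kst"
  proof -
    have "insert v \<tau> \<in> K" if "insert v \<sigma> \<in> K" "\<tau> \<subseteq> \<sigma>" for \<sigma> \<tau>
      using finite_complexD(3)[OF K that(1)] insert_mono[OF that(2)] by blast
    then show ?thesis
      by (intro finite_complexI) (auto simp: Kst_def intro: finite_complexD[OF K] dest: finite_complexD(2)[OF K])
  qed
  have st: "extendable d (geo Kst)" for d
    by (rule extendable_cone[OF fc]) (use v in \<open>auto simp: Kst_def\<close>)
  have "extendable d (geo K)" if d: "d < n" for d
  proof (rule extendableI)
    fix J :: "nat set" and g :: "(nat \<Rightarrow> real) \<Rightarrow> 'a \<Rightarrow> real"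
    assume J: "finite J" "card J = d" and g: "continuous_on (unit_cube_bd J) g" "g ` unit_cube_bd J \<subseteq> geo K"
    let ?\<delta> = "threshold V"
    have gin: "\<And>t. t \<in> unit_cube_bd J \<Longrightarrow> g t \<in> geo K" using g(2) by auto
    \<comment> \<open>No map into \<open>K\<close> is available inside the cube yet; an extension
      \<open>u\<close> of the weight of \<open>v\<close> alone decides which part of the cube goes
      where.\<close>
    have "\<exists>u. continuous_on (unit_cube J) u \<and> u ` unit_cube J \<subseteq> {0..1::real} \<and> (\<forall>t\<in>unit_cube_bd J. u t = g t v)"
    proof (rule extendableD[OF extendable_unit_interval J])
      show "continuous_on (unit_cube_bd J) (\<lambda>t. g t v)" by (rule continuous_on_coordinate_comp[OF g(1)])
      have "x v \<in> {0..1}" if x: "x \<in> geo K" for x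
      proof -
        have "v \<in> V" "finite V" using finite_complexD[OF K] v by auto
        then show ?thesis using x member_le_sum[of v V x] unfolding geo_iff[OF K] by auto
      qed
      then show "(\<lambda>t. g t v) ` unit_cube_bd J \<subseteq> {0..1}" using gin by blast
    qed
    then obtain u where u: "continuous_on (unit_cube J) u" "\<And>t. t \<in> unit_cube_bd J \<Longrightarrow> u t = g t v" by metis
    obtain N where N: "N > 0"
      "\<And>e s t. \<lbrakk>e \<in> grid N J; s \<in> grid_cell N e; t \<in> grid_cell N e\<rbrakk> \<Longrightarrow> \<bar>u s - u t\<bar> < ?\<delta> / 2"
    proof -
      obtain N where N: "N > 0" "\<forall>e\<in>grid N J. grid_cell N e \<subseteq> unit_cube J \<longrightarrow>
        (\<forall>s\<in>grid_cell N e. \<forall>t\<in>grid_cell N e. \<forall>i\<in>{()}. \<bar>u s - u t\<bar> < ?\<delta> / 2)"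
        using grid_variation_small[OF finite.insertI[OF finite.emptyI] compact_unit_cube, of "()" J "\<lambda>_. u" "?\<delta> / 2" J]
          u(1) threshold_pos[of V] by auto
      show ?thesis using that[OF N(1)] N(2) grid_cell_subset_cube[OF N(1)] by simp
    qed
    \<comment> \<open>Both properties are tested on full-dimensional cells and inherited by faces. A
      cell with both is thus a common face of two different full cells and has lower
      dimension.\<close>
    define P where "P e \<longleftrightarrow> (\<exists>T\<in>grid N J. snd T = J \<and> grid_cell N e \<subseteq> grid_cell N T \<and>
      (\<forall>t\<in>grid_cell N T. ?\<delta> / 2 < u t))" for e
    define Q where "Q e \<longleftrightarrow> (\<exists>T\<in>grid N J. snd T = J \<and> grid_cell N e \<subseteq> grid_cell N T \<and>
      \<not> (\<forall>t\<in>grid_cell N T. ?\<delta> / 2 < u t))" for e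
    have PQ: "P e \<or> Q e" if "e \<in> grid N J" for e
      using grid_cell_in_top[OF N(1) that] unfolding P_def Q_def by blast
    have Pmono: "P e'" if "P e" "grid_cell N e' \<subseteq> grid_cell N e" for e e'
      using that unfolding P_def by blast
    have Qmono: "Q e'" if "Q e" "grid_cell N e' \<subseteq> grid_cell N e" for e e'
      using that unfolding Q_def by blast
    have Ppos: "?\<delta> / 2 < u t" if "P e" "t \<in> grid_cell N e" for e t
      using that unfolding P_def by blast
    \<comment> \<open>A value of at most half the threshold and a variation below the other half
      keep \<open>u\<close> under the threshold on the whole cell.\<close>
    have Qsmall: "u t < ?\<delta>" if Qe: "Q e" and t: "t \<in> grid_cell N e" for e t
    proof -
      obtain T s where "T \<in> grid N J" "t \<in> grid_cell N T" "s \<in> grid_cell N T" "u s \<le> ?\<delta> / 2"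
        using Qe t unfolding Q_def not_less[symmetric] by blast
      moreover from this have "\<bar>u t - u s\<bar> < ?\<delta> / 2" by (intro N(2))
      ultimately show ?thesis by linarith
    qed
    define C where "C e = geo (if P e then (if Q e then Klk else Kst) else Kdl)" for e
    have "\<exists>G. continuous_on (unit_cube J) G
      \<and> (\<forall>e\<in>grid N J. grid_cell N e \<subseteq> unit_cube J \<longrightarrow> G ` grid_cell N e \<subseteq> C e)
      \<and> (\<forall>t\<in>unit_cube_bd J. G t = shrink V (g t))"
    proof (rule cubical_extension[OF N(1) J(1) cubical_unit_cube[OF N(1)] cubical_unit_cube_bd[OF N(1)]
          unit_cube_bd_subset])
      fix e e' assume "e \<in> grid N J" "e' \<in> grid N J" and sub': "grid_cell N e' \<subseteq> grid_cell N e"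
      then show "C e' \<subseteq> C e"
        unfolding C_def using PQ[of e] Pmono[OF _ sub'] Qmono[OF _ sub'] sub by (intro geo_mono) auto
    next
      fix e assume e: "e \<in> grid N J"
      have cd: "card (snd e) \<le> d" using card_grid_cell_le[OF J(1) e] J(2) by simp
      show "extendable (card (snd e)) (C e)"
      proof (cases "P e \<and> Q e")
        case True
        then obtain S T where S: "snd S = J" "grid_cell N e \<subseteq> grid_cell N S" "\<forall>t\<in>grid_cell N S. ?\<delta> / 2 < u t"
          and T: "snd T = J" "grid_cell N e \<subseteq> grid_cell N T" "\<not> (\<forall>t\<in>grid_cell N T. ?\<delta> / 2 < u t)"
          unfolding P_def Q_def by blast
        have "snd e \<noteq> J"
        proof
          assume "snd e = J"
          then have "e = S" "e = T"
            using grid_cell_subset(3)[OF N(1) S(2)] grid_cell_subset(3)[OF N(1) T(2)] S(1) T(1) by auto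
          then show False using S(3) T(3) by simp
        qed
        then have "snd e \<subset> J" using e by (auto simp: grid_def)
        then have "card (snd e) < d" using psubset_card_mono[OF J(1)] J(2) by blast
        then show ?thesis
          using True lk[OF v] d unfolding C_def extendable_below_def Klk_def by simp
      next
        case False
        then show ?thesis
          using st dl cd d unfolding C_def extendable_below_def Kdl_def by auto
      qed
    next
      show "continuous_on (unit_cube_bd J) (\<lambda>t. shrink V (g t))"
        by (rule continuous_on_shrink[OF K g(1) gin])
    next
      fix e assume e: "e \<in> grid N J" "grid_cell N e \<subseteq> unit_cube_bd J"
      show "(\<lambda>t. shrink V (g t)) ` grid_cell N e \<subseteq> C e"
      proof (rule image_subsetI)
        fix t assume t: "t \<in> grid_cell N e"
        then have tb: "t \<in> unit_cube_bd J" using e(2) by blast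
        note gt = gin[OF tb]
        let ?\<tau> = "supp (shrink V (g t))"
        have sK: "supp (g t) \<in> K" using gt geo_iff[OF K] by blast
        have \<tau>K: "?\<tau> \<in> K" using finite_complexD(3)[OF K sK supp_shrink_subset[OF K gt]] .
        \<comment> \<open>On cells with \<open>P\<close> the vertex \<open>v\<close> already belongs
          to the support of \<open>g t\<close>; on cells with \<open>Q\<close> truncation removes
          it.\<close>
        have 1: "insert v ?\<tau> \<in> K" if "P e"
        proof -
          have "g t v > 0" using Ppos[OF that t] u(2)[OF tb] threshold_pos[of V] by simp
          then have "insert v ?\<tau> \<subseteq> supp (g t)" using supp_shrink_subset[OF K gt] by (auto simp: supp_def)
          then show ?thesis using finite_complexD(3)[OF K sK] by blast
        qed
        have 2: "v \<notin> ?\<tau>" if "Q e"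
          using Qsmall[OF that t] u(2)[OF tb] unfolding supp_shrink[OF K gt] by simp
        have m: "?\<tau> \<in> (if P e then (if Q e then Klk else Kst) else Kdl)"
          using 1 2 \<tau>K PQ[OF e(1)] by (auto simp: Klk_def Kst_def Kdl_def)
        have "shrink V (g t) \<in> simplex_on ?\<tau>"
          by (rule mem_simplex_on_supp[OF K shrink_in_geo[OF K gt]])
        then show "shrink V (g t) \<in> C e" using m unfolding C_def geo_def by blast
      qed
    qed
    then obtain H where H: "continuous_on (unit_cube J) H"
      "\<And>e. \<lbrakk>e \<in> grid N J; grid_cell N e \<subseteq> unit_cube J\<rbrakk> \<Longrightarrow> H ` grid_cell N e \<subseteq> C e"
      "\<And>t. t \<in> unit_cube_bd J \<Longrightarrow> H t = shrink V (g t)" by metis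
    have "H ` unit_cube J \<subseteq> geo K"
    proof (rule image_subsetI)
      fix t assume t: "t \<in> unit_cube J"
      have "H t \<in> C (min_cell N J t)"
        using H(2)[OF min_cell(1)[OF N(1) t] grid_cell_subset_cube[OF N(1) min_cell(1)[OF N(1) t]]]
          min_cell(2)[OF N(1) t] by blast
      moreover have "C e \<subseteq> geo K" for e unfolding C_def using sub by (intro geo_mono) auto
      ultimately show "H t \<in> geo K" by blast
    qed
    then show "\<exists>G. continuous_on (unit_cube J) G \<and> G ` unit_cube J \<subseteq> geo K \<and> (\<forall>t\<in>unit_cube_bd J. G t = g t)"
      using extend_from_shrink[OF K J(1) g H(1) _ H(3)] by blast
  qed
  then show ?thesis by (simp add: extendable_below_def)
qed

section \<open>Deletion and contraction of matroids\<close>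

lemma matroid_finite_complex: "matroid E \<I> \<Longrightarrow> finite_complex E \<I>"
  unfolding finite_complex_def
  using matroid.finite_ground matroid.indep_subset matroid.indep_downward by metis

lemma matroid_deletion:
  assumes "matroid E \<I>"
  shows "matroid (E - S) {\<sigma> \<in> \<I>. \<sigma> \<inter> S = {}}"
proof -
  interpret matroid E \<I> by fact
  show ?thesis
  proof
    show "finite (E - S)" using finite_ground by simp
    show "A \<in> {\<sigma> \<in> \<I>. \<sigma> \<inter> S = {}} \<Longrightarrow> A \<subseteq> E - S" for A using indep_subset by blast
    show "{} \<in> {\<sigma> \<in> \<I>. \<sigma> \<inter> S = {}}" using indep_empty by simp
    show "A \<in> {\<sigma> \<in> \<I>. \<sigma> \<inter> S = {}} \<Longrightarrow> B \<subseteq> A \<Longrightarrow> B \<in> {\<sigma> \<in> \<I>. \<sigma> \<inter> S = {}}" for A B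
      using indep_downward[of A B] by auto
    show "\<exists>x\<in>B - A. insert x A \<in> {\<sigma> \<in> \<I>. \<sigma> \<inter> S = {}}"
      if "A \<in> {\<sigma> \<in> \<I>. \<sigma> \<inter> S = {}}" "B \<in> {\<sigma> \<in> \<I>. \<sigma> \<inter> S = {}}" "card A < card B" for A B
      using indep_exchange[of A B] that by blast
  qed
qed

lemma matroid_contraction:
  assumes "matroid E \<I>" and v: "{v} \<in> \<I>"
  shows "matroid (E - {v}) {\<sigma>. v \<notin> \<sigma> \<and> insert v \<sigma> \<in> \<I>}"
proof -
  interpret matroid E \<I> by fact
  show ?thesis
  proof
    show "finite (E - {v})" using finite_ground by simp
    show "A \<in> {\<sigma>. v \<notin> \<sigma> \<and> insert v \<sigma> \<in> \<I>} \<Longrightarrow> A \<subseteq> E - {v}" for A using indep_subset by blast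
    show "{} \<in> {\<sigma>. v \<notin> \<sigma> \<and> insert v \<sigma> \<in> \<I>}" using v by simp
    show "A \<in> {\<sigma>. v \<notin> \<sigma> \<and> insert v \<sigma> \<in> \<I>} \<Longrightarrow> B \<subseteq> A \<Longrightarrow> B \<in> {\<sigma>. v \<notin> \<sigma> \<and> insert v \<sigma> \<in> \<I>}" for A B
      using indep_downward[of "insert v A" "insert v B"] by auto
    show "\<exists>x\<in>B - A. insert x A \<in> {\<sigma>. v \<notin> \<sigma> \<and> insert v \<sigma> \<in> \<I>}"
      if A: "A \<in> {\<sigma>. v \<notin> \<sigma> \<and> insert v \<sigma> \<in> \<I>}" and B: "B \<in> {\<sigma>. v \<notin> \<sigma> \<and> insert v \<sigma> \<in> \<I>}"
        and c: "card A < card B" for A B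
    proof -
      have "finite A" "finite B"
        using A B indep_subset finite_ground by (auto intro: finite_subset)
      then have "card (insert v A) < card (insert v B)" using A B c by simp
      then obtain x where "x \<in> insert v B - insert v A" "insert x (insert v A) \<in> \<I>"
        using indep_exchange[of "insert v A" "insert v B"] A B by auto
      then show ?thesis using A by (intro bexI[of _ x]) (auto simp: insert_commute)
    qed
  qed
qed

lemma (in matroid) indep_augment:
  assumes "A \<in> \<I>" "B \<in> \<I>" "card A \<le> card B"
  shows "\<exists>C\<in>\<I>. A \<subseteq> C \<and> C \<subseteq> A \<union> B \<and> card C = card B"
  using assms
proof (induction "card B - card A" arbitrary: A)
  case 0
  then show ?case by (intro bexI[of _ A]) auto
next
  case (Suc n)
  then have "card A < card B" by linarith
  then obtain x where x: "x \<in> B - A" "insert x A \<in> \<I>" using indep_exchange[OF Suc.prems(1,2)] by blast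
  have "finite A" by (rule finite_subset[OF indep_subset[OF Suc.prems(1)] finite_ground])
  then have "card (insert x A) = Suc (card A)" using x(1) by simp
  then have "n = card B - card (insert x A)" "card (insert x A) \<le> card B" using Suc.hyps(2) by linarith+
  then obtain C where "C \<in> \<I>" "insert x A \<subseteq> C" "C \<subseteq> insert x A \<union> B" "card C = card B"
    using Suc.hyps(1)[OF _ x(2) Suc.prems(2)] by blast
  then show ?case using x(1) by (intro bexI[of _ C]) auto
qed

text \<open>Any independent set is allowed in place of a basis, so no rank of a minor has to be
  computed: \<open>A\<close> survives the deletion of an element outside it, and exchange with
  \<open>A\<close> gives a set through \<open>v\<close> of the same size, hence one of size
  \<open>card A - 1\<close> in the contraction. If \<open>A\<close> is the whole ground set, the
  complex is a simplex.\<close>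

lemma matroid_extendable_below:
  assumes "matroid E \<I>" "A \<in> \<I>"
  shows "extendable_below (card A) (geo \<I>)"
  using assms
proof (induction "card E" arbitrary: E \<I> A rule: less_induct)
  case less
  interpret matroid E \<I> by fact
  note K = matroid_finite_complex[OF less.prems(1)]
  have A: "A \<subseteq> E" using indep_subset less.prems(2) .
  show ?case
  proof (cases "A = {}")
    case True
    then show ?thesis by (simp add: extendable_below_def)
  next
    case ne: False
    show ?thesis
    proof (cases "E \<subseteq> A")
      case True
      then have all: "\<sigma> \<in> \<I>" if "\<sigma> \<subseteq> E" for \<sigma>
        using that indep_downward[OF less.prems(2)] by blast
      obtain v where "v \<in> E" using ne A by blast
      then have "extendable d (geo \<I>)" for d
        using indep_subset by (intro extendable_cone[OF K] all) auto
      then show ?thesis by (simp add: extendable_below_def)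
    next
      case False
      then obtain v where v: "v \<in> E" "v \<notin> A" by blast
      have c: "card (E - {v}) < card E" using v(1) finite_ground by (rule card_Diff1_less[rotated])
      show ?thesis
      proof (rule extendable_below_deletion_link[OF K])
        show "extendable_below (card A) (geo {\<sigma> \<in> \<I>. v \<notin> \<sigma>})"
          using less.hyps[OF c, of "{\<sigma> \<in> \<I>. v \<notin> \<sigma>}" A] matroid_deletion[OF less.prems(1), of "{v}"] less.prems(2) v(2)
          by simp
        show "extendable_below (card A - 1) (geo {\<sigma> \<in> \<I>. v \<notin> \<sigma> \<and> insert v \<sigma> \<in> \<I>})" if vI: "{v} \<in> \<I>"
        proof -
          have fin: "finite A" using A finite_ground finite_subset by blast
          have "card {v} \<le> card A" using ne fin by (simp add: Suc_le_eq card_gt_0_iff)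
          then obtain C where C: "C \<in> \<I>" "v \<in> C" "card C = card A"
            using indep_augment[OF vI less.prems(2)] by auto
          have "finite C" by (rule finite_subset[OF indep_subset[OF C(1)] finite_ground])
          then have cC: "card (C - {v}) = card A - 1" using C by simp
          have eq: "{\<sigma> \<in> \<I>. v \<notin> \<sigma> \<and> insert v \<sigma> \<in> \<I>} = {\<sigma>. v \<notin> \<sigma> \<and> insert v \<sigma> \<in> \<I>}"
            using indep_downward by blast
          have "C - {v} \<in> {\<sigma>. v \<notin> \<sigma> \<and> insert v \<sigma> \<in> \<I>}" using C by (simp add: insert_absorb)
          from less.hyps[OF c matroid_contraction[OF less.prems(1) vI] this]
          show ?thesis unfolding eq cC .
        qed
      qed
    qed
  qed
qed

text \<open>For \<open>v\<close> in the forbidden set, a set without \<open>v\<close> cannot contain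
  it, so the deletion of \<open>v\<close> is a matroid complex; the link is a complex of the same
  kind in the contraction, with \<open>v\<close> dropped from the forbidden set. These complexes
  become the carriers of the essential map, which has to miss one of several given basis
  elements.\<close>

lemma matroid_not_containing_extendable_below:
  assumes "finite N" "N \<noteq> {}" "matroid E \<I>" "N \<in> \<I>"
    and "\<And>v. v \<in> N \<Longrightarrow> \<exists>A\<in>\<I>. card A = r \<and> v \<notin> A"
  shows "extendable_below r (geo {\<sigma> \<in> \<I>. \<not> N \<subseteq> \<sigma>})"
  using assms
proof (induction N arbitrary: E \<I> r rule: finite_ne_induct)
  case (singleton v)
  obtain A where A: "A \<in> \<I>" "card A = r" "v \<notin> A" using singleton(3)[of v] by blast
  then have "extendable_below (card A) (geo {\<sigma> \<in> \<I>. \<sigma> \<inter> {v} = {}})"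
    by (intro matroid_extendable_below[OF matroid_deletion[OF singleton(1)]]) simp
  then show ?case using A(2) by simp
next
  case (insert v N)
  interpret matroid E \<I> by fact
  define K where "K = {\<sigma> \<in> \<I>. \<not> insert v N \<subseteq> \<sigma>}"
  have K: "finite_complex E K"
    using finite_ground indep_subset indep_downward by (intro finite_complexI) (auto simp: K_def)
  have vI: "{v} \<in> \<I>" using indep_downward[OF insert.prems(2)] by simp
  have "extendable_below r (geo K)"
  proof (rule extendable_below_deletion_link[OF K])
    obtain A where A: "A \<in> \<I>" "card A = r" "v \<notin> A" using insert.prems(3)[of v] by blast
    then have "extendable_below (card A) (geo {\<sigma> \<in> \<I>. \<sigma> \<inter> {v} = {}})"
      by (intro matroid_extendable_below[OF matroid_deletion[OF insert.prems(1)]]) simp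
    moreover have "{\<sigma> \<in> K. v \<notin> \<sigma>} = {\<sigma> \<in> \<I>. \<sigma> \<inter> {v} = {}}" by (auto simp: K_def)
    ultimately show "extendable_below r (geo {\<sigma> \<in> K. v \<notin> \<sigma>})" using A(2) by simp
    let ?L = "{\<sigma>. v \<notin> \<sigma> \<and> insert v \<sigma> \<in> \<I>}"
    have "extendable_below (r - 1) (geo {\<sigma> \<in> ?L. \<not> N \<subseteq> \<sigma>})"
    proof (cases "r = 0")
      case True
      then show ?thesis by (simp add: extendable_below_def)
    next
      case False
      show ?thesis
      proof (rule insert.IH[OF matroid_contraction[OF insert.prems(1) vI]])
        show "N \<in> ?L" using insert.prems(2) insert.hyps by simp
        fix w assume w: "w \<in> N"
        then obtain A where A: "A \<in> \<I>" "card A = r" "w \<notin> A" using insert.prems(3)[of w] by blast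
        \<comment> \<open>Completing \<open>{v}\<close> from \<open>A\<close> keeps
          \<open>C - {v}\<close> inside \<open>A\<close>, hence off \<open>w\<close>.\<close>
        then obtain C where C: "C \<in> \<I>" "v \<in> C" "C \<subseteq> {v} \<union> A" "card C = r"
          using indep_augment[OF vI A(1)] False by auto
        have "finite C" by (rule finite_subset[OF indep_subset[OF C(1)] finite_ground])
        then have "card (C - {v}) = r - 1" using C by simp
        moreover have "C - {v} \<in> ?L" using C by (simp add: insert_absorb)
        moreover have "w \<notin> C - {v}" using C(3) A(3) by blast
        ultimately show "\<exists>A\<in>?L. card A = r - 1 \<and> w \<notin> A" by blast
      qed
    qed
    moreover have "{\<sigma> \<in> K. v \<notin> \<sigma> \<and> insert v \<sigma> \<in> K} = {\<sigma> \<in> ?L. \<not> N \<subseteq> \<sigma>}"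
      using indep_downward insert.hyps by (auto simp: K_def)
    ultimately show "extendable_below (r - 1) (geo {\<sigma> \<in> K. v \<notin> \<sigma> \<and> insert v \<sigma> \<in> K})" by simp
  qed
  then show ?case by (simp add: K_def)
qed

section \<open>Connectivity of deleted products\<close>

text \<open>Supports are smallest faces, so pairwise disjoint faces around the factors exist exactly
  if the supports are disjoint. The value \<open>undefined\<close> from \<open>k\<close> on is that
  of extensional functions in a product topology.\<close>

definition disjoint_tuples :: "nat \<Rightarrow> 'a set set \<Rightarrow> (nat \<Rightarrow> 'a \<Rightarrow> real) set" where
  "disjoint_tuples k K = {x. (\<forall>i<k. x i \<in> geo K) \<and>
     (\<forall>i<k. \<forall>j<k. i \<noteq> j \<longrightarrow> supp (x i) \<inter> supp (x j) = {}) \<and> (\<forall>i\<ge>k. x i = undefined)}"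

lemma topspace_deleted_product:
  assumes K: "finite_complex V K"
  shows "topspace (deleted_product k K) = disjoint_tuples k K"
proof -
  have "x \<in> topspace (deleted_product k K) \<longleftrightarrow> x \<in> disjoint_tuples k K" for x
  proof
    assume "x \<in> topspace (deleted_product k K)"
    then obtain \<sigma> where x: "x \<in> (\<Pi>\<^sub>E i\<in>{..<k}. geo K)"
      and \<sigma>: "\<forall>i<k. \<forall>j<k. i \<noteq> j \<longrightarrow> \<sigma> i \<inter> \<sigma> j = {}" "x \<in> (\<Pi>\<^sub>E i\<in>{..<k}. simplex_on (\<sigma> i))"
      by (auto simp: deleted_product_def realization_def geo_def)
    have "supp (x i) \<subseteq> \<sigma> i" if "i < k" for i
      using \<sigma>(2) that by (auto simp: PiE_iff simplex_on_def supp_def)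
    then have "\<forall>i<k. \<forall>j<k. i \<noteq> j \<longrightarrow> supp (x i) \<inter> supp (x j) = {}" using \<sigma>(1) by blast
    then show "x \<in> disjoint_tuples k K" using x by (auto simp: disjoint_tuples_def PiE_iff extensional_def)
  next
    assume x: "x \<in> disjoint_tuples k K"
    then have "supp (x i) \<in> K \<and> x i \<in> simplex_on (supp (x i))" if "i < k" for i
      using that mem_simplex_on_supp[OF K] geo_iff[OF K] by (auto simp: disjoint_tuples_def)
    then have "x \<in> (\<Pi>\<^sub>E i\<in>{..<k}. simplex_on (supp (x i)))" "\<forall>i<k. supp (x i) \<in> K"
      using x by (auto simp: disjoint_tuples_def PiE_iff extensional_def)
    moreover have "\<forall>i<k. \<forall>j<k. i \<noteq> j \<longrightarrow> supp (x i) \<inter> supp (x j) = {}"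
      using x by (auto simp: disjoint_tuples_def)
    moreover have "x \<in> (\<Pi>\<^sub>E i\<in>{..<k}. geo K)"
      using x by (auto simp: disjoint_tuples_def PiE_iff extensional_def)
    ultimately show "x \<in> topspace (deleted_product k K)"
      unfolding deleted_product_def realization_def topspace_subtopology topspace_product_topology
        topspace_euclidean_subtopology geo_def[symmetric]
      by (intro IntI UN_I[of "\<lambda>i. supp (x i)"]) simp_all
  qed
  then show ?thesis by blast
qed

text \<open>The coordinates from \<open>k\<close> on are constantly \<open>undefined\<close>, so
  continuity into the product topology agrees with continuity of total functions, for which maps
  have been glued above.\<close>

lemma continuous_map_deleted_product:
  assumes K: "finite_complex V K"
  shows "continuous_map (top_of_set S) (deleted_product k K) f \<longleftrightarrow>
    continuous_on S f \<and> f ` S \<subseteq> disjoint_tuples k K"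
proof
  assume f: "continuous_map (top_of_set S) (deleted_product k K) f"
  then have fin: "f ` S \<subseteq> disjoint_tuples k K"
    using continuous_map_image_subset_topspace[OF f] by (simp add: topspace_deleted_product[OF K])
  have cm: "continuous_map (top_of_set S) (product_topology (\<lambda>_. realization K) {..<k}) f"
    using f unfolding deleted_product_def by (rule continuous_map_into_fulltopology)
  have "continuous_on S (\<lambda>t. f t i)" for i
  proof (cases "i < k")
    case True
    then have "continuous_map (top_of_set S) (realization K) (\<lambda>t. f t i)"
      using cm unfolding continuous_map_componentwise by blast
    then show ?thesis
      unfolding realization_def continuous_map_in_subtopology by simp
  next
    case False
    then have "f t i = undefined" if "t \<in> S" for t
      using fin that by (auto simp: disjoint_tuples_def)
    then show ?thesis by (simp cong: continuous_on_cong)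
  qed
  then show "continuous_on S f \<and> f ` S \<subseteq> disjoint_tuples k K"
    using fin continuous_on_coordinatewise_then_product by blast
next
  assume f: "continuous_on S f \<and> f ` S \<subseteq> disjoint_tuples k K"
  have "continuous_map (top_of_set S) (realization K) (\<lambda>t. f t i)" if "i < k" for i
    using continuous_on_coordinate_comp[OF conjunct1[OF f], of i] f that
    unfolding realization_def continuous_map_in_subtopology geo_def[symmetric]
    by (auto simp: disjoint_tuples_def)
  moreover have "f ` S \<subseteq> extensional {..<k}"
    using f by (auto simp: disjoint_tuples_def extensional_def)
  ultimately have "continuous_map (top_of_set S) (product_topology (\<lambda>_. realization K) {..<k}) f"
    unfolding continuous_map_componentwise by simp
  moreover have "f ` S \<subseteq> topspace (deleted_product k K)"
    using f by (simp add: topspace_deleted_product[OF K])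
  ultimately show "continuous_map (top_of_set S) (deleted_product k K) f"
    unfolding deleted_product_def continuous_map_in_subtopology by auto
qed

text \<open>Given a family of maps into the first \<open>k\<close> factors, an additional map into the last factor
  is found cell by cell: on a cell it has to avoid only those vertices that carry positive weight
  on the whole cell, as all others drop out when the given maps are truncated.\<close>

lemma deleted_product_lift:
  fixes G :: "(nat \<Rightarrow> real) \<Rightarrow> nat \<Rightarrow> 'a \<Rightarrow> real"
  assumes K: "finite_complex V K" and J: "finite J" and D: "compact D" "\<And>N. N > 0 \<Longrightarrow> cubical N J D"
    and A: "\<And>N. N > 0 \<Longrightarrow> cubical N J A" "A \<subseteq> D"
    and dim: "\<And>N e. \<lbrakk>N > 0; e \<in> grid N J; grid_cell N e \<subseteq> D\<rbrakk> \<Longrightarrow> card (snd e) < n"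
    and rank: "\<And>\<sigma>. \<sigma> \<in> K \<Longrightarrow> card \<sigma> \<le> r"
    and ext: "\<And>S. S \<subseteq> V \<Longrightarrow> card S \<le> r * k \<Longrightarrow> extendable_below n (geo {\<sigma> \<in> K. \<sigma> \<inter> S = {}})"
    and G: "\<And>i. i < k \<Longrightarrow> continuous_on D (\<lambda>t. G t i)" "\<And>t i. t \<in> D \<Longrightarrow> i < k \<Longrightarrow> G t i \<in> geo K"
    and h0: "continuous_on A h0" "\<And>t. t \<in> A \<Longrightarrow> h0 t \<in> geo K"
      "\<And>t i. t \<in> A \<Longrightarrow> i < k \<Longrightarrow> supp (h0 t) \<inter> supp (G t i) = {}"
  shows "\<exists>h. continuous_on D h \<and>
    (\<forall>t\<in>D. h t \<in> geo K \<and> (\<forall>i<k. supp (h t) \<inter> supp (shrink V (G t i)) = {})) \<and> (\<forall>t\<in>A. h t = h0 t)"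
proof -
  note fV = finite_complexD(1)[OF K]
  have "\<exists>N>0. \<forall>e\<in>grid N J. grid_cell N e \<subseteq> D \<longrightarrow> (\<forall>s\<in>grid_cell N e. \<forall>t\<in>grid_cell N e.
    \<forall>p\<in>{..<k} \<times> V. \<bar>G s (fst p) (snd p) - G t (fst p) (snd p)\<bar> < threshold V)"
  proof (rule grid_variation_small[OF _ D(1) _ threshold_pos])
    show "continuous_on D (\<lambda>t. G t (fst p) (snd p))" if "p \<in> {..<k} \<times> V" for p
      using that by (intro continuous_on_coordinate_comp[OF G(1)]) auto
  qed (use fV in simp)
  then obtain N where N: "N > 0" and var: "\<And>e s t i v. \<lbrakk>e \<in> grid N J; grid_cell N e \<subseteq> D; s \<in> grid_cell N e;
    t \<in> grid_cell N e; i < k; v \<in> V\<rbrakk> \<Longrightarrow> \<bar>G s i v - G t i v\<bar> < threshold V"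
    by fastforce
  define S where "S e = {v \<in> V. \<exists>i<k. \<forall>t\<in>grid_cell N e. 0 < G t i v}" for e
  define L where "L e = {\<sigma> \<in> K. \<sigma> \<inter> S e = {}}" for e
  have LK: "L e \<subseteq> K" for e by (auto simp: L_def)
  have fcL: "finite_complex V (L e)" for e
    using finite_complexD[OF K] unfolding L_def by (intro finite_complexI) auto
  note L_iff = geo_iff_supp[OF K LK fcL]
  have "\<exists>h. continuous_on D h \<and> (\<forall>e\<in>grid N J. grid_cell N e \<subseteq> D \<longrightarrow> h ` grid_cell N e \<subseteq> geo (L e))
      \<and> (\<forall>t\<in>A. h t = h0 t)"
  proof (rule cubical_extension[OF N J D(2)[OF N] A(1)[OF N] A(2)])
    show "geo (L e') \<subseteq> geo (L e)" if "grid_cell N e' \<subseteq> grid_cell N e" for e e'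
    proof (rule geo_mono)
      \<comment> \<open>Positivity on a smaller cell is the weaker demand, so faces avoid more
        vertices and have smaller carriers.\<close>
      have "S e \<subseteq> S e'" using that unfolding S_def by blast
      then show "L e' \<subseteq> L e" unfolding L_def by blast
    qed
    show "extendable (card (snd e)) (geo (L e))" if e: "e \<in> grid N J" "grid_cell N e \<subseteq> D" for e
    proof -
      obtain t where t: "t \<in> grid_cell N e" using grid_cell_nonempty[OF N] by blast
      have fin: "finite (supp (G t i))" "card (supp (G t i)) \<le> r" if "i < k" for i
      proof -
        have "supp (G t i) \<in> K" using G(2)[of t i] t e(2) that geo_iff[OF K] by blast
        then show "finite (supp (G t i))" "card (supp (G t i)) \<le> r"
          using rank finite_complexD(2)[OF K] fV finite_subset by blast+
      qed
      \<comment> \<open>One point of the cell gives the bound: all of \<open>S e\<close> is positive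
        at \<open>t\<close>, and each of the \<open>k\<close> supports there has at most
        \<open>r\<close> elements.\<close>
      have "S e \<subseteq> (\<Union>i\<in>{..<k}. supp (G t i))"
        using t by (force simp: S_def supp_def)
      then have "card (S e) \<le> card (\<Union>i\<in>{..<k}. supp (G t i))"
        using fin by (intro card_mono) auto
      also have "\<dots> \<le> (\<Sum>i<k. card (supp (G t i)))" by (rule card_UN_le) simp
      also have "\<dots> \<le> (\<Sum>i<k. r)" using fin(2) by (intro sum_mono) auto
      finally have "card (S e) \<le> r * k" by (simp add: mult.commute)
      then show ?thesis using ext[of "S e"] dim[OF N e] unfolding L_def S_def extendable_below_def by blast
    qed
    show "continuous_on A h0" by fact
    show "h0 ` grid_cell N e \<subseteq> geo (L e)" if e: "grid_cell N e \<subseteq> A" for e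
    proof (rule image_subsetI)
      fix t assume t: "t \<in> grid_cell N e"
      then have tA: "t \<in> A" using e by blast
      have "v \<notin> supp (h0 t)" if v: "v \<in> S e" for v
      proof -
        obtain i where "i < k" "0 < G t i v" using v t unfolding S_def by blast
        then have "v \<in> supp (G t i)" by (simp add: supp_def)
        then show ?thesis using h0(3)[OF tA \<open>i < k\<close>] by blast
      qed
      moreover have "supp (h0 t) \<in> K" using h0(2)[OF tA] geo_iff[OF K] by blast
      ultimately show "h0 t \<in> geo (L e)"
        unfolding L_iff using h0(2)[OF tA] unfolding L_def by blast
    qed
  qed
  then obtain h where h: "continuous_on D h"
    "\<forall>e\<in>grid N J. grid_cell N e \<subseteq> D \<longrightarrow> h ` grid_cell N e \<subseteq> geo (L e)" "\<forall>t\<in>A. h t = h0 t"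
    by (elim exE conjE)
  have "h t \<in> geo K \<and> (\<forall>i<k. supp (h t) \<inter> supp (shrink V (G t i)) = {})" if t: "t \<in> D" for t
  proof -
    obtain e where e: "e \<in> grid N J" "t \<in> grid_cell N e" "grid_cell N e \<subseteq> D"
      using D(2)[OF N] t unfolding cubical_def by blast
    then have hL: "h t \<in> geo K" "supp (h t) \<in> L e" using h(2) L_iff by blast+
    have "v \<notin> supp (h t)" if i: "i < k" and v: "v \<in> supp (shrink V (G t i))" for i v
    proof -
      \<comment> \<open>A vertex surviving truncation at \<open>t\<close> exceeds the threshold,
        which also bounds the variation on the cell. So it is positive on the whole cell and was
        avoided.\<close>
      have gt: "G t i v > threshold V" using v unfolding supp_shrink[OF K G(2)[OF t i]] by simp
      then have vV: "v \<in> V" using geo_outside_ground_eq_0[OF K G(2)[OF t i]] threshold_pos[of V] by force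
      have "0 < G s i v" if "s \<in> grid_cell N e" for s
        using var[OF e(1,3) that e(2) i vV] gt by linarith
      then have "v \<in> S e" using vV i unfolding S_def by blast
      then show ?thesis using hL(2) unfolding L_def by blast
    qed
    then show ?thesis using hL(1) by blast
  qed
  then show ?thesis using h(1,3) by (intro exI[of _ h] conjI ballI) simp_all
qed

text \<open>The first \<open>k\<close> factors are extended by assumption and truncated, and a last
  factor is lifted over them. On the boundary the result \<open>H\<close> differs from
  \<open>g\<close> by truncation only; the segments in \<open>F\<close> undo this without enlarging
  supports, so the factors stay disjoint.\<close>

lemma extendable_below_deleted_product_Suc:
  assumes K: "finite_complex V K" and rank: "\<And>\<sigma>. \<sigma> \<in> K \<Longrightarrow> card \<sigma> \<le> r"
    and ext: "\<And>S. S \<subseteq> V \<Longrightarrow> card S \<le> r * k \<Longrightarrow> extendable_below n (geo {\<sigma> \<in> K. \<sigma> \<inter> S = {}})"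
    and k: "extendable_below n (disjoint_tuples k K)"
  shows "extendable_below n (disjoint_tuples (Suc k) K)"
  unfolding extendable_below_def
proof (intro allI impI extendableI)
  fix d and J :: "nat set" and g :: "(nat \<Rightarrow> real) \<Rightarrow> nat \<Rightarrow> 'a \<Rightarrow> real"
  assume d: "d < n" and J: "finite J" "card J = d"
    and g: "continuous_on (unit_cube_bd J) g" "g ` unit_cube_bd J \<subseteq> disjoint_tuples (Suc k) K"
  let ?B = "unit_cube_bd J"
  have gD: "g t \<in> disjoint_tuples (Suc k) K" if "t \<in> ?B" for t using g(2) that by blast
  have gK: "g t i \<in> geo K" if "t \<in> ?B" "i \<le> k" for t i
    using gD[OF that(1)] that(2) by (simp add: disjoint_tuples_def)
  have gdisj: "supp (g t i) \<inter> supp (g t j) = {}" if "t \<in> ?B" "i \<le> k" "j \<le> k" "i \<noteq> j" for t i j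
    using gD[OF that(1)] that(2-) by (simp add: disjoint_tuples_def)
  have gundef: "g t i = undefined" if "t \<in> ?B" "i > k" for t i
    using gD[OF that(1)] that(2) by (simp add: disjoint_tuples_def)
  note gc = continuous_on_coordinate_comp[OF g(1)]
  define g' where "g' t = (\<lambda>i. if i < k then g t i else undefined)" for t
  have "\<exists>G. continuous_on (unit_cube J) G \<and> G ` unit_cube J \<subseteq> disjoint_tuples k K \<and> (\<forall>t\<in>?B. G t = g' t)"
  proof (rule extendableD[OF _ J])
    show "extendable d (disjoint_tuples k K)" using k d by (simp add: extendable_below_def)
    show "continuous_on ?B g'"
    proof (rule continuous_on_coordinatewise_then_product)
      show "continuous_on ?B (\<lambda>t. g' t i)" for i using gc by (cases "i < k") (simp_all add: g'_def)
    qed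
    show "g' ` ?B \<subseteq> disjoint_tuples k K"
    proof (rule image_subsetI)
      fix t assume "t \<in> ?B"
      then show "g' t \<in> disjoint_tuples k K"
        using gK[of t] gdisj[of t] by (simp add: disjoint_tuples_def g'_def)
    qed
  qed
  then obtain G where G: "continuous_on (unit_cube J) G" "G ` unit_cube J \<subseteq> disjoint_tuples k K"
    "\<forall>t\<in>?B. G t = g' t" by (elim exE conjE)
  have GD: "G t \<in> disjoint_tuples k K" if "t \<in> unit_cube J" for t using G(2) that by blast
  have GK: "G t i \<in> geo K" if "t \<in> unit_cube J" "i < k" for t i
    using GD[OF that(1)] that(2) by (simp add: disjoint_tuples_def)
  have Gdisj: "supp (G t i) \<inter> supp (G t j) = {}" if "t \<in> unit_cube J" "i < k" "j < k" "i \<noteq> j" for t i j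
    using GD[OF that(1)] that(2-) by (simp add: disjoint_tuples_def)
  have Gg: "G t i = g t i" if "t \<in> ?B" "i < k" for t i
    using G(3) that by (simp add: g'_def)
  note Gc = continuous_on_coordinate_comp[OF G(1)]
  have "\<exists>h. continuous_on (unit_cube J) h \<and>
    (\<forall>t\<in>unit_cube J. h t \<in> geo K \<and> (\<forall>i<k. supp (h t) \<inter> supp (shrink V (G t i)) = {})) \<and> (\<forall>t\<in>?B. h t = g t k)"
  proof (rule deleted_product_lift[OF K J(1) compact_unit_cube cubical_unit_cube cubical_unit_cube_bd
        unit_cube_bd_subset _ rank ext Gc GK gc gK[OF _ order_refl]])
    show "card (snd e) < n" if "e \<in> grid N J" for N e
      using card_grid_cell_le[OF J(1) that] J(2) d by simp
    show "supp (g t k) \<inter> supp (G t i) = {}" if "t \<in> ?B" "i < k" for t i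
      using gdisj[OF that(1), of k i] that Gg by simp
  qed
  then obtain h where h: "continuous_on (unit_cube J) h"
    "\<forall>t\<in>unit_cube J. h t \<in> geo K \<and> (\<forall>i<k. supp (h t) \<inter> supp (shrink V (G t i)) = {})" "\<forall>t\<in>?B. h t = g t k"
    by (elim exE conjE)
  define H where "H t = (\<lambda>i. if i < k then shrink V (G t i) else if i = k then h t else undefined)" for t
  define F where "F p = (\<lambda>i. if i < k then mix (fst p) (g (snd p) i) (shrink V (g (snd p) i)) else g (snd p) i)" for p
  have "\<exists>G. continuous_on (unit_cube J) G \<and> G ` unit_cube J \<subseteq> disjoint_tuples (Suc k) K \<and> (\<forall>t\<in>?B. G t = F (0, t))"
  proof (rule homotopy_extension_unit_cube[OF J(1)])
    have gs: "continuous_on ({0..1::real} \<times> ?B) (\<lambda>p. g (snd p) i)" for i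
      by (rule continuous_on_compose2[OF gc continuous_on_snd[OF continuous_on_id]]) auto
    show "continuous_on ({0..1} \<times> ?B) F"
    proof (rule continuous_on_coordinatewise_then_product)
      fix i show "continuous_on ({0..1} \<times> ?B) (\<lambda>p. F p i)"
      proof (cases "i < k")
        case True
        have "continuous_on ({0..1} \<times> ?B) (\<lambda>p. mix (fst p) (g (snd p) i) (shrink V (g (snd p) i)))"
          by (intro continuous_on_mix continuous_on_fst continuous_on_id gs continuous_on_shrink[OF K])
            (use gK True in auto)
        then show ?thesis using True by (simp add: F_def)
      next
        case False
        then show ?thesis using gs by (simp add: F_def)
      qed
    qed
    show "F ` ({0..1} \<times> ?B) \<subseteq> disjoint_tuples (Suc k) K"
    proof (rule image_subsetI)
      fix p :: "real \<times> (nat \<Rightarrow> real)" assume "p \<in> {0..1} \<times> ?B"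
      then obtain s t where p: "p = (s, t)" "0 \<le> s" "s \<le> 1" and t: "t \<in> ?B" by auto
      have FK: "F p i \<in> geo K" if "i \<le> k" for i
        using mix_shrink_in_geo[OF K gK[OF t that] p(2,3)] gK[OF t that] by (simp add: F_def p(1))
      have Fs: "supp (F p i) \<subseteq> supp (g t i)" if "i \<le> k" for i
        using supp_mix_subset[of s "g t i" "shrink V (g t i)"] supp_shrink_subset[OF K gK[OF t that]]
        by (simp add: F_def p(1)) blast
      have "supp (F p i) \<inter> supp (F p j) = {}" if "i \<le> k" "j \<le> k" "i \<noteq> j" for i j
        using Fs[OF that(1)] Fs[OF that(2)] gdisj[OF t that] by blast
      moreover have "F p i = undefined" if "i > k" for i using gundef[OF t that] that by (simp add: F_def p(1))
      ultimately show "F p \<in> disjoint_tuples (Suc k) K"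
        using FK by (simp add: disjoint_tuples_def less_Suc_eq_le Suc_le_eq)
    qed
    show "continuous_on (unit_cube J) H"
    proof (rule continuous_on_coordinatewise_then_product)
      fix i
      have "continuous_on (unit_cube J) (\<lambda>t. shrink V (G t i))" if "i < k"
        using GK that by (intro continuous_on_shrink[OF K Gc])
      then show "continuous_on (unit_cube J) (\<lambda>t. H t i)"
        using h(1) by (cases "i < k"; cases "i = k") (simp_all add: H_def)
    qed
    show "H ` unit_cube J \<subseteq> disjoint_tuples (Suc k) K"
    proof (rule image_subsetI)
      fix t assume t: "t \<in> unit_cube J"
      have HK: "H t i \<in> geo K" if "i \<le> k" for i
        using shrink_in_geo[OF K GK[OF t]] h(2) t that by (simp add: H_def)
      have "supp (shrink V (G t i)) \<inter> supp (shrink V (G t j)) = {}" if "i < k" "j < k" "i \<noteq> j" for i j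
        using supp_shrink_subset[OF K GK[OF t that(1)]] supp_shrink_subset[OF K GK[OF t that(2)]] Gdisj[OF t that]
        by blast
      then have "supp (H t i) \<inter> supp (H t j) = {}" if "i \<le> k" "j \<le> k" "i \<noteq> j" for i j
        using that h(2) t by (auto simp: H_def Int_commute)
      moreover have "H t i = undefined" if "i > k" for i using that by (simp add: H_def)
      ultimately show "H t \<in> disjoint_tuples (Suc k) K"
        using HK by (simp add: disjoint_tuples_def less_Suc_eq_le Suc_le_eq)
    qed
    fix t assume t: "t \<in> ?B"
    show "F (1, t) = H t"
    proof
      fix i
      consider "i < k" | "i = k" | "i > k" by linarith
      then show "F (1, t) i = H t i"
      proof cases
        case 3
        then show ?thesis using gundef[OF t 3] by (simp add: F_def H_def)
      qed (use Gg[OF t] h(3) t in \<open>simp_all add: F_def H_def\<close>)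
    qed
  qed
  moreover have "F (0, t) = g t" for t by (simp add: F_def fun_eq_iff)
  ultimately show "\<exists>G. continuous_on (unit_cube J) G \<and> G ` unit_cube J \<subseteq> disjoint_tuples (Suc k) K \<and> (\<forall>t\<in>?B. G t = g t)"
    by simp
qed

text \<open>The induction starts from the one-point space of empty tuples. The complex
  \<open>K\<close> itself then arises by the general step, with \<open>S\<close> empty.\<close>

lemma extendable_below_deleted_product:
  assumes K: "finite_complex V K" and rank: "\<And>\<sigma>. \<sigma> \<in> K \<Longrightarrow> card \<sigma> \<le> r"
    and ext: "\<And>S. S \<subseteq> V \<Longrightarrow> card S \<le> r * (k - 1) \<Longrightarrow> extendable_below n (geo {\<sigma> \<in> K. \<sigma> \<inter> S = {}})"
  shows "extendable_below n (disjoint_tuples k K)"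
  using ext
proof (induction k)
  case 0
  have eq: "disjoint_tuples 0 K = {\<lambda>_. undefined}" by (auto simp: disjoint_tuples_def)
  have "extendable d ({\<lambda>_. undefined} :: (nat \<Rightarrow> 'a \<Rightarrow> real) set)" for d
    by (rule extendable_contractible[where h = snd and y = "\<lambda>_. undefined"])
      (auto intro: continuous_on_snd continuous_on_id)
  then show ?case unfolding eq extendable_below_def by blast
next
  case (Suc k)
  have "r * (k - 1) \<le> r * k" by simp
  then have "extendable_below n (disjoint_tuples k K)"
    using Suc.prems by (intro Suc.IH) (metis diff_Suc_1 order_trans)
  then show ?case
    using Suc.prems by (intro extendable_below_deleted_product_Suc[OF K rank]) auto
qed

section \<open>Homotopy sets and extension over cubes\<close>

lemma topspace_cube: "topspace (cube n) = (\<Pi>\<^sub>E j\<in>{..<n}. {0..1})"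
  by (simp add: cube_def)

lemma cube_boundary_subset: "cube_boundary n \<subseteq> topspace (cube n)"
  by (auto simp: cube_boundary_def)

lemma is_singleton_homotopy_set:
  assumes x0: "x0 \<in> topspace X"
  shows "is_singleton (homotopy_set n X x0) \<longleftrightarrow>
    (\<forall>f. continuous_map (cube n) X f \<and> f ` cube_boundary n \<subseteq> {x0} \<longrightarrow>
      homotopic_with (\<lambda>h. h ` cube_boundary n \<subseteq> {x0}) (cube n) X f (\<lambda>_. x0))"
proof -
  let ?P = "\<lambda>h. h ` cube_boundary n \<subseteq> {x0}"
  define S where "S = {f. continuous_map (cube n) X f \<and> ?P f}"
  define R where "R = {(f, g). homotopic_with ?P (cube n) X f g}"
  let ?c = "\<lambda>_. x0"
  have cS: "?c \<in> S" using x0 by (auto simp: S_def)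
  have hs: "homotopy_set n X x0 = S // R" by (simp add: homotopy_set_def S_def R_def)
  have reflR: "(f, f) \<in> R" if "f \<in> S" for f using that by (simp add: S_def R_def)
  have sym: "(g, f) \<in> R" if "(f, g) \<in> R" for f g using that by (simp add: R_def homotopic_with_symD)
  have trans: "(f, h) \<in> R" if "(f, g) \<in> R" "(g, h) \<in> R" for f g h
    using that by (auto simp: R_def intro: homotopic_with_trans)
  have "is_singleton (S // R) \<longleftrightarrow> (\<forall>f\<in>S. (f, ?c) \<in> R)"
  proof
    assume "is_singleton (S // R)"
    then obtain C where C: "S // R = {C}" by (auto simp: is_singleton_def)
    show "\<forall>f\<in>S. (f, ?c) \<in> R"
    proof
      fix f assume f: "f \<in> S"
      have "R `` {f} \<in> S // R" "R `` {?c} \<in> S // R" using f cS by (simp_all add: quotientI)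
      then have "R `` {f} = R `` {?c}" unfolding C by simp
      moreover have "?c \<in> R `` {?c}" using reflR[OF cS] by (simp only: Image_singleton_iff)
      ultimately have "?c \<in> R `` {f}" by (simp only:)
      then show "(f, ?c) \<in> R" by (simp only: Image_singleton_iff)
    qed
  next
    assume all: "\<forall>f\<in>S. (f, ?c) \<in> R"
    have "R `` {f} = R `` {?c}" if "f \<in> S" for f
    proof -
      have fc: "(f, ?c) \<in> R" using all that by simp
      have "(f, h) \<in> R \<longleftrightarrow> (?c, h) \<in> R" for h
        using trans[OF fc, of h] trans[OF sym[OF fc], of h] by (rule iffI[rotated])
      then show ?thesis by (simp add: Image_def)
    qed
    then have "(\<lambda>f. R `` {f}) ` S = (\<lambda>_. R `` {?c}) ` S" by (rule image_cong[OF refl])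
    also have "\<dots> = {R `` {?c}}" by (rule image_constant[OF cS])
    finally have "(\<lambda>f. R `` {f}) ` S = {R `` {?c}}" .
    moreover have "S // R = (\<lambda>f. R `` {f}) ` S" unfolding quotient_def by (rule UNION_singleton_eq_range)
    ultimately show "is_singleton (S // R)" by simp
  qed
  then show ?thesis unfolding hs S_def R_def by simp
qed

text \<open>Appends a time \<open>s\<close> as coordinate \<open>n\<close>, which turns homotopies
  on the \<open>n\<close>-cube into maps on the next cube. It also passes from the extensional
  points of \<open>cube n\<close> to points that are zero off the directions of the cube.\<close>

definition cube_point :: "nat \<Rightarrow> real \<Rightarrow> (nat \<Rightarrow> real) \<Rightarrow> nat \<Rightarrow> real" where
  "cube_point n s y = (\<lambda>j. if j < n then y j else if j = n then s else 0)"

lemma cube_point_in_unit_cube: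
  "y \<in> topspace (cube n) \<Longrightarrow> s \<in> {0..1} \<Longrightarrow> cube_point n s y \<in> unit_cube {..<Suc n}"
  by (auto simp: cube_point_def unit_cube_def topspace_cube PiE_iff)

lemma continuous_map_cube_point:
  "continuous_map (prod_topology (top_of_set {0..1}) (cube n)) (top_of_set (unit_cube {..<Suc n}))
    (\<lambda>p. cube_point n (fst p) (snd p))"
  unfolding continuous_map_in_subtopology
proof
  have "continuous_map (prod_topology (top_of_set {0..1}) (cube n)) euclideanreal
      (\<lambda>p. cube_point n (fst p) (snd p) j)" for j
  proof -
    consider "j < n" | "j = n" | "j > n" by linarith
    then show ?thesis
    proof cases
      case 1
      have "continuous_map (cube n) euclideanreal (\<lambda>y. y j)"
        using continuous_map_product_projection[of j "{..<n}" "\<lambda>_. top_of_set {0..1::real}"] 1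
        by (simp add: cube_def continuous_map_in_subtopology)
      then show ?thesis using 1
        using continuous_map_compose[OF continuous_map_snd, of "cube n" euclideanreal "\<lambda>y. y j"]
        by (simp add: cube_point_def o_def)
    next
      case 2
      have "continuous_map (top_of_set {0..1::real}) euclideanreal (\<lambda>s. s)"
        using continuous_on_id by simp
      then show ?thesis using 2
        using continuous_map_compose[OF continuous_map_fst, of "top_of_set {0..1}" euclideanreal "\<lambda>s. s"]
        by (simp add: cube_point_def o_def)
    qed (simp add: cube_point_def)
  qed
  then show "continuous_map (prod_topology (top_of_set {0..1}) (cube n)) euclidean
      (\<lambda>p. cube_point n (fst p) (snd p))"
    unfolding euclidean_product_topology[symmetric] continuous_map_componentwise_UNIV by blast
  show "(\<lambda>p. cube_point n (fst p) (snd p)) \<in> topspace (prod_topology (top_of_set {0..1}) (cube n)) \<rightarrow> unit_cube {..<Suc n}"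
    using cube_point_in_unit_cube by auto
qed

lemma continuous_map_restrict_cube:
  assumes "S \<subseteq> unit_cube {..<Suc n}"
  shows "continuous_map (top_of_set S) (cube n) (\<lambda>t. restrict t {..<n})"
  unfolding cube_def continuous_map_componentwise
proof (intro conjI ballI)
  fix j assume j: "j \<in> {..<n}"
  have "continuous_map (top_of_set S) (top_of_set {0..1}) (\<lambda>t. t j)"
    using continuous_on_coordinate assms j
    by (auto simp: continuous_map_in_subtopology unit_cube_def)
  then show "continuous_map (top_of_set S) (top_of_set {0..1}) (\<lambda>t. restrict t {..<n} j)"
    using j by simp
qed auto

text \<open>A map of the \<open>i\<close>-cube is placed on the face \<open>t i = 0\<close> of a
  cube of dimension \<open>i + 1\<close>, with \<open>x0\<close> on all other faces. An extension,
  with \<open>t i\<close> read as time, is a null-homotopy; \<open>n + 2 \<le> int m\<close>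
  provides \<open>i + 1 < m\<close>.\<close>

lemma n_connected_deleted_product:
  assumes K: "finite_complex V K" and ext: "extendable_below m (disjoint_tuples k K)"
    and m: "0 < m" "n + 2 \<le> int m"
  shows "n_connected n (deleted_product k K)"
  unfolding n_connected_def topspace_deleted_product[OF K]
proof (intro conjI allI impI ballI)
  let ?D = "disjoint_tuples k K" and ?X = "deleted_product k K"
  show "?D \<noteq> {}" using ext m(1) by (simp add: extendable_below_def flip: extendable_0)
  fix i :: nat and x0 assume i: "int i \<le> n" and x0: "x0 \<in> ?D"
  have x0X: "x0 \<in> topspace ?X" using x0 topspace_deleted_product[OF K] by blast
  show "is_singleton (homotopy_set i ?X x0)"
    unfolding is_singleton_homotopy_set[OF x0X]
  proof (intro allI impI, elim conjE)
    fix f assume f: "continuous_map (cube i) ?X f" "f ` cube_boundary i \<subseteq> {x0}"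
    let ?J = "{..<Suc i}"
    let ?B = "unit_cube_bd ?J"
    have f0: "f y = x0" if "y \<in> cube_boundary i" for y using f(2) that by blast
    define B0 where "B0 = {t \<in> ?B. t i = 0}"
    define B1 where "B1 = {t \<in> ?B. t i = 1 \<or> (\<exists>j<i. t j = 0 \<or> t j = 1)}"
    define g where "g t = (if t i = 0 then f (restrict t {..<i}) else x0)" for t
    have B: "?B = B0 \<union> B1" by (auto simp: B0_def B1_def unit_cube_bd_def less_Suc_eq)
    have cb: "restrict t {..<i} \<in> cube_boundary i" if "t \<in> unit_cube ?J" "\<exists>j<i. t j = 0 \<or> t j = 1" for t
      using that by (auto simp: cube_boundary_def topspace_cube unit_cube_def)
    have clB: "closed ?B"
      by (rule compact_imp_closed) (rule compact_unit_cube_bd, simp)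
    have cl: "closed {t :: nat \<Rightarrow> real. t j = c}" for j c
      by (intro closed_Collect_eq continuous_on_coordinate continuous_on_const)
    have cl0: "closed B0" unfolding B0_def using clB cl[of i 0] by (simp add: Collect_conj_eq closed_Int)
    have B1': "B1 = ?B \<inter> ({t. t i = 1} \<union> (\<Union>j\<in>{..<i}. {t. t j = 0} \<union> {t. t j = 1}))"
      by (auto simp: B1_def)
    have cl1: "closed B1" unfolding B1' by (intro closed_Int clB closed_Un closed_UN ballI cl finite_lessThan)
    have "continuous_on (B0 \<union> B1) g"
      unfolding g_def
    proof (rule continuous_on_cases[OF cl0 cl1 _ continuous_on_const])
      have "continuous_map (top_of_set B0) ?X (f \<circ> (\<lambda>t. restrict t {..<i}))"
        using unit_cube_bd_subset by (intro continuous_map_compose[OF continuous_map_restrict_cube f(1)])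
          (auto simp: B0_def)
      then show "continuous_on B0 (\<lambda>t. f (restrict t {..<i}))"
        unfolding continuous_map_deleted_product[OF K] by (simp add: o_def)
      show "\<forall>t. t \<in> B0 \<and> \<not> t i = 0 \<or> t \<in> B1 \<and> t i = 0 \<longrightarrow> f (restrict t {..<i}) = x0"
        using cb f0 unit_cube_bd_subset by (auto simp: B0_def B1_def)
    qed
    then have gc: "continuous_on ?B g" using B by simp
    have fX: "f y \<in> ?D" if "y \<in> topspace (cube i)" for y
      using continuous_map_image_subset_topspace[OF f(1)] that by (auto simp: topspace_deleted_product[OF K])
    have "\<exists>G. continuous_on (unit_cube ?J) G \<and> G ` unit_cube ?J \<subseteq> ?D \<and> (\<forall>t\<in>?B. G t = g t)"
    proof (rule extendableD[OF _ finite_lessThan card_lessThan gc])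
      show "extendable (Suc i) ?D" using ext m(2) i by (simp add: extendable_below_def)
      show "g ` ?B \<subseteq> ?D"
        using fX x0 unit_cube_bd_subset by (auto simp: g_def topspace_cube unit_cube_bd_def unit_cube_def)
    qed
    then obtain G where G: "continuous_on (unit_cube ?J) G" "G ` unit_cube ?J \<subseteq> ?D" "\<forall>t\<in>?B. G t = g t"
      by (elim exE conjE)
    have cp: "cube_point i s y \<in> ?B" if "y \<in> topspace (cube i)" "s \<in> {0..1}" "s = 0 \<or> s = 1 \<or> y \<in> cube_boundary i" for s y
      using cube_point_in_unit_cube[OF that(1,2)] that(3)
      by (fastforce simp: unit_cube_bd_def cube_point_def cube_boundary_def)
    have rp: "restrict (cube_point i s y) {..<i} = y" if "y \<in> topspace (cube i)" for s y
      using that by (auto simp: cube_point_def topspace_cube PiE_iff extensional_def restrict_def)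
    let ?h = "G \<circ> (\<lambda>p. cube_point i (fst p) (snd p))"
    show "homotopic_with (\<lambda>h. h ` cube_boundary i \<subseteq> {x0}) (cube i) ?X f (\<lambda>_. x0)"
    proof (subst homotopic_with)
      show "h ` cube_boundary i \<subseteq> {x0} \<longleftrightarrow> k ` cube_boundary i \<subseteq> {x0}"
        if "\<And>x. x \<in> topspace (cube i) \<Longrightarrow> h x = k x" for h k
      proof -
        have "h ` cube_boundary i = k ` cube_boundary i"
          using that cube_boundary_subset by (intro image_cong refl) blast
        then show ?thesis by simp
      qed
      show "\<exists>h. continuous_map (prod_topology (top_of_set {0..1::real}) (cube i)) ?X h \<and>
        (\<forall>x\<in>topspace (cube i). h (0, x) = f x) \<and> (\<forall>x\<in>topspace (cube i). h (1, x) = x0) \<and>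
        (\<forall>t\<in>{0..1}. (\<lambda>x. h (t, x)) ` cube_boundary i \<subseteq> {x0})"
      proof (intro exI[of _ ?h] conjI ballI)
        show "continuous_map (prod_topology (top_of_set {0..1}) (cube i)) ?X ?h"
          using G(1,2) by (intro continuous_map_compose[OF continuous_map_cube_point])
            (simp add: continuous_map_deleted_product[OF K])
        show "?h (0, y) = f y" if y: "y \<in> topspace (cube i)" for y
          using G(3) cp[OF y, of 0] rp[OF y, of 0] by (simp add: g_def) (simp add: cube_point_def)
        show "?h (1, y) = x0" if y: "y \<in> topspace (cube i)" for y
          using G(3) cp[OF y, of 1] by (simp add: g_def) (simp add: cube_point_def)
        show "(\<lambda>y. ?h (s, y)) ` cube_boundary i \<subseteq> {x0}" if s: "s \<in> {0..1}" for s
        proof (rule image_subsetI)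
          fix y assume y: "y \<in> cube_boundary i"
          then have yt: "y \<in> topspace (cube i)" using cube_boundary_subset by blast
          have "G (cube_point i s y) = g (cube_point i s y)" using G(3) cp[OF yt s] y by blast
          also have "\<dots> = x0" unfolding g_def rp[OF yt] using f0[OF y] by simp
          finally show "?h (s, y) \<in> {x0}" by simp
        qed
      qed
    qed
  qed
qed

section \<open>An essential map\<close>

text \<open>The properties of a map from the boundary of the cube \<open>[-1, 1]\<^sup>r\<close> to the matroid complex that
  make it essential: points of the positive orthant go to the corresponding points of the
  basis simplex, and any other point \<open>t\<close> to a point with a vanishing coordinate
  among those in which \<open>t\<close> is negative. Only supports matter, so truncation preserves them.\<close>

definition sign_compatible :: "nat \<Rightarrow> (nat \<Rightarrow> 'a) \<Rightarrow> (nat \<Rightarrow> real) \<Rightarrow> ('a \<Rightarrow> real) \<Rightarrow> bool" where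
  "sign_compatible r \<beta> t x \<longleftrightarrow> (\<exists>j<r. t j < 1/2 \<and> \<beta> j \<notin> supp x) \<or> supp x \<subseteq> \<beta> ` {j. j < r \<and> 1/2 < t j}"

lemma sign_compatible_mono:
  "sign_compatible r \<beta> t x \<Longrightarrow> supp y \<subseteq> supp x \<Longrightarrow> sign_compatible r \<beta> t y"
  unfolding sign_compatible_def by blast

text \<open>On the part \<open>A\<close> of the boundary in the positive orthant, the map is the
  central projection to the simplex of \<open>B\<close>. It is extended over the grid of mesh 1/2,
  where each cell lies on one side of 1/2 in every direction. The carrier of a cell outside
  \<open>A\<close> demands that a basis element of some negative direction be missing.\<close>

lemma ex_sign_compatible_map:
  assumes M: "matroid E \<I>" and B: "B \<in> \<I>" and B': "B' \<in> \<I>" "card B' = r" "B \<inter> B' = {}"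
    and \<beta>: "bij_betw \<beta> {..<r} B"
  shows "\<exists>\<psi>. continuous_on (unit_cube_bd {..<r}) \<psi> \<and>
    (\<forall>t\<in>unit_cube_bd {..<r}. \<psi> t \<in> geo \<I> \<and> sign_compatible r \<beta> t (\<psi> t))"
proof -
  interpret matroid E \<I> by fact
  note K = matroid_finite_complex[OF M]
  let ?J = "{..<r}"
  let ?B = "unit_cube_bd ?J"
  have two: "(2::nat) > 0" by simp
  define A where "A = {t \<in> ?B. \<forall>j<r. 1/2 \<le> t j}"
  define \<gamma> where "\<gamma> = inv_into ?J \<beta>"
  have \<gamma>\<beta>: "\<gamma> (\<beta> j) = j" if "j < r" for j
    using \<beta> that by (simp add: \<gamma>_def bij_betw_def)
  have \<beta>\<gamma>: "\<beta> (\<gamma> v) = v" "\<gamma> v < r" if "v \<in> B" for v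
    using \<beta> that inv_into_into[of v \<beta> ?J] f_inv_into_f[of v \<beta> ?J] by (auto simp: \<gamma>_def bij_betw_def)
  have \<beta>B: "\<beta> j \<in> B" if "j < r" for j using \<beta> that by (auto simp: bij_betw_def)
  define W where "W t = (\<Sum>j<r. 2 * t j - 1)" for t :: "nat \<Rightarrow> real"
  define g where "g t = (\<lambda>v. if v \<in> B then (2 * t (\<gamma> v) - 1) / W t else 0)" for t
  have Wpos: "W t > 0" if "t \<in> A" for t
  proof -
    obtain j where j: "j < r" "t j = 0 \<or> t j = 1" using \<open>t \<in> A\<close> by (auto simp: A_def unit_cube_bd_def)
    have ge: "1/2 \<le> t i" if "i < r" for i using \<open>t \<in> A\<close> that by (simp add: A_def)
    have "t j = 1" using j ge[OF j(1)] by auto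
    then show ?thesis unfolding W_def using j(1) by (intro sum_pos2[of _ j]) (auto dest: ge)
  qed
  have gB: "supp (g t) \<subseteq> B" for t by (auto simp: g_def supp_def)
  have gI: "supp (g t) \<in> \<I>" for t by (rule indep_downward[OF B gB])
  have BE: "B \<subseteq> E" by (rule indep_subset[OF B])
  have ggeo: "g t \<in> geo \<I>" if t: "t \<in> A" for t
    unfolding geo_iff[OF K]
  proof (intro conjI allI gI)
    show "0 \<le> g t v" for v
      using t Wpos[OF t] \<beta>\<gamma>(2)[of v] by (auto simp: g_def A_def intro!: divide_nonneg_pos)
    have "sum (g t) E = sum (g t) B"
      using BE finite_ground by (intro sum.mono_neutral_right) (auto simp: g_def)
    also have "\<dots> = (\<Sum>j<r. g t (\<beta> j))" using sum.reindex_bij_betw[OF \<beta>, of "g t"] by simp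
    also have "\<dots> = (\<Sum>j<r. (2 * t j - 1) / W t)"
      by (intro sum.cong refl) (simp add: g_def \<beta>B \<gamma>\<beta>)
    also have "\<dots> = 1" using Wpos[OF t] by (simp add: W_def flip: sum_divide_distrib)
    finally show "sum (g t) E = 1" .
  qed
  have gc: "continuous_on A g"
  proof (rule continuous_on_coordinatewise_then_product)
    have "continuous_on A W"
      unfolding W_def by (intro continuous_on_sum continuous_on_diff continuous_on_mult
          continuous_on_const continuous_on_coordinate)
    then have "continuous_on A (\<lambda>t. (2 * t (\<gamma> v) - 1) / W t)" for v
      using Wpos by (intro continuous_on_divide continuous_on_diff continuous_on_mult
          continuous_on_const continuous_on_coordinate) force+
    then show "continuous_on A (\<lambda>t. g t v)" for v by (cases "v \<in> B") (simp_all add: g_def)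
  qed
  \<comment> \<open>For \<open>N = 2\<close> a lower corner 0 means that the cell stays in
    \<open>t j \<le> 1/2\<close>.\<close>
  define Neg where "Neg e = {j. j < r \<and> fst e j = (0::nat)}" for e :: "(nat \<Rightarrow> nat) \<times> nat set"
  define L where "L e = {\<sigma> \<in> \<I>. \<not> \<beta> ` Neg e \<subseteq> \<sigma>}" for e
  have LI: "L e \<subseteq> \<I>" for e by (auto simp: L_def)
  have fcL: "finite_complex E (L e)" for e
    using finite_complexD[OF K] unfolding L_def by (intro finite_complexI) blast+
  note L_iff = geo_iff_supp[OF K LI fcL]
  \<comment> \<open>Inside \<open>A\<close> the map is prescribed and its image serves as carrier;
    only the other cells call for connectivity.\<close>
  define C where "C e = (if grid_cell 2 e \<subseteq> A then g ` grid_cell 2 e else geo (L e))" for e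
  have inA: "grid_cell 2 e \<subseteq> A" if "grid_cell 2 e \<subseteq> ?B" "Neg e = {}" for e
  proof
    fix s assume s: "s \<in> grid_cell 2 e"
    have "1/2 \<le> s j" if "j < r" for j
    proof -
      have "fst e j \<ge> 1" using \<open>Neg e = {}\<close> that by (auto simp: Neg_def)
      moreover have "real (fst e j) \<le> real 2 * s j" using s unfolding grid_cell_def by blast
      ultimately show ?thesis by simp
    qed
    then show "s \<in> A" using s that(1) by (auto simp: A_def)
  qed
  have cubA: "cubical 2 ?J A"
  proof (rule cubicalI[OF two])
    show "A \<subseteq> unit_cube ?J" using unit_cube_bd_subset by (auto simp: A_def)
    fix t assume t: "t \<in> A"
    show "grid_cell 2 (min_cell 2 ?J t) \<subseteq> A"
    proof (rule inA)
      show "grid_cell 2 (min_cell 2 ?J t) \<subseteq> ?B" using t by (intro min_cell_subset_bd) (auto simp: A_def)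
      have "1 \<le> nat \<lfloor>2 * t j\<rfloor>" if "j < r" for j using t that by (auto simp: A_def le_nat_iff le_floor_iff)
      then show "Neg (min_cell 2 ?J t) = {}" by (fastforce simp: Neg_def min_cell_def)
    qed
  qed
  have "\<exists>\<psi>. continuous_on ?B \<psi> \<and> (\<forall>e\<in>grid 2 ?J. grid_cell 2 e \<subseteq> ?B \<longrightarrow> \<psi> ` grid_cell 2 e \<subseteq> C e)
      \<and> (\<forall>t\<in>A. \<psi> t = g t)"
  proof (rule cubical_extension[OF two finite_lessThan cubical_unit_cube_bd[OF two] cubA _ _ _ gc])
    show "A \<subseteq> ?B" by (auto simp: A_def)
    show "g ` grid_cell 2 e \<subseteq> C e" if "grid_cell 2 e \<subseteq> A" for e using that by (simp add: C_def)
    fix e assume e: "e \<in> grid 2 ?J" "grid_cell 2 e \<subseteq> ?B"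
    show "extendable (card (snd e)) (C e)" if nA: "\<not> grid_cell 2 e \<subseteq> A"
    proof -
      have "Neg e \<noteq> {}" using inA[OF e(2)] nA by blast
      moreover have sub: "\<beta> ` Neg e \<subseteq> B" using \<beta>B by (auto simp: Neg_def)
      moreover have "\<beta> ` Neg e \<in> \<I>" by (rule indep_downward[OF B sub])
      \<comment> \<open>\<open>B'\<close> is disjoint from \<open>B\<close> and so avoids every
        forbidden vertex at once.\<close>
      moreover have "\<exists>A\<in>\<I>. card A = r \<and> v \<notin> A" if "v \<in> \<beta> ` Neg e" for v
        using that sub B' by (intro bexI[of _ B']) auto
      ultimately have "extendable_below r (geo (L e))"
        unfolding L_def by (intro matroid_not_containing_extendable_below[OF _ _ M]) (auto simp: Neg_def)
      then show ?thesis
        using card_grid_cell_bd[OF two finite_lessThan e] nA by (simp add: C_def extendable_below_def)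
    qed
    fix e' assume e': "grid_cell 2 e' \<subseteq> grid_cell 2 e"
    show "C e' \<subseteq> C e"
    proof (cases "grid_cell 2 e \<subseteq> A")
      case True
      then show ?thesis using e' by (auto simp: C_def)
    next
      case nA: False
      show ?thesis
      proof (cases "grid_cell 2 e' \<subseteq> A")
        case True
        obtain j where j: "j < r" "fst e j = 0" using inA[OF e(2)] nA by (auto simp: Neg_def)
        have "g ` grid_cell 2 e' \<subseteq> geo (L e)"
        proof (rule image_subsetI)
          fix t assume t: "t \<in> grid_cell 2 e'"
          then have tA: "t \<in> A" using True by blast
          have "t \<in> grid_cell 2 e" using t e' by blast
          then have "if j \<in> snd e then real 2 * t j \<le> real (fst e j) + 1 else real 2 * t j = real (fst e j)"
            unfolding grid_cell_def by blast
          then have "t j \<le> 1/2" using j(2) by (auto split: if_splits)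
          \<comment> \<open>A negative direction of \<open>e\<close> meets \<open>A\<close> only in
            \<open>t j = 1/2\<close>, where the projected point has no weight at
            \<open>\<beta> j\<close>. So prescribed values fit the carrier of
            \<open>e\<close>.\<close>
          then have "t j = 1/2" using tA j(1) by (force simp: A_def)
          then have "\<beta> j \<notin> supp (g t)" using j(1) by (simp add: supp_def g_def \<beta>B \<gamma>\<beta>)
          then have "supp (g t) \<in> L e" using gI j by (auto simp: L_def Neg_def)
          then show "g t \<in> geo (L e)" unfolding L_iff using ggeo[OF tA] by blast
        qed
        then show ?thesis using True nA by (simp add: C_def)
      next
        case False
        have "fst e j = 0" if "fst e' j = 0" for j using grid_cell_subset(2)[OF two e', of j] that by simp
        then have "Neg e' \<subseteq> Neg e" by (auto simp: Neg_def)
        then have "L e' \<subseteq> L e" unfolding L_def by blast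
        then show ?thesis using False nA by (simp add: C_def geo_mono)
      qed
    qed
  qed
  then obtain \<psi> where \<psi>: "continuous_on ?B \<psi>"
    "\<forall>e\<in>grid 2 ?J. grid_cell 2 e \<subseteq> ?B \<longrightarrow> \<psi> ` grid_cell 2 e \<subseteq> C e" "\<forall>t\<in>A. \<psi> t = g t"
    by (elim exE conjE)
  have "\<psi> t \<in> geo \<I> \<and> sign_compatible r \<beta> t (\<psi> t)" if t: "t \<in> ?B" for t
  proof (cases "t \<in> A")
    case True
    have "v \<in> \<beta> ` {j. j < r \<and> 1/2 < t j}" if v: "v \<in> supp (g t)" for v
    proof -
      have vB: "v \<in> B" and nz: "2 * t (\<gamma> v) - 1 \<noteq> 0" using v by (auto simp: supp_def g_def split: if_splits)
      have "1/2 \<le> t (\<gamma> v)" using True \<beta>\<gamma>(2)[OF vB] by (simp add: A_def)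
      then have "1/2 < t (\<gamma> v)" using nz by linarith
      then show ?thesis using \<beta>\<gamma>[OF vB] by (intro image_eqI[of _ _ "\<gamma> v"]) auto
    qed
    then show ?thesis using \<psi>(3) True ggeo[OF True] by (auto simp: sign_compatible_def)
  next
    case False
    let ?e = "min_cell 2 ?J t"
    have tc: "t \<in> unit_cube ?J" using t unit_cube_bd_subset by blast
    have te: "t \<in> grid_cell 2 ?e" by (rule min_cell(2)[OF two tc])
    have nA: "\<not> grid_cell 2 ?e \<subseteq> A" using False te by blast
    have "\<psi> ` grid_cell 2 ?e \<subseteq> C ?e"
      using \<psi>(2) min_cell(1)[OF two tc] min_cell_subset_bd[OF two t] by simp
    then have "\<psi> t \<in> C ?e" using te by blast
    then have "\<psi> t \<in> geo (L ?e)" using nA by (simp only: C_def if_False)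
    then have 1: "\<psi> t \<in> geo \<I>" "supp (\<psi> t) \<in> L ?e" unfolding L_iff by blast+
    then obtain j where j: "j < r" "nat \<lfloor>2 * t j\<rfloor> = 0" "\<beta> j \<notin> supp (\<psi> t)"
      by (auto simp: L_def Neg_def min_cell_def)
    then have "t j < 1/2" by linarith
    then show ?thesis using 1(1) j by (auto simp: sign_compatible_def)
  qed
  then show ?thesis using \<psi>(1) by blast
qed

text \<open>Factors are added one by one, without prescribed values. Each step truncates the earlier
  ones, so the first factor keeps only the inclusion of supports, which is what
  \<open>sign_compatible_mono\<close> asks for. Boundary cells have dimension below
  \<open>r\<close>, matching fibres of full rank.\<close>

lemma lift_to_deleted_product:
  assumes K: "finite_complex V K" and rank: "\<And>\<sigma>. \<sigma> \<in> K \<Longrightarrow> card \<sigma> \<le> r"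
    and ext: "\<And>S. S \<subseteq> V \<Longrightarrow> card S \<le> r * k \<Longrightarrow> extendable_below r (geo {\<sigma> \<in> K. \<sigma> \<inter> S = {}})"
    and \<psi>: "continuous_on (unit_cube_bd {..<r}) \<psi>" "\<And>t. t \<in> unit_cube_bd {..<r} \<Longrightarrow> \<psi> t \<in> geo K"
  shows "\<exists>f. continuous_on (unit_cube_bd {..<r}) f \<and>
    (\<forall>t\<in>unit_cube_bd {..<r}. f t \<in> disjoint_tuples (Suc k) K \<and> supp (f t 0) \<subseteq> supp (\<psi> t))"
  using ext
proof (induction k)
  case 0
  define f where "f t = (\<lambda>i::nat. if i = 0 then \<psi> t else undefined)" for t
  have "continuous_on (unit_cube_bd {..<r}) f"
  proof (rule continuous_on_coordinatewise_then_product)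
    show "continuous_on (unit_cube_bd {..<r}) (\<lambda>t. f t i)" for i
      using \<psi>(1) by (cases "i = 0") (simp_all add: f_def)
  qed
  moreover have "f t \<in> disjoint_tuples (Suc 0) K \<and> supp (f t 0) \<subseteq> supp (\<psi> t)"
    if "t \<in> unit_cube_bd {..<r}" for t
    using \<psi>(2)[OF that] by (simp add: f_def disjoint_tuples_def)
  ultimately show ?case by blast
next
  case (Suc k)
  let ?B = "unit_cube_bd {..<r}"
  have "r * k \<le> r * Suc k" by simp
  then obtain f where f: "continuous_on ?B f"
    "\<forall>t\<in>?B. f t \<in> disjoint_tuples (Suc k) K \<and> supp (f t 0) \<subseteq> supp (\<psi> t)"
    using Suc.IH Suc.prems by (meson order_trans)
  note fc = continuous_on_coordinate_comp[OF f(1)]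
  have fK: "f t i \<in> geo K" if "t \<in> ?B" "i < Suc k" for t i
    using f(2) that by (simp add: disjoint_tuples_def)
  have fdisj: "supp (f t i) \<inter> supp (f t j) = {}" if "t \<in> ?B" "i < Suc k" "j < Suc k" "i \<noteq> j" for t i j
    using f(2) that by (simp add: disjoint_tuples_def)
  have "\<exists>h. continuous_on ?B h \<and>
    (\<forall>t\<in>?B. h t \<in> geo K \<and> (\<forall>i<Suc k. supp (h t) \<inter> supp (shrink V (f t i)) = {})) \<and>
    (\<forall>t\<in>{}. h t = (\<lambda>_. undefined) t)"
  proof (rule deleted_product_lift[OF K finite_lessThan compact_unit_cube_bd cubical_unit_cube_bd cubical_empty
        _ _ rank Suc.prems fc fK])
    show "card (snd e) < r" if "N > 0" "e \<in> grid N {..<r}" "grid_cell N e \<subseteq> ?B" for N e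
      using card_grid_cell_bd[OF that(1) finite_lessThan that(2,3)] by simp
  qed simp_all
  then obtain h where h: "continuous_on ?B h"
    "\<forall>t\<in>?B. h t \<in> geo K \<and> (\<forall>i<Suc k. supp (h t) \<inter> supp (shrink V (f t i)) = {})"
    by (elim exE conjE)
  define f' where "f' t = (\<lambda>i. if i < Suc k then shrink V (f t i) else if i = Suc k then h t else undefined)" for t
  have "continuous_on ?B f'"
  proof (rule continuous_on_coordinatewise_then_product)
    fix i
    have "continuous_on ?B (\<lambda>t. shrink V (f t i))" if "i < Suc k"
      using fK that by (intro continuous_on_shrink[OF K fc])
    then show "continuous_on ?B (\<lambda>t. f' t i)"
      using h(1) by (cases "i < Suc k"; cases "i = Suc k") (simp_all add: f'_def)
  qed
  moreover have "f' t \<in> disjoint_tuples (Suc (Suc k)) K \<and> supp (f' t 0) \<subseteq> supp (\<psi> t)" if t: "t \<in> ?B" for t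
  proof
    have f'K: "f' t i \<in> geo K" if "i < Suc (Suc k)" for i
      using shrink_in_geo[OF K fK[OF t]] h(2) t that by (simp add: f'_def)
    have disj1: "supp (shrink V (f t i)) \<inter> supp (shrink V (f t j)) = {}" if "i < Suc k" "j < Suc k" "i \<noteq> j" for i j
      using supp_shrink_subset[OF K fK[OF t that(1)]] supp_shrink_subset[OF K fK[OF t that(2)]] fdisj[OF t that]
      by blast
    have disj2: "supp (h t) \<inter> supp (shrink V (f t i)) = {}" if "i < Suc k" for i
      using h(2) t that by simp
    have "supp (f' t i) \<inter> supp (f' t j) = {}" if ij: "i < Suc (Suc k)" "j < Suc (Suc k)" "i \<noteq> j" for i j
    proof -
      consider "i < Suc k" "j < Suc k" | "i = Suc k" "j < Suc k" | "i < Suc k" "j = Suc k"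
        using ij by linarith
      then show ?thesis
      proof cases
        case 1
        then show ?thesis using \<open>i \<noteq> j\<close> disj1 by (simp add: f'_def)
      qed (use disj2 in \<open>simp_all add: f'_def Int_commute\<close>)
    qed
    moreover have "f' t i = undefined" if "i \<ge> Suc (Suc k)" for i using that by (simp add: f'_def)
    ultimately show "f' t \<in> disjoint_tuples (Suc (Suc k)) K"
      using f'K by (simp add: disjoint_tuples_def)
    show "supp (f' t 0) \<subseteq> supp (\<psi> t)"
      using supp_shrink_subset[OF K fK[OF t, of 0]] f(2) t by (auto simp: f'_def)
  qed
  ultimately show ?case by blast
qed

text \<open>A map from the complex to the complement of the origin which restricts to the inclusion on the
  simplex of a basis \<open>B\<close> (identified with the standard simplex) and sends everything else outside
  the open positive orthant.\<close>

definition orthant_map :: "nat \<Rightarrow> (nat \<Rightarrow> 'a) \<Rightarrow> ('a \<Rightarrow> real) \<Rightarrow> nat \<Rightarrow> real" where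
  "orthant_map r \<beta> x = (\<lambda>j. if j < r then x (\<beta> j) - (1 - (\<Sum>i<r. x (\<beta> i))) else 0)"

lemma continuous_on_orthant_map:
  assumes "continuous_on S f"
  shows "continuous_on S (\<lambda>t. orthant_map r \<beta> (f t))"
proof (rule continuous_on_coordinatewise_then_product)
  fix j
  have "continuous_on S (\<lambda>t. f t (\<beta> j) - (1 - (\<Sum>i<r. f t (\<beta> i))))"
    by (intro continuous_on_diff continuous_on_sum continuous_on_const continuous_on_coordinate_comp[OF assms])
  then show "continuous_on S (\<lambda>t. orthant_map r \<beta> (f t) j)"
    by (cases "j < r") (simp_all add: orthant_map_def)
qed

lemma sum_basis_le_1:
  assumes K: "finite_complex V K" and x: "x \<in> geo K" and \<beta>: "inj_on \<beta> {..<r}" "\<beta> ` {..<r} \<subseteq> V"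
  shows "(\<Sum>i<r. x (\<beta> i)) \<le> 1"
proof -
  have x: "\<forall>v. 0 \<le> x v" "sum x V = 1" using x geo_iff[OF K] by blast+
  have "(\<Sum>i<r. x (\<beta> i)) = sum x (\<beta> ` {..<r})" using \<beta>(1) by (simp add: sum.reindex)
  also have "\<dots> \<le> sum x V" using \<beta>(2) x(1) finite_complexD(1)[OF K] by (intro sum_mono2) auto
  finally show ?thesis using x(2) by simp
qed

text \<open>At a zero all basis coordinates equal the weight \<open>\<phi>\<close> missing from the
  basis. It is not 0, since otherwise the coordinates would sum to 0 and \<open>\<phi>\<close> would
  be 1. So the support contains the basis, equals it by the rank bound, and no weight is missing
  after all.\<close>

lemma orthant_map_nonzero:
  assumes K: "finite_complex V K" and rank: "\<And>\<sigma>. \<sigma> \<in> K \<Longrightarrow> card \<sigma> \<le> r"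
    and x: "x \<in> geo K" and \<beta>: "inj_on \<beta> {..<r}" "\<beta> ` {..<r} \<subseteq> V"
  shows "\<exists>j<r. orthant_map r \<beta> x j \<noteq> 0"
proof (rule ccontr)
  assume "\<not> ?thesis"
  then have 0: "orthant_map r \<beta> x j = 0" if "j < r" for j using that by blast
  have eq: "x (\<beta> j) = 1 - (\<Sum>i<r. x (\<beta> i))" if "j < r" for j
    using 0[OF that] that unfolding orthant_map_def by simp
  define \<phi> where "\<phi> = 1 - (\<Sum>i<r. x (\<beta> i))"
  have xK: "supp x \<in> K" "sum x V = 1" using x geo_iff[OF K] by blast+
  have eq: "x (\<beta> j) = \<phi>" if "j < r" for j using eq[OF that] by (simp only: \<phi>_def)
  have "(\<Sum>i<r. x (\<beta> i)) = (\<Sum>i<r. \<phi>)"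
    by (intro sum.cong refl) (simp add: eq)
  then have "\<phi> \<noteq> 0" by (auto simp: \<phi>_def)
  then have sub: "\<beta> ` {..<r} \<subseteq> supp x" using eq by (auto simp: supp_def)
  have fin: "finite (supp x)" by (rule finite_subset[OF finite_complexD(2)[OF K xK(1)] finite_complexD(1)[OF K]])
  have "card (\<beta> ` {..<r}) = r" using \<beta>(1) by (simp add: card_image)
  then have "supp x = \<beta> ` {..<r}" using sub fin rank[OF xK(1)] by (metis card_seteq)
  then have "sum x V = sum x (\<beta> ` {..<r})"
    using \<beta>(2) finite_complexD(1)[OF K] by (intro sum.mono_neutral_right) (auto simp: supp_def)
  also have "\<dots> = (\<Sum>i<r. x (\<beta> i))" using \<beta>(1) by (simp add: sum.reindex)
  finally show False using \<open>\<phi> \<noteq> 0\<close> xK(2) by (simp add: \<phi>_def)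
qed

text \<open>Either \<open>t\<close> is negative in a direction where \<open>x\<close> has no weight,
  and both vectors are nonpositive there; or \<open>x\<close> lives on basis elements of positive
  directions, and both vectors are positive in one of them.\<close>

lemma orthant_map_not_antipodal:
  assumes K: "finite_complex V K" and x: "x \<in> geo K" and \<beta>: "inj_on \<beta> {..<r}" "\<beta> ` {..<r} \<subseteq> V"
    and sc: "sign_compatible r \<beta> t x" and s: "0 \<le> s" "s \<le> 1"
  shows "\<exists>j<r. (1 - s) * centred {..<r} t j + s * orthant_map r \<beta> x j \<noteq> 0"
proof (rule ccontr)
  assume "\<not> ?thesis"
  then have 0: "(1 - s) * centred {..<r} t j + s * orthant_map r \<beta> x j = 0" if "j < r" for j
    using that by blast
  have z: "(1 - s) * (2 * t j - 1) + s * (x (\<beta> j) - (1 - (\<Sum>i<r. x (\<beta> i)))) = 0" if "j < r" for j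
    using 0[OF that] that unfolding centred_def orthant_map_def by (simp only: if_True lessThan_iff)
  define \<phi> where "\<phi> = 1 - (\<Sum>i<r. x (\<beta> i))"
  have \<phi>: "\<phi> \<ge> 0" using sum_basis_le_1[OF K x \<beta>] by (simp add: \<phi>_def)
  have xK: "\<forall>v. 0 \<le> x v" "sum x V = 1" using x geo_iff[OF K] by blast+
  show False
  proof (cases "\<exists>j<r. t j < 1/2 \<and> \<beta> j \<notin> supp x")
    case True
    then obtain j where j: "j < r" "t j < 1/2" "x (\<beta> j) = 0" by (auto simp: supp_def)
    have zj: "(1 - s) * (2 * t j - 1) - s * \<phi> = 0" using z[OF j(1)] unfolding j(3) \<phi>_def by (simp only: diff_0 mult_minus_right)
    have "(1 - s) * (2 * t j - 1) \<le> 0" using s j(2) by (intro mult_nonneg_nonpos) auto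
    moreover have "0 \<le> s * \<phi>" using s \<phi> by simp
    ultimately have "(1 - s) * (2 * t j - 1) = 0" "s * \<phi> = 0" using zj by linarith+
    \<comment> \<open>Cancellation leaves \<open>s = 1\<close> with all weight on the basis; the
      other equations then make every basis coordinate vanish.\<close>
    then have "s = 1" "\<phi> = 0" using j(2) by auto
    then have "x (\<beta> i) = 0" if "i < r" for i using z[OF that] by (simp add: \<phi>_def)
    then show False using \<open>\<phi> = 0\<close> by (simp add: \<phi>_def)
  next
    case False
    then have sub: "supp x \<subseteq> \<beta> ` {j. j < r \<and> 1/2 < t j}" using sc by (auto simp: sign_compatible_def)
    then have "sum x V = sum x (\<beta> ` {..<r})"
      using \<beta>(2) finite_complexD(1)[OF K] by (intro sum.mono_neutral_right) (auto simp: supp_def)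
    also have "\<dots> = (\<Sum>i<r. x (\<beta> i))" using \<beta>(1) by (simp add: sum.reindex)
    finally have sum1: "(\<Sum>i<r. x (\<beta> i)) = 1" using xK(2) by simp
    then obtain j where "j < r" "x (\<beta> j) \<noteq> 0" by (metis lessThan_iff sum.neutral zero_neq_one)
    then have j: "j < r" "x (\<beta> j) > 0" using xK(1) by (auto simp: less_le)
    then have "\<beta> j \<in> supp x" by (simp add: supp_def)
    then obtain i where "i < r" "1/2 < t i" "\<beta> j = \<beta> i" using sub by auto
    then have "1/2 < t j" using \<beta>(1) j(1) by (metis inj_onD lessThan_iff)
    then have "0 < (1 - s) * (2 * t j - 1) + s * x (\<beta> j)"
      using j(2) s by (cases "s = 0") (auto intro: add_nonneg_pos)
    then show False using z[OF j(1)] sum1 by simp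
  qed
qed

text \<open>A form of the no-retraction theorem: normalizing \<open>Z\<close> along the segments
  from the centre of the cube would contract the sphere.\<close>

lemma no_nonvanishing_extension:
  assumes Z: "continuous_on (unit_cube {..<Suc n}) Z" "\<And>t. t \<in> unit_cube {..<Suc n} \<Longrightarrow> \<exists>j<Suc n. Z t j \<noteq> 0"
    and bd: "\<And>t j. t \<in> unit_cube_bd {..<Suc n} \<Longrightarrow> Z t j = centred {..<Suc n} t j"
  shows False
proof -
  let ?J = "{..<Suc n}"
  define S where "S = {x :: nat \<Rightarrow> real. (\<Sum>i\<le>n. (x i)\<^sup>2) = 1 \<and> (\<forall>i>n. x i = 0)}"
  have sph: "nsphere n = top_of_set S"
    unfolding nsphere S_def by (simp add: euclidean_product_topology)
  have ex: "\<exists>j\<in>?J. y j \<noteq> 0" if "y \<in> S" for y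
  proof (rule ccontr)
    assume "\<not> ?thesis"
    then have "(\<Sum>i\<le>n. (y i)\<^sup>2) = 0" by (intro sum.neutral) auto
    then show False using that by (simp add: S_def)
  qed
  \<comment> \<open>For fixed \<open>y\<close> this is the segment from the centre of the cube to
    the boundary point on the ray of \<open>y\<close>.\<close>
  define p :: "real \<times> (nat \<Rightarrow> real) \<Rightarrow> nat \<Rightarrow> real" where "p q = (\<lambda>j. if j < Suc n then 1/2 + fst q * (radial ?J (snd q) j - 1/2) else 0)" for q
  define norm2 where "norm2 v = sqrt (\<Sum>i\<le>n. (v i)\<^sup>2)" for v :: "nat \<Rightarrow> real"
  define h where "h q = (\<lambda>j. if j < Suc n then Z (p q) j / norm2 (Z (p q)) else 0)" for q
  have pin: "p q \<in> unit_cube ?J" if q: "q \<in> {0..1::real} \<times> S" for q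
  proof -
    obtain s y where sy: "q = (s, y)" "0 \<le> s" "s \<le> 1" "y \<in> S" using q by auto
    have "radial ?J y \<in> unit_cube ?J" using radial_in_bd[OF _ ex[OF sy(4)]] unit_cube_bd_subset by blast
    then have r: "\<bar>radial ?J y j - 1/2\<bar> \<le> 1/2" if "j < Suc n" for j
    proof -
      have "0 \<le> radial ?J y j" "radial ?J y j \<le> 1"
        using \<open>radial ?J y \<in> unit_cube ?J\<close> that by (auto simp: unit_cube_def)
      then show ?thesis by linarith
    qed
    have "0 \<le> p q j \<and> p q j \<le> 1" if "j < Suc n" for j
    proof -
      have "\<bar>s * (radial ?J y j - 1/2)\<bar> = s * \<bar>radial ?J y j - 1/2\<bar>" using sy by (simp add: abs_mult)
      also have "\<dots> \<le> 1 * (1/2)" using sy r[OF that] by (intro mult_mono) auto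
      finally have "\<bar>s * (radial ?J y j - 1/2)\<bar> \<le> 1/2" by simp
      then have "0 \<le> 1/2 + s * (radial ?J y j - 1/2) \<and> 1/2 + s * (radial ?J y j - 1/2) \<le> 1" by linarith
      then show ?thesis using that by (simp add: p_def sy(1))
    qed
    moreover have "p q j = 0" if "j \<notin> ?J" for j using that by (simp add: p_def)
    ultimately show ?thesis by (simp add: unit_cube_def)
  qed
  have npos: "norm2 v > 0" if v: "\<exists>j<Suc n. v j \<noteq> 0" for v
  proof -
    obtain j where "j \<le> n" "v j \<noteq> 0" using v by (auto simp: less_Suc_eq_le)
    then have "0 < (\<Sum>i\<le>n. (v i)\<^sup>2)" by (intro sum_pos2[of _ j]) auto
    then show ?thesis by (simp add: norm2_def)
  qed
  have pc: "continuous_on ({0..1} \<times> S) p"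
  proof (rule continuous_on_coordinatewise_then_product)
    fix j
    have "continuous_on ({0..1::real} \<times> S) (\<lambda>q. radial ?J (snd q))"
      using ex by (intro continuous_on_radial continuous_on_snd continuous_on_id) auto
    note rc = continuous_on_coordinate_comp[OF this]
    have "continuous_on ({0..1} \<times> S) (\<lambda>q. 1/2 + fst q * (radial ?J (snd q) j - 1/2))"
      by (intro continuous_on_add continuous_on_mult continuous_on_diff continuous_on_const
          continuous_on_fst continuous_on_id rc)
    then show "continuous_on ({0..1} \<times> S) (\<lambda>q. p q j)"
      by (cases "j < Suc n") (simp_all add: p_def)
  qed
  have Zpc: "continuous_on ({0..1} \<times> S) (\<lambda>q. Z (p q))"
    by (rule continuous_on_compose2[OF Z(1) pc]) (use pin in blast)
  have hc: "continuous_on ({0..1} \<times> S) h"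
  proof (rule continuous_on_coordinatewise_then_product)
    fix j
    have "continuous_on ({0..1} \<times> S) (\<lambda>q. norm2 (Z (p q)))"
      unfolding norm2_def
      by (intro continuous_on_real_sqrt continuous_on_sum continuous_on_power continuous_on_coordinate_comp[OF Zpc])
    moreover have "norm2 (Z (p q)) \<noteq> 0" if "q \<in> {0..1::real} \<times> S" for q
      using npos[OF Z(2)[OF pin[OF that]]] by simp
    ultimately have "continuous_on ({0..1} \<times> S) (\<lambda>q. Z (p q) j / norm2 (Z (p q)))"
      by (intro continuous_on_divide continuous_on_coordinate_comp[OF Zpc] ballI)
    then show "continuous_on ({0..1} \<times> S) (\<lambda>q. h q j)"
      by (cases "j < Suc n") (simp_all add: h_def)
  qed
  have hS: "h ` ({0..1} \<times> S) \<subseteq> S"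
  proof (rule image_subsetI)
    fix q :: "real \<times> (nat \<Rightarrow> real)" assume q: "q \<in> {0..1} \<times> S"
    have pos: "norm2 (Z (p q)) > 0" by (rule npos[OF Z(2)[OF pin[OF q]]])
    then have pos2: "(\<Sum>i\<le>n. (Z (p q) i)\<^sup>2) > 0" by (simp add: norm2_def)
    have "(\<Sum>i\<le>n. (h q i)\<^sup>2) = (\<Sum>i\<le>n. (Z (p q) i)\<^sup>2 / (norm2 (Z (p q)))\<^sup>2)"
      by (intro sum.cong refl) (simp add: h_def power_divide)
    also have "\<dots> = (\<Sum>i\<le>n. (Z (p q) i)\<^sup>2) / (norm2 (Z (p q)))\<^sup>2" by (simp add: sum_divide_distrib)
    also have "(norm2 (Z (p q)))\<^sup>2 = (\<Sum>i\<le>n. (Z (p q) i)\<^sup>2)"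
      unfolding norm2_def by (intro real_sqrt_pow2 sum_nonneg) simp
    finally show "h q \<in> S" using pos2 by (simp add: S_def h_def)
  qed
  \<comment> \<open>On the boundary \<open>Z\<close> points in the direction of \<open>y\<close>, so
    normalizing returns \<open>y\<close>: the homotopy ends in the identity.\<close>
  have h1: "h (1, y) = y" if y: "y \<in> S" for y
  proof -
    let ?m = "sup_norm ?J y"
    have m: "?m > 0" using ex[OF y] sup_norm_pos[OF finite_lessThan] by blast
    have "p (1, y) = radial ?J y" by (auto simp: p_def radial_def fun_eq_iff)
    then have Zp: "Z (p (1, y)) j = y j / ?m" if "j < Suc n" for j
      using bd[OF radial_in_bd[OF finite_lessThan ex[OF y]]] centred_radial[of j ?J y] that by simp
    have "(\<Sum>i\<le>n. (Z (p (1, y)) i)\<^sup>2) = (\<Sum>i\<le>n. (y i)\<^sup>2 / ?m\<^sup>2)"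
      by (intro sum.cong refl) (simp add: Zp power_divide)
    also have "\<dots> = 1 / ?m\<^sup>2" using y by (simp add: S_def flip: sum_divide_distrib)
    finally have "norm2 (Z (p (1, y))) = 1 / ?m" using m by (simp add: norm2_def real_sqrt_divide)
    then show ?thesis using Zp m y by (auto simp: h_def S_def fun_eq_iff)
  qed
  have h0: "h (0, y) = h (0, y')" for y y'
  proof -
    have "p (0, y) = p (0, y')" by (simp add: p_def fun_eq_iff)
    then show ?thesis unfolding h_def by (simp only:)
  qed
  have "contractible_space (nsphere n)"
    unfolding contractible_space_def sph
  proof (intro exI)
    let ?a = "h (0, \<lambda>_. 0)"
    have "homotopic_with (\<lambda>x. True) (top_of_set S) (top_of_set S) (\<lambda>_. ?a) id"
    proof (subst homotopic_with)
      show "\<exists>k. continuous_map (prod_topology (top_of_set {0..1::real}) (top_of_set S)) (top_of_set S) k \<and>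
        (\<forall>x\<in>topspace (top_of_set S). k (0, x) = ?a) \<and> (\<forall>x\<in>topspace (top_of_set S). k (1, x) = id x) \<and>
        (\<forall>t\<in>{0..1::real}. True)"
        using hc hS h0 h1 by (intro exI[of _ h] conjI ballI)
          (auto simp: continuous_map_in_subtopology simp flip: subtopology_Times)
    qed simp
    then show "homotopic_with (\<lambda>x. True) (top_of_set S) (top_of_set S) id (\<lambda>_. ?a)"
      by (rule homotopic_with_symD)
  qed
  then show False using non_contractible_space_nsphere by blast
qed

text \<open>Collapses all of the boundary of \<open>[-1, 1]\<^sup>n\<^sup>+\<^sup>1\<close> except for the bottom face to a ray, without moving any
  point to its antipode: this turns maps on the boundary into maps that are constant off one face.\<close>

definition wrap :: "nat \<Rightarrow> (nat \<Rightarrow> real) \<Rightarrow> nat \<Rightarrow> real" where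
  "wrap n x = (\<lambda>j. if j < n then max 0 (- x n - (\<Sum>i<n. \<bar>x i\<bar>)) * x j
     else if j = n then x n + 2 * (\<Sum>i<n. \<bar>x i\<bar>) else 0)"

lemma continuous_on_wrap:
  assumes "continuous_on S f"
  shows "continuous_on S (\<lambda>t. wrap n (f t))"
proof (rule continuous_on_coordinatewise_then_product)
  fix j
  note fc = continuous_on_coordinate_comp[OF assms]
  have s: "continuous_on S (\<lambda>t. \<Sum>i<n. \<bar>f t i\<bar>)" by (intro continuous_on_sum continuous_on_rabs fc)
  have "continuous_on S (\<lambda>t. max 0 (- f t n - (\<Sum>i<n. \<bar>f t i\<bar>)) * f t j)"
    by (intro continuous_on_mult continuous_on_max continuous_on_const continuous_on_diff continuous_on_minus s fc)
  moreover have "continuous_on S (\<lambda>t. f t n + 2 * (\<Sum>i<n. \<bar>f t i\<bar>))"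
    by (intro continuous_on_add continuous_on_mult continuous_on_const s fc)
  ultimately show "continuous_on S (\<lambda>t. wrap n (f t) j)"
    by (cases "j < n"; cases "j = n") (simp_all add: wrap_def)
qed

text \<open>If some \<open>x j\<close> with \<open>j < n\<close> is nonzero, its factor vanishes
  only for \<open>s = 1\<close> and \<open>- x n \<le> \<mu>\<close>, and then the last coordinate
  is at least \<open>\<mu> > 0\<close>. Otherwise the point is the centre of the top or bottom face,
  which \<open>wrap\<close> fixes. The case \<open>s = 1\<close> says that \<open>wrap\<close> does
  not vanish.\<close>

lemma wrap_not_antipodal:
  assumes t: "t \<in> unit_cube_bd {..<Suc n}" and s: "0 \<le> s" "s \<le> 1"
  shows "\<exists>j\<in>{..<Suc n}. (1 - s) * centred {..<Suc n} t j + s * wrap n (centred {..<Suc n} t) j \<noteq> 0"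
proof (rule ccontr)
  define x where "x = centred {..<Suc n} t"
  define \<mu> where "\<mu> = (\<Sum>i<n. \<bar>x i\<bar>)"
  assume "\<not> ?thesis"
  then have z: "(1 - s) * x j + s * wrap n x j = 0" if "j < Suc n" for j
    using that by (simp add: x_def)
  have zn: "(1 - s) * x n + s * (x n + 2 * \<mu>) = 0" using z[of n] by (simp add: wrap_def \<mu>_def)
  have zj: "((1 - s) + s * max 0 (- x n - \<mu>)) * x j = 0" if "j < n" for j
    using z[of j] that by (simp add: wrap_def \<mu>_def algebra_simps)
  show False
  proof (cases "\<exists>j<n. x j \<noteq> 0")
    case True
    then obtain j where j: "j < n" "x j \<noteq> 0" by blast
    then have sum0: "(1 - s) + s * max 0 (- x n - \<mu>) = 0" using zj by auto
    have "0 \<le> s * max 0 (- x n - \<mu>)" using s by simp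
    then have s1: "s = 1" using sum0 s by linarith
    then have "- x n - \<mu> \<le> 0" using sum0 by simp
    moreover have "\<bar>x j\<bar> \<le> \<mu>" unfolding \<mu>_def using j(1) by (intro member_le_sum) auto
    ultimately have "x n + 2 * \<mu> > 0" using j(2) by linarith
    then show False using zn s1 by simp
  next
    case False
    then have \<mu>0: "\<mu> = 0" by (simp add: \<mu>_def)
    have "x j \<noteq> 0" if "t j = 0 \<or> t j = 1" "j < Suc n" for j using that by (auto simp: x_def centred_def)
    moreover obtain j where "j < Suc n" "t j = 0 \<or> t j = 1" using t by (auto simp: unit_cube_bd_def)
    ultimately have "x n \<noteq> 0" using False by (metis less_Suc_eq)
    moreover have "x n = 0" using zn \<mu>0 by (simp add: algebra_simps)
    ultimately show False by simp
  qed
qed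

text \<open>Off the bottom face either \<open>x n = 1\<close> or the other coordinates have absolute
  values of sum at least 1. In both cases \<open>wrap\<close> kills these coordinates and leaves a
  positive last one.\<close>

lemma radial_wrap_const:
  assumes t: "t \<in> unit_cube_bd {..<Suc n}" and b: "t n = 1 \<or> (\<exists>j<n. t j = 0 \<or> t j = 1)"
  shows "radial {..<Suc n} (wrap n (centred {..<Suc n} t)) = radial {..<Suc n} (\<lambda>j. if j = n then 1 else 0)"
proof -
  define x where "x = centred {..<Suc n} t"
  define \<mu> where "\<mu> = (\<Sum>i<n. \<bar>x i\<bar>)"
  let ?J = "{..<Suc n}"
  have xn: "- 1 \<le> x n" using t by (auto simp: x_def centred_def unit_cube_bd_def unit_cube_def)
  have \<mu>0: "0 \<le> \<mu>" by (simp add: \<mu>_def sum_nonneg)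
  have "- x n - \<mu> \<le> 0 \<and> 0 < x n + 2 * \<mu>"
  proof (cases "t n = 1")
    case True
    then have "x n = 1" by (simp add: x_def centred_def)
    then show ?thesis using \<mu>0 by simp
  next
    case False
    then obtain j where j: "j < n" "t j = 0 \<or> t j = 1" using b by blast
    then have "\<bar>x j\<bar> = 1" by (auto simp: x_def centred_def)
    moreover have "\<bar>x j\<bar> \<le> \<mu>" unfolding \<mu>_def using j(1) by (intro member_le_sum) auto
    ultimately show ?thesis using xn by linarith
  qed
  moreover define c where "c = x n + 2 * \<mu>"
  ultimately have w: "wrap n x = (\<lambda>j. if j = n then c else 0)" and c: "c > 0"
    by (auto simp: wrap_def \<mu>_def fun_eq_iff)
  have sn: "sup_norm ?J (\<lambda>j. if j = n then d else 0) = d" if "d > 0" for d :: real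
    unfolding sup_norm_def using that by (intro Max_eqI) auto
  show ?thesis
    unfolding x_def[symmetric] w using c sn[OF c] sn[of 1] by (auto simp: radial_def)
qed

text \<open>The wrapped map is constant off the bottom face, so its restriction to that face
  represents an element of the homotopy set. A null-homotopy of it, with \<open>t n\<close> as time,
  has the right values on the bottom face by construction and the constant value on the other
  faces.\<close>

lemma n_connected_extend_wrap:
  assumes K: "finite_complex V K" and conn: "n_connected (int n) (deleted_product k K)"
    and f: "continuous_on (unit_cube_bd {..<Suc n}) f" "\<And>t. t \<in> unit_cube_bd {..<Suc n} \<Longrightarrow> f t \<in> disjoint_tuples k K"
  shows "\<exists>G. continuous_on (unit_cube {..<Suc n}) G \<and> G ` unit_cube {..<Suc n} \<subseteq> disjoint_tuples k K \<and>
    (\<forall>t\<in>unit_cube_bd {..<Suc n}. G t = f (radial {..<Suc n} (wrap n (centred {..<Suc n} t))))"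
proof -
  let ?J = "{..<Suc n}" and ?X = "deleted_product k K" and ?D = "disjoint_tuples k K"
  let ?B = "unit_cube_bd ?J"
  define w where "w t = radial ?J (wrap n (centred ?J t))" for t
  define q where "q = radial ?J (\<lambda>j. if j = n then 1 else 0)"
  have nz: "\<exists>j\<in>?J. wrap n (centred ?J t) j \<noteq> 0" if "t \<in> ?B" for t
    using wrap_not_antipodal[OF that, of 1] by simp
  have wB: "w t \<in> ?B" if "t \<in> ?B" for t
    unfolding w_def by (intro radial_in_bd nz that finite_lessThan)
  have wc: "continuous_on ?B w"
    unfolding w_def by (intro continuous_on_radial finite_lessThan continuous_on_wrap continuous_on_centred
        continuous_on_id nz)
  have wq: "w t = q" if "t \<in> ?B" "t n = 1 \<or> (\<exists>j<n. t j = 0 \<or> t j = 1)" for t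
    unfolding w_def q_def by (rule radial_wrap_const[OF that])
  have qB: "q \<in> ?B" unfolding q_def by (intro radial_in_bd) auto
  define x0 where "x0 = f q"
  have x0: "x0 \<in> ?D" using f(2)[OF qB] by (simp add: x0_def)
  then have x0X: "x0 \<in> topspace ?X" by (simp add: topspace_deleted_product[OF K])
  define \<phi> where "\<phi> y = f (w (cube_point n 0 y))" for y
  have cpB: "cube_point n 0 y \<in> ?B" if "y \<in> topspace (cube n)" for y
    using cube_point_in_unit_cube[OF that, of 0] by (auto simp: unit_cube_bd_def cube_point_def)
  have "continuous_map (cube n) ?X \<phi>"
  proof -
    have "continuous_map (cube n) (prod_topology (top_of_set {0..1}) (cube n)) (\<lambda>y. (0::real, y))"
      by (intro continuous_map_pairedI) (auto simp: continuous_map_in_subtopology)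
    from continuous_map_compose[OF this continuous_map_cube_point]
    have "continuous_map (cube n) (top_of_set (unit_cube ?J)) (\<lambda>y. cube_point n 0 y)"
      by (simp add: o_def)
    then have 1: "continuous_map (cube n) (top_of_set ?B) (\<lambda>y. cube_point n 0 y)"
      using cpB by (auto simp: continuous_map_in_subtopology)
    have "continuous_on ?B (\<lambda>t. f (w t))"
      by (rule continuous_on_compose2[OF f(1) wc]) (use wB in blast)
    then have "continuous_map (top_of_set ?B) ?X (\<lambda>t. f (w t))"
      using f(2) wB by (auto simp: continuous_map_deleted_product[OF K])
    from continuous_map_compose[OF 1 this] show ?thesis by (simp add: o_def \<phi>_def[abs_def])
  qed
  moreover have \<phi>0: "\<phi> ` cube_boundary n \<subseteq> {x0}"
  proof (rule image_subsetI)
    fix y assume y: "y \<in> cube_boundary n"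
    then have yt: "y \<in> topspace (cube n)" using cube_boundary_subset by blast
    obtain j where "j < n" "y j = 0 \<or> y j = 1" using y by (auto simp: cube_boundary_def)
    then have "\<exists>j<n. cube_point n 0 y j = 0 \<or> cube_point n 0 y j = 1" by (auto simp: cube_point_def)
    then show "\<phi> y \<in> {x0}" using wq[OF cpB[OF yt]] by (simp add: \<phi>_def x0_def)
  qed
  moreover have "is_singleton (homotopy_set n ?X x0)"
    using conn x0X unfolding n_connected_def by blast
  ultimately have "homotopic_with (\<lambda>h. h ` cube_boundary n \<subseteq> {x0}) (cube n) ?X \<phi> (\<lambda>_. x0)"
    unfolding is_singleton_homotopy_set[OF x0X] by blast
  then obtain L where L: "continuous_map (prod_topology (top_of_set {0..1::real}) (cube n)) ?X L"
    "\<And>y. L (0, y) = \<phi> y" "\<And>y. L (1, y) = x0" "\<And>s. s \<in> {0..1} \<Longrightarrow> (\<lambda>y. L (s, y)) ` cube_boundary n \<subseteq> {x0}"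
    unfolding homotopic_with_def by blast
  define G where "G t = L (t n, restrict t {..<n})" for t
  have "continuous_map (top_of_set (unit_cube ?J)) (prod_topology (top_of_set {0..1::real}) (cube n))
      (\<lambda>t. (t n, restrict t {..<n}))"
  proof (rule continuous_map_pairedI)
    show "continuous_map (top_of_set (unit_cube ?J)) (top_of_set {0..1}) (\<lambda>t. t n)"
      using continuous_on_coordinate by (auto simp: continuous_map_in_subtopology unit_cube_def)
    show "continuous_map (top_of_set (unit_cube ?J)) (cube n) (\<lambda>t. restrict t {..<n})"
      by (rule continuous_map_restrict_cube) simp
  qed
  from continuous_map_compose[OF this L(1)]
  have "continuous_map (top_of_set (unit_cube ?J)) ?X G" by (simp add: o_def G_def[abs_def])
  then have GD: "continuous_on (unit_cube ?J) G \<and> G ` unit_cube ?J \<subseteq> ?D"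
    unfolding continuous_map_deleted_product[OF K] .
  moreover have "G t = f (w t)" if t: "t \<in> ?B" for t
  proof -
    have tc: "t \<in> unit_cube ?J" using t unit_cube_bd_subset by blast
    show ?thesis
    proof (cases "t n = 1 \<or> (\<exists>j<n. t j = 0 \<or> t j = 1)")
      case True
      have "G t = x0"
      proof (cases "t n = 1")
        case True
        then show ?thesis by (simp add: G_def L(3))
      next
        case False
        then have "restrict t {..<n} \<in> cube_boundary n"
          using True tc by (auto simp: cube_boundary_def topspace_cube unit_cube_def)
        moreover have "t n \<in> {0..1}" using tc by (auto simp: unit_cube_def)
        ultimately show ?thesis using L(4) by (auto simp: G_def)
      qed
      then show ?thesis using wq[OF t True] by (simp add: x0_def)
    next
      case False
      then have tn: "t n = 0" using t by (auto simp: unit_cube_bd_def less_Suc_eq)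
      have "t j = 0" if "\<not> j < n" for j
        using that tn tc by (cases "j = n") (auto simp: unit_cube_def)
      then have "cube_point n 0 (restrict t {..<n}) = t"
        by (auto simp: cube_point_def fun_eq_iff)
      then show ?thesis using tn by (simp add: G_def L(2) \<phi>_def)
    qed
  qed
  ultimately show ?thesis unfolding w_def by (intro exI[of _ G]) simp
qed

text \<open>If the space were \<open>n\<close>-connected, the first factor of the extension followed
  by \<open>orthant_map\<close> would be a nonvanishing map on the cube. On the boundary it is
  deformed, without zeros, first to the wrapped vector \<open>v\<close> and then to
  \<open>centred\<close>, which has no nonvanishing extension.\<close>

lemma not_n_connected_deleted_product:
  assumes K: "finite_complex V K" and rank: "\<And>\<sigma>. \<sigma> \<in> K \<Longrightarrow> card \<sigma> \<le> Suc n"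
    and \<beta>: "inj_on \<beta> {..<Suc n}" "\<beta> ` {..<Suc n} \<subseteq> V" and k: "0 < k"
    and f: "continuous_on (unit_cube_bd {..<Suc n}) f"
      "\<And>t. t \<in> unit_cube_bd {..<Suc n} \<Longrightarrow> f t \<in> disjoint_tuples k K \<and> sign_compatible (Suc n) \<beta> t (f t 0)"
  shows "\<not> n_connected (int n) (deleted_product k K)"
proof
  assume conn: "n_connected (int n) (deleted_product k K)"
  let ?J = "{..<Suc n}"
  let ?B = "unit_cube_bd ?J"
  let ?\<kappa> = "orthant_map (Suc n) \<beta>"
  define v where "v t = wrap n (centred ?J t)" for t
  define Y where "Y = {y :: nat \<Rightarrow> real. \<exists>j<Suc n. y j \<noteq> 0}"
  have nz: "\<exists>j\<in>?J. v t j \<noteq> 0" if "t \<in> ?B" for t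
    using wrap_not_antipodal[OF that, of 1] by (simp add: v_def)
  have vB: "radial ?J (v t) \<in> ?B" if "t \<in> ?B" for t by (intro radial_in_bd nz that finite_lessThan)
  have vc: "continuous_on ?B v" unfolding v_def by (intro continuous_on_wrap continuous_on_centred continuous_on_id)
  have geo0: "x 0 \<in> geo K" if "x \<in> disjoint_tuples k K" for x
    using that k by (simp add: disjoint_tuples_def)
  have fD: "f t \<in> disjoint_tuples k K" if "t \<in> ?B" for t using f(2)[OF that] by simp
  have "\<exists>G. continuous_on (unit_cube ?J) G \<and> G ` unit_cube ?J \<subseteq> disjoint_tuples k K \<and>
    (\<forall>t\<in>?B. G t = f (radial ?J (v t)))"
    unfolding v_def by (rule n_connected_extend_wrap[OF K conn f(1) fD])
  then obtain G where G: "continuous_on (unit_cube ?J) G" "G ` unit_cube ?J \<subseteq> disjoint_tuples k K"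
    "\<forall>t\<in>?B. G t = f (radial ?J (v t))"
    by (elim exE conjE)
  have sq: "continuous_on ({0..1::real} \<times> ?B) (\<lambda>p. h (snd p))" if "continuous_on ?B h"
    for h :: "(nat \<Rightarrow> real) \<Rightarrow> nat \<Rightarrow> real"
    by (rule continuous_on_compose2[OF that continuous_on_snd[OF continuous_on_id]]) auto
  have "\<exists>Z. continuous_on (unit_cube ?J) Z \<and> Z ` unit_cube ?J \<subseteq> Y \<and>
    (\<forall>t\<in>?B. Z t = (\<lambda>p. mix (fst p) (v (snd p)) (?\<kappa> (f (radial ?J (v (snd p))) 0))) (0, t))"
  proof (rule homotopy_extension_unit_cube[OF finite_lessThan])
    have "continuous_on ?B (\<lambda>t. radial ?J (v t))"
      by (intro continuous_on_radial finite_lessThan vc nz)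
    then have "continuous_on ?B (\<lambda>t. f (radial ?J (v t)))"
      by (rule continuous_on_compose2[OF f(1)]) (use vB in blast)
    then have "continuous_on ?B (\<lambda>t. ?\<kappa> (f (radial ?J (v t)) 0))"
      by (rule continuous_on_orthant_map[OF continuous_on_coordinate_comp])
    from sq[OF this] sq[OF vc]
    show "continuous_on ({0..1} \<times> ?B) (\<lambda>p. mix (fst p) (v (snd p)) (?\<kappa> (f (radial ?J (v (snd p))) 0)))"
      by (intro continuous_on_mix continuous_on_fst continuous_on_id)
    show "(\<lambda>p. mix (fst p) (v (snd p)) (?\<kappa> (f (radial ?J (v (snd p))) 0))) ` ({0..1} \<times> ?B) \<subseteq> Y"
    proof (rule image_subsetI)
      fix p :: "real \<times> (nat \<Rightarrow> real)" assume "p \<in> {0..1} \<times> ?B"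
      then obtain s t where p: "p = (s, t)" "0 \<le> s" "s \<le> 1" and t: "t \<in> ?B" by auto
      let ?u = "radial ?J (v t)" and ?m = "sup_norm ?J (v t)"
      have m: "?m > 0" using nz[OF t] sup_norm_pos[OF finite_lessThan] by blast
      \<comment> \<open>\<open>v t\<close> is \<open>?m\<close> times the centred boundary point
        \<open>?u\<close>. Up to the factor \<open>c\<close>, the point at \<open>s\<close> on the
        segment from \<open>v t\<close> is the point at \<open>s / c\<close> on the segment from
        that boundary point, to which \<open>orthant_map_not_antipodal\<close> applies.\<close>
      define c where "c = (1 - s) * ?m + s"
      have c: "c > 0" "(1 - s) * ?m \<ge> 0"
        using p m by (cases "s = 0"; simp add: c_def add_nonneg_pos)+
      have s': "0 \<le> s / c" "s / c \<le> 1" using p c by (simp_all add: c_def field_simps)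
      obtain j where j: "j < Suc n" "(1 - s / c) * centred ?J ?u j + s / c * ?\<kappa> (f ?u 0) j \<noteq> 0"
        using orthant_map_not_antipodal[OF K geo0 \<beta> _ s', of "f ?u" ?u] f(2)[OF vB[OF t]] by blast
      have "c * ((1 - s / c) * a + s / c * d) = (c - s) * a + s * d" for a d
        using c(1) by (simp add: field_simps)
      note scale = this
      have cj: "centred ?J ?u j = v t j / ?m" by (rule centred_radial) (use j(1) in simp)
      have "c * ((1 - s / c) * centred ?J ?u j + s / c * ?\<kappa> (f ?u 0) j)
        = (c - s) * (v t j / ?m) + s * ?\<kappa> (f ?u 0) j"
        unfolding scale cj ..
      also have "\<dots> = mix s (v t) (?\<kappa> (f ?u 0)) j" using m by (simp add: c_def mix_def)
      finally have "mix s (v t) (?\<kappa> (f ?u 0)) j \<noteq> 0" using j(2) c(1) by (metis mult_eq_0_iff less_irrefl)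
      then show "mix (fst p) (v (snd p)) (?\<kappa> (f (radial ?J (v (snd p))) 0)) \<in> Y"
        using j(1) by (auto simp: p(1) Y_def)
    qed
    show "continuous_on (unit_cube ?J) (\<lambda>t. ?\<kappa> (G t 0))"
      by (rule continuous_on_orthant_map[OF continuous_on_coordinate_comp[OF G(1)]])
    show "(\<lambda>t. ?\<kappa> (G t 0)) ` unit_cube ?J \<subseteq> Y"
    proof (rule image_subsetI)
      fix t assume "t \<in> unit_cube ?J"
      then have "G t 0 \<in> geo K" using G(2) geo0 by blast
      then show "?\<kappa> (G t 0) \<in> Y" using orthant_map_nonzero[OF K rank _ \<beta>] by (simp add: Y_def)
    qed
    show "mix (fst (1, t)) (v (snd (1, t))) (?\<kappa> (f (radial ?J (v (snd (1, t)))) 0)) = ?\<kappa> (G t 0)"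
      if "t \<in> ?B" for t using G(3) that by simp
  qed
  then obtain Z where Z: "continuous_on (unit_cube ?J) Z" "Z ` unit_cube ?J \<subseteq> Y" "\<forall>t\<in>?B. Z t = v t"
    by auto
  have "\<exists>Z. continuous_on (unit_cube ?J) Z \<and> Z ` unit_cube ?J \<subseteq> Y \<and>
    (\<forall>t\<in>?B. Z t = (\<lambda>p. mix (fst p) (centred ?J (snd p)) (v (snd p))) (0, t))"
  proof (rule homotopy_extension_unit_cube[OF finite_lessThan _ _ Z(1,2)])
    have "continuous_on ?B (centred ?J)" using continuous_on_centred[OF continuous_on_id] by simp
    from sq[OF this] sq[OF vc]
    show "continuous_on ({0..1} \<times> ?B) (\<lambda>p. mix (fst p) (centred ?J (snd p)) (v (snd p)))"
      by (intro continuous_on_mix continuous_on_fst continuous_on_id)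
    show "(\<lambda>p. mix (fst p) (centred ?J (snd p)) (v (snd p))) ` ({0..1} \<times> ?B) \<subseteq> Y"
    proof (rule image_subsetI)
      fix p :: "real \<times> (nat \<Rightarrow> real)" assume "p \<in> {0..1} \<times> ?B"
      then obtain s t where p: "p = (s, t)" "0 \<le> s" "s \<le> 1" and t: "t \<in> ?B" by auto
      show "mix (fst p) (centred ?J (snd p)) (v (snd p)) \<in> Y"
        using wrap_not_antipodal[OF t p(2,3)] by (simp add: p(1) Y_def mix_def v_def Bex_def)
    qed
    show "mix (fst (1, t)) (centred ?J (snd (1, t))) (v (snd (1, t))) = Z t" if "t \<in> ?B" for t
      using Z(3) that by simp
  qed
  then obtain Z' where Z': "continuous_on (unit_cube ?J) Z'" "Z' ` unit_cube ?J \<subseteq> Y" "\<forall>t\<in>?B. Z' t = centred ?J t"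
    by auto
  show False
  proof (rule no_nonvanishing_extension[OF Z'(1)])
    show "\<exists>j<Suc n. Z' t j \<noteq> 0" if "t \<in> unit_cube ?J" for t
      using Z'(2) that by (auto simp: Y_def)
  qed (use Z'(3) in simp)
qed

section \<open>Rank bounds and conclusion\<close>

lemma extendable_below_mono: "extendable_below m Y \<Longrightarrow> n \<le> m \<Longrightarrow> extendable_below n Y"
  by (simp add: extendable_below_def)

lemma (in matroid) card_indep_le_basis:
  assumes "matroid_basis \<I> B" "A \<in> \<I>"
  shows "card A \<le> card B"
proof (rule ccontr)
  assume "\<not> ?thesis"
  then obtain x where "x \<in> A - B" "insert x B \<in> \<I>"
    using indep_exchange[of B A] assms by (auto simp: matroid_basis_def)
  then show False using assms(1) by (auto simp: matroid_basis_def)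
qed

text \<open>Averaging: if each of the \<open>b\<close> disjoint sets met \<open>S\<close> in more
  than \<open>card S div b\<close> points, \<open>S\<close> would be too large. Rounding down here
  is the origin of the floor in the theorem.\<close>

lemma ex_small_intersection:
  assumes b: "card \<B> = b" "b > 0" and dis: "pairwise disjnt \<B>" and S: "finite S"
  shows "\<exists>B\<in>\<B>. card (B \<inter> S) \<le> card S div b"
proof (rule ccontr)
  assume "\<not> ?thesis"
  then have gt: "Suc (card S div b) \<le> card (B \<inter> S)" if "B \<in> \<B>" for B using that by auto
  have fin: "finite \<B>" using b card_gt_0_iff by metis
  have "b * Suc (card S div b) = (\<Sum>B\<in>\<B>. Suc (card S div b))" using b(1) by simp
  also have "\<dots> \<le> (\<Sum>B\<in>\<B>. card (B \<inter> S))" using gt by (intro sum_mono)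
  also have "\<dots> = card (\<Union>B\<in>\<B>. B \<inter> S)"
    using dis S fin by (intro card_UN_disjoint[symmetric]) (auto simp: pairwise_def disjnt_def)
  also have "\<dots> \<le> card S" using S by (intro card_mono) auto
  finally have "b * Suc (card S div b) \<le> card S" .
  moreover have "card S < b * Suc (card S div b)" using dividend_less_times_div[of b "card S"] b(2) by simp
  ultimately show False by simp
qed

theorem theorem4p4:
  fixes b k r :: nat
    and E :: "'a set" and \<I> \<B> :: "'a set set"
  assumes "b \<ge> 2" "k \<ge> 2" "r \<ge> 2" "r \<ge> k" "b \<ge> k"
    and "matroid E \<I>"
    and "matroid_rank \<I> = r"
    and "card \<B> = b" "\<forall>B\<in>\<B>. matroid_basis \<I> B" "pairwise disjnt \<B>"
  shows "n_connected (int r - 2 - \<lfloor>real r * (real k - 1) / real b\<rfloor>) (deleted_product k \<I>) \<and>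
         (b \<ge> r * (k - 1) + 1 \<longrightarrow>
            n_connected (int r - 2) (deleted_product k \<I>) \<and>
            \<not> n_connected (int r - 1) (deleted_product k \<I>))"
proof -
  interpret matroid E \<I> by fact
  note K = matroid_finite_complex[OF assms(6)]
  have basis: "B \<in> \<I>" "card B = r" if "B \<in> \<B>" for B
    using assms(7,9) that matroid_rank_eq by (auto simp: matroid_basis_def)
  obtain B0 where B0: "B0 \<in> \<B>" using assms(1,8) by fastforce
  have rank: "card \<sigma> \<le> r" if "\<sigma> \<in> \<I>" for \<sigma>
    using card_indep_le_basis[of B0 \<sigma>] that assms(9) B0 basis(2)[OF B0] by simp
  define c where "c = r * (k - 1) div b"
  \<comment> \<open>From \<open>k - 1 < b\<close>. It keeps \<open>r - c\<close> positive, so that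
    the extension property includes nonemptiness.\<close>
  have c: "c < r"
    unfolding c_def using assms(2,3,5) by (intro less_mult_imp_div_less) simp
  have ext: "extendable_below (r - c) (geo {\<sigma> \<in> \<I>. \<sigma> \<inter> S = {}})"
    if S: "S \<subseteq> E" "card S \<le> r * (k - 1)" for S
  proof -
    have finS: "finite S" using S(1) finite_ground finite_subset by blast
    obtain B where B: "B \<in> \<B>" "card (B \<inter> S) \<le> card S div b"
      using ex_small_intersection[OF assms(8) _ assms(10) finS] assms(1) by auto
    have "card S div b \<le> c" unfolding c_def by (rule div_le_mono[OF S(2)])
    then have "r - c \<le> card B - card (B \<inter> S)" using B basis(2)[OF B(1)] by simp
    also have "\<dots> = card (B - S)" using finS by (simp add: card_Diff_subset_Int)
    finally have "r - c \<le> card (B - S)" .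
    moreover have "B - S \<in> {\<sigma> \<in> \<I>. \<sigma> \<inter> S = {}}"
      using indep_downward[OF basis(1)[OF B(1)], of "B - S"] by auto
    ultimately show ?thesis
      using extendable_below_mono matroid_extendable_below[OF matroid_deletion[OF assms(6)]] by blast
  qed
  have pos: "extendable_below (r - c) (disjoint_tuples k \<I>)"
    by (rule extendable_below_deleted_product[OF K rank ext])
  have "real r * (real k - 1) / real b = real (r * (k - 1)) / real b"
    using assms(2) by (simp add: of_nat_diff)
  then have fl: "\<lfloor>real r * (real k - 1) / real b\<rfloor> = int c"
    by (simp only: floor_divide_of_nat_eq c_def)
  have conn: "n_connected (int r - 2 - int c) (deleted_product k \<I>)"
    by (rule n_connected_deleted_product[OF K pos]) (use c in auto)
  moreover have "n_connected (int r - 2) (deleted_product k \<I>) \<and> \<not> n_connected (int r - 1) (deleted_product k \<I>)"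
    if big: "b \<ge> r * (k - 1) + 1"
  proof
    \<comment> \<open>Now some basis is disjoint from any given \<open>S\<close> of size at most
      \<open>r * (k - 1)\<close>, so all fibres have full rank.\<close>
    have c0: "c = 0" using big by (simp add: c_def)
    then show "n_connected (int r - 2) (deleted_product k \<I>)" using conn by simp
    obtain B1 where B1: "B1 \<in> \<B>" "B1 \<noteq> B0"
    proof -
      have "\<B> \<noteq> {B0}" using assms(1,8) by auto
      then show ?thesis using B0 that by blast
    qed
    have disj: "B0 \<inter> B1 = {}" using assms(10) B0 B1 by (auto simp: pairwise_def disjnt_def)
    have "finite B0" by (rule finite_subset[OF indep_subset[OF basis(1)[OF B0]] finite_ground])
    then obtain \<beta> where \<beta>: "bij_betw \<beta> {..<r} B0"
      using ex_bij_betw_nat_finite[of B0] basis(2)[OF B0] by (auto simp: atLeast0LessThan)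
    obtain \<psi> where \<psi>: "continuous_on (unit_cube_bd {..<r}) \<psi>"
      "\<forall>t\<in>unit_cube_bd {..<r}. \<psi> t \<in> geo \<I> \<and> sign_compatible r \<beta> t (\<psi> t)"
      using ex_sign_compatible_map[OF assms(6) basis(1)[OF B0] basis[OF B1(1)] disj \<beta>] by blast
    \<comment> \<open>The map \<open>\<psi>\<close> is the first factor, and \<open>k - 1\<close>
      further factors are lifted over it.\<close>
    obtain f where f: "continuous_on (unit_cube_bd {..<r}) f"
      "\<forall>t\<in>unit_cube_bd {..<r}. f t \<in> disjoint_tuples (Suc (k - 1)) \<I> \<and> supp (f t 0) \<subseteq> supp (\<psi> t)"
      using lift_to_deleted_product[OF K rank _ \<psi>(1), of "k - 1"] ext c0 \<psi>(2) by auto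
    have k: "Suc (k - 1) = k" using assms(2) by simp
    have r: "Suc (r - 1) = r" using assms(3) by simp
    have "\<not> n_connected (int (r - 1)) (deleted_product k \<I>)"
    proof (rule not_n_connected_deleted_product[OF K, of "r - 1" \<beta> k f, unfolded r])
      show "inj_on \<beta> {..<r}" "\<beta> ` {..<r} \<subseteq> E"
        using \<beta> indep_subset[OF basis(1)[OF B0]] by (auto simp: bij_betw_def)
      show "f t \<in> disjoint_tuples k \<I> \<and> sign_compatible r \<beta> t (f t 0)" if "t \<in> unit_cube_bd {..<r}" for t
        using f(2) \<psi>(2) that sign_compatible_mono unfolding k by blast
    qed (use rank f(1) assms(2) in auto)
    then show "\<not> n_connected (int r - 1) (deleted_product k \<I>)" using assms(3) by (simp add: of_nat_diff)
  qed
  ultimately show ?thesis unfolding fl by blast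
qed

end
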